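(* Let $\mathfrak{A}$ be an atomic von Neumann algebra and let $0 \le \varphi \in \mathfrak{A}_*$ be a faithful and normal state on $\mathfrak{A}$. Let $T \colon \mathfrak{A} \to \mathfrak{A}$ be a positive and unital linear operator such that $T'\varphi \le \varphi$. Then the following are equivalent: (a) The operator $T$ is invertible and its inverse operator $T^{-1}$ is positive. (b) The operator $T$ is a bijective isometry. (c) The operator $T$ is doubly power bounded.
   Context: A von Neumann algebra is atomic if every non-zero projection in it dominates a minimal projection. $\mathfrak{A}_*$ denotes the predual of $\mathfrak{A}$, i.e. the space of normal bounded linear functionals, regarded as a subspace of the dual space $\mathfrak{A}'$. $T'$ is the Banach space adjoint of $T$ on $\mathfrak{A}'$, so $T'\varphi = \varphi\circ T$; the order on $\mathfrak{A}'$ is given by positivity of functionals. $T$ is positive if it maps the positive cone $\mathfrak{A}_+$ into itself, and unital if $T\mathbf{1}=\mathbf{1}$. A bounded linear operator $T$ on a Banach space is doubly power bounded if it is bijective and $\sup_{n \in \mathbb{Z}} \|T^n\| < \infty$. *)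

theory Defs
  imports "HOL-Analysis.Analysis"
begin

class complex_vector = real_vector +
  fixes scaleC :: "complex \<Rightarrow> 'a \<Rightarrow> 'a"  (infixr "*\<^sub>C" 75)
  assumes scaleC_add_right: "c *\<^sub>C (x + y) = c *\<^sub>C x + c *\<^sub>C y"
    and scaleC_add_left: "(c + d) *\<^sub>C x = c *\<^sub>C x + d *\<^sub>C x"
    and scaleC_scaleC: "c *\<^sub>C d *\<^sub>C x = (c * d) *\<^sub>C x"
    and scaleC_of_real: "complex_of_real r *\<^sub>C x = r *\<^sub>R x"

text \<open>
  The complex inner product is linear in the second argument. Its real part is required to be the
  inner product of the underlying real inner product space, so that norm and topology are the ones
  induced by \<^term>\<open>cinner\<close>; positive definiteness is inherited as well, because
  \<^term>\<open>cinner x x\<close> is real by conjugate symmetry.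
\<close>

class complex_inner = complex_vector + real_inner +
  fixes cinner :: "'a \<Rightarrow> 'a \<Rightarrow> complex"
  assumes cinner_commute: "cinner x y = cnj (cinner y x)"
    and cinner_add_right: "cinner x (y + z) = cinner x y + cinner x z"
    and cinner_scaleC_right: "cinner x (c *\<^sub>C y) = c * cinner x y"
    and Re_cinner: "Re (cinner x y) = inner x y"

class chilbert_space = complex_inner + complete_space

instantiation complex :: chilbert_space
begin

definition scaleC_complex :: "complex \<Rightarrow> complex \<Rightarrow> complex"
  where "scaleC_complex c x = c * x"

definition cinner_complex :: "complex \<Rightarrow> complex \<Rightarrow> complex"
  where "cinner_complex x y = cnj x * y"

instance
  by standard
    (auto simp: scaleC_complex_def cinner_complex_def inner_complex_def scaleR_conv_of_real
      algebra_simps)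

end

lemma cinner_self: "cinner x x = complex_of_real ((norm x)\<^sup>2)"
  for x :: "'a::complex_inner"
proof -
  have "Im (cinner x x) = 0"
    using cinner_commute[of x x] by (metis cnj.simps(2) neg_equal_zero)
  then show ?thesis
    by (simp add: complex_eq_iff Re_cinner power2_norm_eq_inner)
qed

lemma norm_scaleC: "norm (c *\<^sub>C x) = cmod c * norm x"
  for x :: "'a::complex_inner"
proof -
  have "cinner (c *\<^sub>C x) (c *\<^sub>C x) = c * cnj c * cinner x x"
    using cinner_commute[of "c *\<^sub>C x" x] cinner_commute[of x x]
    by (simp add: cinner_scaleC_right mult.assoc)
  also have "\<dots> = complex_of_real ((cmod c)\<^sup>2 * (norm x)\<^sup>2)"
    by (simp add: cinner_self complex_norm_square[symmetric] del: of_real_power)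
  finally have "(norm (c *\<^sub>C x))\<^sup>2 = (cmod c * norm x)\<^sup>2"
    by (metis cinner_self of_real_eq_iff power_mult_distrib)
  then show ?thesis
    by simp
qed

lemma bounded_linear_scaleC: "bounded_linear (\<lambda>x::'a::complex_inner. c *\<^sub>C x)"
proof (rule bounded_linear_intro[where K = "cmod c"])
  show "c *\<^sub>C (r *\<^sub>R x) = r *\<^sub>R (c *\<^sub>C x)" for r and x :: 'a
    by (metis mult.commute scaleC_of_real scaleC_scaleC)
qed (simp_all add: scaleC_add_right norm_scaleC mult.commute)

instantiation blinfun :: (real_normed_vector, complex_inner) complex_vector
begin

definition scaleC_blinfun :: "complex \<Rightarrow> ('a \<Rightarrow>\<^sub>L 'b) \<Rightarrow> ('a \<Rightarrow>\<^sub>L 'b)"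
  where "scaleC_blinfun c S = Blinfun (\<lambda>x. c *\<^sub>C blinfun_apply S x)"

lemma scaleC_blinfun_apply: "blinfun_apply (c *\<^sub>C S) x = c *\<^sub>C blinfun_apply S x"
  for S :: "'a \<Rightarrow>\<^sub>L 'b"
  unfolding scaleC_blinfun_def
  by (subst bounded_linear_Blinfun_apply)
    (simp_all add: bounded_linear_compose[OF bounded_linear_scaleC] blinfun.bounded_linear_right)

instance
  by standard
    (auto intro!: blinfun_eqI simp: scaleC_blinfun_apply scaleC_add_right scaleC_add_left
      scaleC_scaleC scaleC_of_real blinfun.add_left blinfun.scaleR_left)

end

text \<open>
  The elements of the type \<^typ>\<open>'h \<Rightarrow>\<^sub>L 'h\<close> are the bounded real-linear operators, with the operator
  norm; \<open>B(H)\<close> is the subset of the complex-linear ones.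
\<close>

definition bounded_operators :: "('h::chilbert_space \<Rightarrow>\<^sub>L 'h) set"
  where "bounded_operators =
    {S. \<forall>c x. blinfun_apply S (c *\<^sub>C x) = c *\<^sub>C blinfun_apply S x}"

definition is_adjoint :: "('h::chilbert_space \<Rightarrow>\<^sub>L 'h) \<Rightarrow> ('h \<Rightarrow>\<^sub>L 'h) \<Rightarrow> bool"
  where "is_adjoint S R \<longleftrightarrow>
    (\<forall>x y. cinner (blinfun_apply R x) y = cinner x (blinfun_apply S y))"

definition selfadjoint :: "('h::chilbert_space \<Rightarrow>\<^sub>L 'h) \<Rightarrow> bool"
  where "selfadjoint S \<longleftrightarrow> is_adjoint S S"

definition positive_op :: "('h::chilbert_space \<Rightarrow>\<^sub>L 'h) \<Rightarrow> bool"
  where "positive_op S \<longleftrightarrow> (\<forall>x. cinner x (blinfun_apply S x) \<in> \<real>\<^sub>\<ge>\<^sub>0)"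

definition le_op :: "('h::chilbert_space \<Rightarrow>\<^sub>L 'h) \<Rightarrow> ('h \<Rightarrow>\<^sub>L 'h) \<Rightarrow> bool"
  where "le_op S R \<longleftrightarrow> positive_op (R - S)"

definition projection :: "('h::chilbert_space \<Rightarrow>\<^sub>L 'h) \<Rightarrow> bool"
  where "projection p \<longleftrightarrow> p o\<^sub>L p = p \<and> selfadjoint p"

definition commutant :: "('h::chilbert_space \<Rightarrow>\<^sub>L 'h) set \<Rightarrow> ('h \<Rightarrow>\<^sub>L 'h) set"
  where "commutant M = {S \<in> bounded_operators. \<forall>R\<in>M. S o\<^sub>L R = R o\<^sub>L S}"

definition unital_star_subalgebra :: "('h::chilbert_space \<Rightarrow>\<^sub>L 'h) set \<Rightarrow> bool"
  where "unital_star_subalgebra A \<longleftrightarrow>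
    A \<subseteq> bounded_operators \<and> id_blinfun \<in> A \<and>
    (\<forall>a\<in>A. \<forall>b\<in>A. a + b \<in> A \<and> a o\<^sub>L b \<in> A) \<and>
    (\<forall>c. \<forall>a\<in>A. c *\<^sub>C a \<in> A) \<and>
    (\<forall>a\<in>A. \<exists>b\<in>A. is_adjoint a b)"

definition von_neumann_algebra :: "('h::chilbert_space \<Rightarrow>\<^sub>L 'h) set \<Rightarrow> bool"
  where "von_neumann_algebra A \<longleftrightarrow>
    unital_star_subalgebra A \<and> commutant (commutant A) = A"

definition minimal_projection ::
    "('h::chilbert_space \<Rightarrow>\<^sub>L 'h) set \<Rightarrow> ('h \<Rightarrow>\<^sub>L 'h) \<Rightarrow> bool"
  where "minimal_projection A p \<longleftrightarrow>
    p \<in> A \<and> projection p \<and> p \<noteq> 0 \<and>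
    (\<forall>q\<in>A. projection q \<and> le_op q p \<longrightarrow> q = 0 \<or> q = p)"

definition atomic :: "('h::chilbert_space \<Rightarrow>\<^sub>L 'h) set \<Rightarrow> bool"
  where "atomic A \<longleftrightarrow>
    (\<forall>q\<in>A. projection q \<and> q \<noteq> 0 \<longrightarrow> (\<exists>p. minimal_projection A p \<and> le_op p q))"

text \<open>
  Functionals and operators on an algebra \<open>A\<close> are represented by total functions of which only
  the values on \<open>A\<close> matter.
\<close>

definition dual_space :: "('h::chilbert_space \<Rightarrow>\<^sub>L 'h) set \<Rightarrow> (('h \<Rightarrow>\<^sub>L 'h) \<Rightarrow> complex) set"
  where "dual_space A = {\<phi>.
    (\<forall>a\<in>A. \<forall>b\<in>A. \<phi> (a + b) = \<phi> a + \<phi> b) \<and>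
    (\<forall>c. \<forall>a\<in>A. \<phi> (c *\<^sub>C a) = c * \<phi> a) \<and>
    (\<exists>K. \<forall>a\<in>A. cmod (\<phi> a) \<le> K * norm a)}"

definition supremum_in ::
    "('h::chilbert_space \<Rightarrow>\<^sub>L 'h) set \<Rightarrow> ('h \<Rightarrow>\<^sub>L 'h) set \<Rightarrow> ('h \<Rightarrow>\<^sub>L 'h) \<Rightarrow> bool"
  where "supremum_in A D s \<longleftrightarrow>
    s \<in> A \<and> selfadjoint s \<and> (\<forall>d\<in>D. le_op d s) \<and>
    (\<forall>b\<in>A. selfadjoint b \<and> (\<forall>d\<in>D. le_op d b) \<longrightarrow> le_op s b)"

definition upward_directed :: "('h::chilbert_space \<Rightarrow>\<^sub>L 'h) set \<Rightarrow> bool"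
  where "upward_directed D \<longleftrightarrow>
    D \<noteq> {} \<and> (\<forall>a\<in>D. \<forall>b\<in>D. \<exists>d\<in>D. le_op a d \<and> le_op b d)"

text \<open>
  Order continuity: \<open>\<phi>\<close> converges along every bounded increasing net of self-adjoint elements to its
  value at the supremum. The net is given by its range, an upward directed set indexed by itself;
  it is bounded above because it has a supremum.
\<close>

definition normal_functional ::
    "('h::chilbert_space \<Rightarrow>\<^sub>L 'h) set \<Rightarrow> (('h \<Rightarrow>\<^sub>L 'h) \<Rightarrow> complex) \<Rightarrow> bool"
  where "normal_functional A \<phi> \<longleftrightarrow>
    (\<forall>D s. D \<subseteq> A \<and> (\<forall>d\<in>D. selfadjoint d) \<and> upward_directed D \<and> supremum_in A D s \<longrightarrow>
      (\<forall>\<epsilon>>0. \<exists>d\<^sub>0\<in>D. \<forall>d\<in>D. le_op d\<^sub>0 d \<longrightarrow> cmod (\<phi> d - \<phi> s) < \<epsilon>))"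

definition predual :: "('h::chilbert_space \<Rightarrow>\<^sub>L 'h) set \<Rightarrow> (('h \<Rightarrow>\<^sub>L 'h) \<Rightarrow> complex) set"
  where "predual A = {\<phi> \<in> dual_space A. normal_functional A \<phi>}"

definition functional_le ::
    "('h::chilbert_space \<Rightarrow>\<^sub>L 'h) set \<Rightarrow> (('h \<Rightarrow>\<^sub>L 'h) \<Rightarrow> complex) \<Rightarrow>
      (('h \<Rightarrow>\<^sub>L 'h) \<Rightarrow> complex) \<Rightarrow> bool"
  where "functional_le A \<phi> \<psi> \<longleftrightarrow> (\<forall>a\<in>A. positive_op a \<longrightarrow> \<psi> a - \<phi> a \<in> \<real>\<^sub>\<ge>\<^sub>0)"

definition state :: "('h::chilbert_space \<Rightarrow>\<^sub>L 'h) set \<Rightarrow> (('h \<Rightarrow>\<^sub>L 'h) \<Rightarrow> complex) \<Rightarrow> bool"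
  where "state A \<phi> \<longleftrightarrow>
    \<phi> \<in> dual_space A \<and> functional_le A (\<lambda>_. 0) \<phi> \<and> \<phi> id_blinfun = 1"

definition faithful :: "('h::chilbert_space \<Rightarrow>\<^sub>L 'h) set \<Rightarrow> (('h \<Rightarrow>\<^sub>L 'h) \<Rightarrow> complex) \<Rightarrow> bool"
  where "faithful A \<phi> \<longleftrightarrow> (\<forall>a\<in>A. positive_op a \<and> \<phi> a = 0 \<longrightarrow> a = 0)"

definition linear_operator_on ::
    "('h::chilbert_space \<Rightarrow>\<^sub>L 'h) set \<Rightarrow> (('h \<Rightarrow>\<^sub>L 'h) \<Rightarrow> ('h \<Rightarrow>\<^sub>L 'h)) \<Rightarrow> bool"
  where "linear_operator_on A T \<longleftrightarrow>
    (\<forall>a\<in>A. T a \<in> A) \<and>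
    (\<forall>a\<in>A. \<forall>b\<in>A. T (a + b) = T a + T b) \<and>
    (\<forall>c. \<forall>a\<in>A. T (c *\<^sub>C a) = c *\<^sub>C T a)"

definition positive_cone :: "('h::chilbert_space \<Rightarrow>\<^sub>L 'h) set \<Rightarrow> ('h \<Rightarrow>\<^sub>L 'h) set"
  where "positive_cone A = {a \<in> A. positive_op a}"

definition positive_operator_on ::
    "('h::chilbert_space \<Rightarrow>\<^sub>L 'h) set \<Rightarrow> (('h \<Rightarrow>\<^sub>L 'h) \<Rightarrow> ('h \<Rightarrow>\<^sub>L 'h)) \<Rightarrow> bool"
  where "positive_operator_on A T \<longleftrightarrow> T ` positive_cone A \<subseteq> positive_cone A"

definition dual_operator ::
    "(('h::chilbert_space \<Rightarrow>\<^sub>L 'h) \<Rightarrow> ('h \<Rightarrow>\<^sub>L 'h)) \<Rightarrow> (('h \<Rightarrow>\<^sub>L 'h) \<Rightarrow> complex) \<Rightarrow>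
      (('h \<Rightarrow>\<^sub>L 'h) \<Rightarrow> complex)"
  where "dual_operator T \<phi> = \<phi> \<circ> T"

definition isometry_on ::
    "('h::chilbert_space \<Rightarrow>\<^sub>L 'h) set \<Rightarrow> (('h \<Rightarrow>\<^sub>L 'h) \<Rightarrow> ('h \<Rightarrow>\<^sub>L 'h)) \<Rightarrow> bool"
  where "isometry_on A T \<longleftrightarrow> (\<forall>a\<in>A. norm (T a) = norm a)"

definition int_power ::
    "('h::chilbert_space \<Rightarrow>\<^sub>L 'h) set \<Rightarrow> (('h \<Rightarrow>\<^sub>L 'h) \<Rightarrow> ('h \<Rightarrow>\<^sub>L 'h)) \<Rightarrow> int \<Rightarrow>
      (('h \<Rightarrow>\<^sub>L 'h) \<Rightarrow> ('h \<Rightarrow>\<^sub>L 'h))"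
  where "int_power A T n =
    (if 0 \<le> n then T ^^ nat n else inv_into A T ^^ nat (- n))"

text \<open>
  The constant \<open>K\<close> is a common bound for the operator norms of all integer powers of \<open>T\<close>; the case
  \<open>n = 1\<close> says that \<open>T\<close> itself is bounded.
\<close>

definition doubly_power_bounded_on ::
    "('h::chilbert_space \<Rightarrow>\<^sub>L 'h) set \<Rightarrow> (('h \<Rightarrow>\<^sub>L 'h) \<Rightarrow> ('h \<Rightarrow>\<^sub>L 'h)) \<Rightarrow> bool"
  where "doubly_power_bounded_on A T \<longleftrightarrow>
    bij_betw T A A \<and> (\<exists>K. \<forall>n::int. \<forall>a\<in>A. norm (int_power A T n a) \<le> K * norm a)"

end

theory Submission
  imports Defs
begin

text \<open>
  That (b) implies (c) is clear, and (b) implies (a) because a self-adjoint \<open>b\<close> is positive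
  if and only if \<open>\<parallel>c - b\<parallel> \<le> c\<close> for large \<open>c\<close>.

  (a) implies (b): Kadison's inequality \<open>T(a)\<^sup>2 \<le> T(a\<^sup>2)\<close> for \<open>T\<close> and its inverse makes \<open>T\<close> a Jordan
  homomorphism, so \<open>T(a a\<^sup>* a) = T(a) T(a)\<^sup>* T(a)\<close>. As \<open>\<parallel>a a\<^sup>* a\<parallel> = \<parallel>a\<parallel>\<^sup>3\<close>, iterating this identity
  turns any bound on \<open>\<parallel>T\<parallel>\<close> into the bound 1.

  (c) implies (a): Let \<open>T b = a \<ge> 0\<close>, and let \<open>\<psi>\<close> be a functional with \<open>0 \<le> \<psi> \<le> C \<phi>\<close>. All
  \<open>\<psi> \<circ> T\<^sup>n\<close> are dominated by \<open>C \<phi>\<close>, and the set of such functionals is totally bounded in norm: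
  up to a small error a normal \<open>\<phi>\<close> lives on a corner \<open>p A p\<close> with \<open>p\<close> a finite sum of minimal
  projections, and this corner is finite-dimensional. Hence \<open>\<psi> \<circ> T\<^sup>m\<close> and \<open>\<psi> \<circ> T\<^sup>n\<close> are close for
  some \<open>m < n\<close>, and the bound on the negative powers makes \<open>\<psi>(b)\<close> close to
  \<open>\<psi>(T\<^bsup>n-m-1\<^esup> a) \<ge> 0\<close>, so \<open>\<psi>(b) \<ge> 0\<close>. There are enough such \<open>\<psi>\<close> to conclude \<open>b \<ge> 0\<close>: if \<open>\<rho>\<close> is the
  density of \<open>\<phi>\<close>, the vector functionals of the vectors \<open>\<rho> \<zeta>\<close> are dominated by multiples of \<open>\<phi>\<close>,
  and these vectors are dense because \<open>\<phi>\<close> is faithful.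
\<close>

text \<open>The density \<rho> is never built as an operator. If \<open>x\<close> is a unit vector
  in the range of a minimal projection \<open>e\<close>, then
  \<open>a \<odot> e \<mapsto> a x\<close> is isometric, and the single vectors \<rho> (z x) come
  from Riesz representation on the closure of \<open>A x\<close>. This yields positivity of the form
  of \<open>b\<close> only at such vectors \<open>x\<close>; atomicity makes them sufficient,
  because a non-zero negative part of \<open>b\<close> would have a minimal projection below its
  range projection. Minimality is exploited in the form that \<open>e A e\<close> consists of
  scalars and \<open>e A f\<close> is at most one-dimensional. No spectral theorem enters. Square
  roots come from an iteration, range projections from the bicommutant property, positive and
  negative parts from both, and Kadison's inequality from Bernstein polynomials. The initial bound
  on the norm of \<open>T\<close> is 2, one for the real and one for the imaginary part; this loss
  is harmless, as the Jordan identity removes it.\<close>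

abbreviation mult_op :: "('h::real_normed_vector \<Rightarrow>\<^sub>L 'h) \<Rightarrow> ('h \<Rightarrow>\<^sub>L 'h) \<Rightarrow> ('h \<Rightarrow>\<^sub>L 'h)"
    (infixl "\<odot>" 70)
  where "a \<odot> b \<equiv> a o\<^sub>L b"

section \<open>Complex Hilbert spaces\<close>

lemma cinner_add_left: "cinner (x + y) z = cinner x z + cinner y z"
  by (metis cinner_add_right cinner_commute complex_cnj_add)

lemma cinner_scaleC_left: "cinner (c *\<^sub>C x) y = cnj c * cinner x y"
  by (metis cinner_commute cinner_scaleC_right complex_cnj_mult)

lemma scaleC_1 [simp]: "1 *\<^sub>C x = (x::'a::complex_vector)"
  by (metis of_real_1 scaleC_of_real scaleR_one)

lemma scaleC_zero_left [simp]: "0 *\<^sub>C x = (0::'a::complex_vector)"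
  by (metis of_real_0 scaleC_of_real scaleR_zero_left)

lemma scaleC_minus1: "(- 1) *\<^sub>C x = - (x::'a::complex_vector)"
  by (metis of_real_1 of_real_minus scaleC_of_real scaleR_minus1_left)

lemma cinner_scaleR_right: "cinner x (r *\<^sub>R y) = of_real r * cinner x y"
  by (metis cinner_scaleC_right scaleC_of_real)

lemma cinner_scaleR_left: "cinner (r *\<^sub>R x) y = of_real r * cinner x y"
  by (metis cinner_scaleC_left complex_cnj_complex_of_real scaleC_of_real)

lemma cmod_cinner_le: "cmod (cinner x y) \<le> norm x * norm y"
proof (cases "cinner x y = 0")
  case False
  define u where "u = cnj (cinner x y) / cmod (cinner x y)"
  have u: "u * cinner x y = cmod (cinner x y)"
    using False by (simp add: u_def mult.commute power2_eq_square flip: complex_norm_square)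
  have nu: "cmod u = 1" using False by (simp add: u_def norm_divide)
  have "cmod (cinner x y) = Re (cinner x (u *\<^sub>C y))"
    using u by (simp add: cinner_scaleC_right)
  also have "\<dots> \<le> norm x * norm (u *\<^sub>C y)"
    by (simp add: Re_cinner norm_cauchy_schwarz)
  finally show ?thesis by (simp add: norm_scaleC nu)
qed simp

lemma bounded_bilinear_cinner: "bounded_bilinear (cinner :: 'a::complex_inner \<Rightarrow> 'a \<Rightarrow> complex)"
proof
  show "\<exists>K. \<forall>a b::'a. cmod (cinner a b) \<le> norm a * norm b * K"
    by (rule exI[of _ 1]) (simp add: cmod_cinner_le)
qed (auto simp: cinner_add_left cinner_add_right cinner_scaleR_left cinner_scaleR_right scaleR_conv_of_real)

interpretation cinner: bounded_bilinear "cinner :: 'a::complex_inner \<Rightarrow> 'a \<Rightarrow> complex"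
  by (rule bounded_bilinear_cinner)

lemmas cinner_simps = cinner.add_left cinner.add_right cinner.diff_left cinner.diff_right
  cinner.minus_left cinner.minus_right cinner.zero_left cinner.zero_right
  cinner_scaleC_left cinner_scaleC_right cinner_scaleR_left cinner_scaleR_right

text \<open>
  The graph of a bounded linear functional on a subspace, given as a relation so that neither
  well-definedness nor closedness of its domain has to be established beforehand.
\<close>

lemma riesz_representation_graph:
  fixes G :: "('a::{real_inner, complete_space} \<times> real) set"
  assumes sub: "subspace G" and bd: "\<And>v s. (v, s) \<in> G \<Longrightarrow> \<bar>s\<bar> \<le> K * norm v"
  obtains \<xi> where "\<xi> \<in> closure (fst ` G)" "\<And>v s. (v, s) \<in> G \<Longrightarrow> s = inner \<xi> v"
proof -
  \<comment> \<open>On a graph \<open>s = inner \<xi> v\<close> this is the squared distance of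
    \<open>v\<close> from \<xi> minus the square of the norm of \<xi>, so minimizing
    \<open>J\<close> finds \<xi>.\<close>
  define J where "J = (\<lambda>(v, s). (norm (v::'a))\<^sup>2 - 2 * (s::real))"
  have K: "J (v, s) \<ge> - K\<^sup>2" if "(v, s) \<in> G" for v s
  proof -
    have "2 * s \<le> 2 * (K * norm v)" using bd[OF that] by auto
    moreover have "0 \<le> (norm v - K)\<^sup>2" by simp
    ultimately show ?thesis by (simp add: J_def power2_eq_square algebra_simps)
  qed
  define m where "m = Inf (J ` G)"
  have G0: "(0, 0) \<in> G" using subspace_0[OF sub] by (simp add: zero_prod_def)
  have bdb: "bdd_below (J ` G)"
    by (rule bdd_belowI[of _ "- K\<^sup>2"]) (use K in auto)
  have mle: "m \<le> J g" if "g \<in> G" for g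
    unfolding m_def using bdb that by (intro cInf_lower) auto
  have "\<exists>g\<in>G. J g < m + 1 / real (Suc n)" for n
    using cInf_lessD[of "J ` G" "m + 1 / real (Suc n)"] G0 unfolding m_def by auto
  then obtain g where gG: "\<And>n. g n \<in> G" and gJ: "\<And>n. J (g n) < m + 1 / real (Suc n)"
    by metis
  \<comment> \<open>Parallelogram law: the linear parts of \<open>J\<close> cancel, so two
    near-minimizers are close to each other.\<close>
  have par: "(norm (v - w))\<^sup>2 = 2 * J (v, s) + 2 * J (w, t) - 4 * J ((1/2) *\<^sub>R ((v, s) + (w, t)))" for v w s t
    by (simp add: J_def power2_norm_eq_inner inner_simps inner_commute algebra_simps)
  have key: "(norm (fst p - fst q))\<^sup>2 \<le> 2 * (J p - m) + 2 * (J q - m)" if "p \<in> G" "q \<in> G" for p q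
  proof -
    have "(1/2) *\<^sub>R (p + q) \<in> G"
      using sub that by (intro subspace_scale subspace_add)
    from mle[OF this] par[of "fst p" "fst q" "snd p" "snd q"] show ?thesis by simp
  qed
  have "Cauchy (\<lambda>n. fst (g n))"
  proof (rule metric_CauchyI)
    fix e :: real assume e: "e > 0"
    obtain N where N: "1 / real (Suc N) < e\<^sup>2 / 4"
      using e by (meson nat_approx_posE zero_less_divide_iff zero_less_power zero_less_numeral)
    have "dist (fst (g p)) (fst (g q)) < e" if "p \<ge> N" "q \<ge> N" for p q
    proof -
      have "1 / real (Suc p) \<le> 1 / real (Suc N)" "1 / real (Suc q) \<le> 1 / real (Suc N)"
        using that by (auto simp: field_simps)
      then have "(norm (fst (g p) - fst (g q)))\<^sup>2 < e\<^sup>2"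
        using key[OF gG[of p] gG[of q]] gJ[of p] gJ[of q] N by argo
      then show ?thesis using e by (simp add: dist_norm power_less_imp_less_base)
    qed
    then show "\<exists>N. \<forall>p\<ge>N. \<forall>q\<ge>N. dist (fst (g p)) (fst (g q)) < e" by blast
  qed
  then obtain \<xi> where lim: "(\<lambda>n. fst (g n)) \<longlonglongrightarrow> \<xi>"
    using convergent_eq_Cauchy by blast
  have cl: "\<xi> \<in> closure (fst ` G)"
    using lim gG closure_sequential by (metis image_eqI)
  have Jlim: "(\<lambda>n. J (g n)) \<longlonglongrightarrow> m"
  proof (rule tendsto_sandwich[of "\<lambda>_. m" _ _ "\<lambda>n. m + 1 / real (Suc n)"])
    show "(\<lambda>n. m + 1 / real (Suc n)) \<longlonglongrightarrow> m"
      using tendsto_add[OF tendsto_const LIMSEQ_inverse_real_of_nat, of m] by (simp add: inverse_eq_divide)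
    show "\<forall>\<^sub>F n in sequentially. m \<le> J (g n)"
      by (simp add: mle gG)
    show "\<forall>\<^sub>F n in sequentially. J (g n) \<le> m + 1 / real (Suc n)"
      by (intro always_eventually allI less_imp_le gJ)
  qed simp
  \<comment> \<open>First variation of \<open>J\<close> at the limit of the minimizing sequence, in
    the direction \<open>(v, s)\<close>.\<close>
  have var: "0 \<le> 2 * t * (inner \<xi> v - s) + t\<^sup>2 * (norm v)\<^sup>2" if vs: "(v, s) \<in> G" for v s t
  proof -
    have "m \<le> J (g n) + (2 * t * (inner (fst (g n)) v - s) + t\<^sup>2 * (norm v)\<^sup>2)" for n
    proof -
      have "g n + t *\<^sub>R (v, s) \<in> G" using gG sub vs by (intro subspace_add subspace_scale)
      from mle[OF this] show ?thesis
        by (simp add: J_def case_prod_beta power2_norm_eq_inner inner_add_left inner_add_right inner_commute[of v "fst (g n)"]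
            power2_eq_square[of t] algebra_simps)
    qed
    moreover have "(\<lambda>n. J (g n) + (2 * t * (inner (fst (g n)) v - s) + t\<^sup>2 * (norm v)\<^sup>2))
       \<longlonglongrightarrow> m + (2 * t * (inner \<xi> v - s) + t\<^sup>2 * (norm v)\<^sup>2)"
      by (intro tendsto_intros Jlim lim)
    ultimately have "m \<le> m + (2 * t * (inner \<xi> v - s) + t\<^sup>2 * (norm v)\<^sup>2)"
      by (meson LIMSEQ_le_const)
    then show ?thesis by simp
  qed
  have "s = inner \<xi> v" if vs: "(v, s) \<in> G" for v s
  proof (rule ccontr)
    define d where "d = inner \<xi> v - s"
    \<comment> \<open>The optimal parameter would be \<open>- d / (norm v)\<^sup>2\<close>; adding 1
      avoids division by zero and still gives a negative value.\<close>
    define N where "N = 1 + (norm v)\<^sup>2"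
    have N: "N > 0" unfolding N_def by (simp add: add_pos_nonneg)
    assume "s \<noteq> inner \<xi> v"
    then have d: "d\<^sup>2 > 0" by (simp add: d_def)
    have "0 \<le> 2 * (- d / N) * d + (- d / N)\<^sup>2 * (norm v)\<^sup>2"
      using var[OF vs, of "- d / N"] by (simp add: d_def)
    also have "\<dots> \<le> 2 * (- d / N) * d + (- d / N)\<^sup>2 * N"
      by (intro add_left_mono mult_left_mono) (auto simp: N_def)
    also have "\<dots> = - (d\<^sup>2 / N)" using N by (simp add: field_simps power2_eq_square)
    finally show False using d N by (simp add: divide_le_0_iff)
  qed
  with cl that show thesis by blast
qed

text \<open>Representing the functional \<open>v \<mapsto> inner x v\<close> on \<open>V\<close> by
  a vector of \<open>closure V\<close> gives the orthogonal projection of \<open>x\<close>.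
  \<open>V\<close> itself need not be closed.\<close>

lemma orthogonal_decomposition:
  fixes V :: "'a::{real_inner, complete_space} set"
  assumes "subspace V"
  obtains y where "y \<in> closure V" "\<And>v. v \<in> closure V \<Longrightarrow> inner (x - y) v = 0"
proof -
  define G where "G = (\<lambda>v. (v, inner x v)) ` V"
  have "linear (\<lambda>v. (v, inner x v))"
    by (intro linearI) (auto simp: inner_simps)
  then have "subspace G" unfolding G_def by (rule linear_subspace_image[OF _ assms])
  then obtain y where y: "y \<in> closure (fst ` G)" "\<And>v s. (v, s) \<in> G \<Longrightarrow> s = inner y v"
    by (rule riesz_representation_graph[where K = "norm x"])
      (auto simp: G_def Cauchy_Schwarz_ineq2)
  have "fst ` G = V" unfolding G_def by force
  then have yV: "y \<in> closure V" using y(1) by simp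
  have "V \<subseteq> {v. inner (x - y) v = 0}" using y(2) by (auto simp: G_def inner_simps)
  moreover have "closed {v. inner (x - y) v = 0}"
    by (intro closed_Collect_eq continuous_intros)
  ultimately have "closure V \<subseteq> {v. inner (x - y) v = 0}" by (rule closure_minimal)
  with yV show thesis by (intro that) auto
qed

section \<open>Operators in a von Neumann algebra\<close>

text \<open>The signs of the coefficients are part of the conclusion: \<open>r = 0\<close> forces
  \<open>q = 0\<close>, a negative \<open>r\<close> fails for large \<open>t\<close>, and for
  positive \<open>r\<close> the minimum is at \<open>t = - q / r\<close>.\<close>

lemma nonneg_quadratic_imp_discriminant:
  fixes p q r :: real
  assumes "\<And>t. 0 \<le> p + 2 * t * q + t\<^sup>2 * r"
  shows "q\<^sup>2 \<le> p * r"
proof (cases "r = 0")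
  case True
  have "q = 0"
  proof (rule ccontr)
    assume q: "q \<noteq> 0"
    have "2 * (- (\<bar>p\<bar> + 1) / q) * q = - 2 * (\<bar>p\<bar> + 1)"
      using q by (simp add: field_simps)
    then show False using assms[of "- (\<bar>p\<bar> + 1) / q"] True by simp
  qed
  then show ?thesis using True by simp
next
  case False
  have r: "r > 0"
  proof (rule ccontr)
    assume "\<not> r > 0"
    then have r: "r < 0" using False by simp
    define t where "t = (\<bar>p\<bar> + 2 * \<bar>q\<bar> + 1) / (- r) + 1"
    have t1: "t \<ge> 1" unfolding t_def using r by (simp add: divide_nonneg_neg)
    have "t * (- r) \<ge> \<bar>p\<bar> + 2 * \<bar>q\<bar> + 1"
      unfolding t_def using r by (simp add: field_simps)
    then have "t * (t * (- r)) \<ge> t * (\<bar>p\<bar> + 2 * \<bar>q\<bar> + 1)"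
      using t1 by (intro mult_left_mono) auto
    moreover have "t * (\<bar>p\<bar> + 1) \<ge> 1 * (\<bar>p\<bar> + 1)" using t1 by (intro mult_right_mono) auto
    moreover have "t * q \<le> t * \<bar>q\<bar>" using t1 by (intro mult_left_mono) auto
    ultimately show False using assms[of t] by (simp add: power2_eq_square algebra_simps)
  qed
  have "0 \<le> p + 2 * (- q / r) * q + (- q / r)\<^sup>2 * r" by (rule assms)
  also have "\<dots> = p - q\<^sup>2 / r" using r by (simp add: field_simps power2_eq_square)
  finally show ?thesis using r by (simp add: field_simps)
qed

text \<open>Multiplying a real parameter by the phase that makes \<open>w * q\<close> real reduces
  this to the real discriminant. It is the common core of the Cauchy-Schwarz inequalities for
  positive functionals.\<close>

lemma nonneg_form_imp_cauchy_schwarz: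
  assumes "\<And>w :: complex. 0 \<le> p + 2 * Re (w * q) + (cmod w)\<^sup>2 * r"
  shows "(cmod q)\<^sup>2 \<le> p * r"
proof (cases "q = 0")
  case True
  have "0 \<le> p" using assms[of 0] by simp
  moreover have "0\<^sup>2 \<le> p * r"
    by (rule nonneg_quadratic_imp_discriminant)
      (use True assms[of "of_real t" for t] in simp)
  ultimately show ?thesis using True by simp
next
  case False
  define u where "u = cnj q / cmod q"
  have u: "u * q = cmod q"
    using False by (simp add: u_def mult.commute power2_eq_square flip: complex_norm_square)
  have nu: "cmod u = 1" using False by (simp add: u_def norm_divide)
  show ?thesis
  proof (rule nonneg_quadratic_imp_discriminant)
    fix t
    have "Re (of_real t * u * q) = t * cmod q"
      using u by (simp add: mult.assoc)
    then show "0 \<le> p + 2 * t * cmod q + t\<^sup>2 * r"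
      using assms[of "of_real t * u"] by (simp add: norm_mult nu)
  qed
qed

interpretation blinfun_compose: bounded_bilinear blinfun_compose
  by (rule bounded_bilinear_blinfun_compose)

lemmas blinfun_simps = blinfun.bilinear_simps scaleC_blinfun_apply

lemma cinner_eq_zeroI: "(\<And>y. cinner y x = 0) \<Longrightarrow> x = 0"
  by (metis Re_cinner inner_eq_zero_iff zero_complex.sel(1))

lemma op_eqI:
  fixes a b :: "'h::chilbert_space \<Rightarrow>\<^sub>L 'h"
  assumes "\<And>x y. cinner x (a y) = cinner x (b y)"
  shows "a = b"
proof (rule blinfun_eqI)
  fix y
  have "a y - b y = 0" by (rule cinner_eq_zeroI) (simp add: cinner_simps assms)
  then show "a y = b y" by simp
qed

text \<open>Choice makes this total without any existence theorem: inside a star subalgebra an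
  adjoint exists by definition, and \<open>is_adjoint_unique\<close> identifies it.\<close>

definition adj :: "('h::chilbert_space \<Rightarrow>\<^sub>L 'h) \<Rightarrow> ('h \<Rightarrow>\<^sub>L 'h)"
  where "adj a = (SOME b. is_adjoint a b)"

lemma is_adjoint_unique: "is_adjoint a b \<Longrightarrow> is_adjoint a c \<Longrightarrow> b = c"
  unfolding is_adjoint_def by (intro op_eqI) (metis cinner_commute)

lemma adj_eq: "is_adjoint a b \<Longrightarrow> adj a = b"
  unfolding adj_def by (metis is_adjoint_unique someI_ex)

lemma nonneg_Reals_iff: "z \<in> \<real>\<^sub>\<ge>\<^sub>0 \<longleftrightarrow> Im z = 0 \<and> 0 \<le> Re z"
  by (auto simp: complex_nonneg_Reals_iff)

lemma positive_op_iff: "positive_op a \<longleftrightarrow> (\<forall>x. Im (cinner x (a x)) = 0 \<and> 0 \<le> inner x (a x))"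
  by (simp add: positive_op_def nonneg_Reals_iff Re_cinner)

lemma positive_opD: "positive_op a \<Longrightarrow> 0 \<le> inner x (a x)"
  by (simp add: positive_op_iff)

lemma positive_op_scaleR: "positive_op a \<Longrightarrow> 0 \<le> r \<Longrightarrow> positive_op (r *\<^sub>R a)"
  by (simp add: positive_op_iff blinfun_simps cinner_simps inner_simps)

lemma positive_op_id: "positive_op (id_blinfun :: 'h::chilbert_space \<Rightarrow>\<^sub>L 'h)"
  by (simp add: positive_op_iff cinner_self)

lemma positive_op_0: "positive_op (0 :: 'h::chilbert_space \<Rightarrow>\<^sub>L 'h)"
  by (simp add: positive_op_iff blinfun_simps cinner_simps)

lemma selfadjoint_cinner: "selfadjoint a \<Longrightarrow> cinner (a x) y = cinner x (a y)"
  by (simp add: selfadjoint_def is_adjoint_def)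

lemma selfadjoint_inner: "selfadjoint a \<Longrightarrow> inner (a x) y = inner x (a y)"
  by (metis selfadjoint_cinner Re_cinner)

lemma selfadjoint_Im: "selfadjoint a \<Longrightarrow> Im (cinner x (a x)) = 0"
  by (metis selfadjoint_cinner cinner_commute cnj.simps(2) neg_equal_zero)

lemma positive_op_selfadjointI: "selfadjoint a \<Longrightarrow> (\<And>x. 0 \<le> inner x (a x)) \<Longrightarrow> positive_op a"
  by (simp add: positive_op_iff selfadjoint_Im)

lemma positive_op_square: "selfadjoint a \<Longrightarrow> positive_op (a \<odot> a)"
  by (simp add: positive_op_def selfadjoint_cinner[symmetric] cinner_self del: of_real_power)

lemma positive_op_conj: "positive_op c \<Longrightarrow> is_adjoint a b \<Longrightarrow> positive_op (b \<odot> c \<odot> a)"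
  by (simp add: positive_op_def is_adjoint_def) (metis cinner_commute)

lemma selfadjoint_add: "selfadjoint a \<Longrightarrow> selfadjoint b \<Longrightarrow> selfadjoint (a + b)"
  by (simp add: selfadjoint_def is_adjoint_def blinfun_simps cinner_simps)

lemma selfadjoint_diff: "selfadjoint a \<Longrightarrow> selfadjoint b \<Longrightarrow> selfadjoint (a - b)"
  by (simp add: selfadjoint_def is_adjoint_def blinfun_simps cinner_simps)

lemma selfadjoint_scaleR: "selfadjoint a \<Longrightarrow> selfadjoint (r *\<^sub>R a)"
  by (simp add: selfadjoint_def is_adjoint_def blinfun_simps cinner_simps)

lemma selfadjoint_id: "selfadjoint id_blinfun"
  by (simp add: selfadjoint_def is_adjoint_def)

lemma selfadjoint_0: "selfadjoint 0"
  by (simp add: selfadjoint_def is_adjoint_def blinfun_simps cinner_simps)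

lemma selfadjoint_mult: "selfadjoint a \<Longrightarrow> selfadjoint b \<Longrightarrow> a \<odot> b = b \<odot> a \<Longrightarrow> selfadjoint (a \<odot> b)"
  unfolding selfadjoint_def is_adjoint_def
  by (metis blinfun_apply_blinfun_compose)

lemmas selfadjoint_intros = selfadjoint_add selfadjoint_diff selfadjoint_scaleR selfadjoint_id selfadjoint_0

lemma selfadjoint_limit:
  assumes "f \<longlonglongrightarrow> a" "\<And>n. selfadjoint (f n)"
  shows "selfadjoint a"
  unfolding selfadjoint_def is_adjoint_def
proof (intro allI)
  fix x y
  have "(\<lambda>n. cinner (f n x) y) \<longlonglongrightarrow> cinner (a x) y" "(\<lambda>n. cinner x (f n y)) \<longlonglongrightarrow> cinner x (a y)"
    by (intro cinner.tendsto blinfun.tendsto tendsto_const assms)+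
  then show "cinner (a x) y = cinner x (a y)"
    using assms(2) by (simp add: selfadjoint_cinner LIMSEQ_unique)
qed

lemma abs_form_le:
  fixes a :: "'h::chilbert_space \<Rightarrow>\<^sub>L 'h"
  assumes "norm a \<le> r"
  shows "\<bar>inner x (a x)\<bar> \<le> r * (norm x)\<^sup>2"
proof -
  have "\<bar>inner x (a x)\<bar> \<le> norm x * norm (a x)" by (rule Cauchy_Schwarz_ineq2)
  also have "\<dots> \<le> norm x * (r * norm x)"
    using assms norm_blinfun[of a x] mult_right_mono[OF assms, of "norm x"] by (intro mult_left_mono) auto
  finally show ?thesis by (simp add: power2_eq_square mult_ac)
qed

text \<open>Polarization expresses \<open>inner y (a x)\<close> by the form of \<open>a\<close> at
  \<open>x + y\<close> and \<open>x - y\<close>, and the parallelogram law bounds the result. The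
  test vector \<open>y\<close> is \<open>a x\<close> rescaled to the length of
  \<open>x\<close>.\<close>

lemma norm_selfadjoint_le:
  fixes a :: "'h::chilbert_space \<Rightarrow>\<^sub>L 'h"
  assumes sa: "selfadjoint a" and r: "0 \<le> r" and le: "\<And>x. \<bar>inner x (a x)\<bar> \<le> r * (norm x)\<^sup>2"
  shows "norm a \<le> r"
proof (rule norm_blinfun_bound)
  fix x :: 'h
  show "norm (a x) \<le> r * norm x"
  proof (cases "a x = 0")
    case False
    then have x: "norm x > 0" by (metis norm_eq_zero zero_less_norm_iff blinfun.zero_right)
    define y where "y = (norm x / norm (a x)) *\<^sub>R a x"
    have ny: "norm y = norm x" using False by (simp add: y_def)
    have "4 * inner y (a x) = inner (x + y) (a (x + y)) - inner (x - y) (a (x - y))"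
      using selfadjoint_inner[OF sa, of x y]
      by (simp add: blinfun_simps inner_add_left inner_add_right inner_diff_left inner_diff_right inner_commute)
    also have "\<dots> \<le> r * (norm (x + y))\<^sup>2 + r * (norm (x - y))\<^sup>2"
      using le[of "x + y"] le[of "x - y"] by linarith
    also have "\<dots> = r * (2 * (norm x)\<^sup>2 + 2 * (norm y)\<^sup>2)"
      by (simp add: power2_norm_eq_inner inner_add_left inner_add_right inner_diff_left inner_diff_right inner_commute algebra_simps)
    finally have "inner y (a x) \<le> r * (norm x)\<^sup>2" by (simp add: ny)
    moreover have "inner y (a x) = norm x * norm (a x)"
      using False by (simp add: y_def flip: power2_norm_eq_inner) (simp add: power2_eq_square)
    ultimately show ?thesis using x by (simp add: power2_eq_square)
  qed (use r in simp)
qed (use r in simp)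

lemma positive_op_cauchy_schwarz:
  assumes "selfadjoint a" "positive_op a"
  shows "(inner x (a y))\<^sup>2 \<le> inner x (a x) * inner y (a y)"
proof (rule nonneg_quadratic_imp_discriminant)
  fix t
  show "0 \<le> inner x (a x) + 2 * t * inner x (a y) + t\<^sup>2 * inner y (a y)"
    using positive_opD[OF assms(2), of "x + t *\<^sub>R y"] selfadjoint_inner[OF assms(1), of x y]
    by (simp add: blinfun_simps inner_add_left inner_add_right inner_commute power2_eq_square algebra_simps)
qed

lemma positive_op_kernel:
  assumes "selfadjoint a" "positive_op a" "inner x (a x) = 0"
  shows "a x = 0"
proof -
  have "(inner (a x) (a x))\<^sup>2 \<le> inner (a x) (a (a x)) * inner x (a x)"
    by (rule positive_op_cauchy_schwarz[OF assms(1,2)])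
  then show ?thesis using assms(3) by simp
qed

section \<open>Projections and their order\<close>

lemma projection_simps:
  assumes "projection p"
  shows "p \<odot> p = p" "selfadjoint p" "p (p x) = p x" "positive_op p"
proof -
  show *: "p \<odot> p = p" "selfadjoint p" using assms by (auto simp: projection_def)
  then show "p (p x) = p x" by (metis blinfun_apply_blinfun_compose)
  show "positive_op p" using positive_op_square[OF *(2)] * by simp
qed

lemma projection_inner: "projection p \<Longrightarrow> inner x (p x) = (norm (p x))\<^sup>2"
  by (metis power2_norm_eq_inner projection_simps(2,3) selfadjoint_inner)

text \<open>Forward, Pythagoras for \<open>y = p x\<close> splits its norm into the parts of
  \<open>q y\<close> and \<open>y - q y\<close>, and the order leaves nothing for the second.
  Backward, \<open>q - p\<close> is its own square.\<close>

lemma projection_le_iff: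
  assumes "projection p" "projection q"
  shows "le_op p q \<longleftrightarrow> q \<odot> p = p"
proof
  assume "le_op p q"
  then have le: "inner x (p x) \<le> inner x (q x)" for x
    using positive_opD[of "q - p" x] by (simp add: le_op_def blinfun_simps inner_simps)
  show "q \<odot> p = p"
  proof (rule blinfun_eqI)
    fix x
    define y where "y = p x"
    have "inner (y - q y) (q y) = 0"
      using assms by (simp add: selfadjoint_inner[OF projection_simps(2), symmetric] blinfun_simps projection_simps(3))
    then have "(norm y)\<^sup>2 = (norm (q y))\<^sup>2 + (norm (y - q y))\<^sup>2"
      by (simp add: power2_norm_eq_inner inner_diff_left inner_diff_right inner_commute)
    moreover have "(norm y)\<^sup>2 \<le> (norm (q y))\<^sup>2"
      using le[of y] unfolding projection_inner[OF assms(1)] projection_inner[OF assms(2)]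
      by (simp add: y_def projection_simps(3)[OF assms(1)])
    ultimately have "norm (y - q y) = 0"
      by (smt (verit) zero_le_power2 power2_eq_iff_nonneg norm_ge_zero zero_eq_power2)
    then show "(q \<odot> p) x = p x" by (simp add: y_def)
  qed
next
  assume qp: "q \<odot> p = p"
  have "p \<odot> q = p"
  proof (rule op_eqI)
    fix x y
    show "cinner x ((p \<odot> q) y) = cinner x (p y)"
      using qp assms by (metis blinfun_apply_blinfun_compose projection_simps(2) selfadjoint_cinner)
  qed
  then have "(q - p) \<odot> (q - p) = q - p"
    using qp assms by (simp add: blinfun_compose.diff_left blinfun_compose.diff_right projection_simps(1))
  then show "le_op p q"
    unfolding le_op_def using assms by (metis positive_op_square projection_simps(2) selfadjoint_diff)
qed

section \<open>Algebraic and norm structure of a von Neumann algebra\<close>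

locale von_neumann =
  fixes A :: "('h::chilbert_space \<Rightarrow>\<^sub>L 'h) set"
  assumes vn: "von_neumann_algebra A"
begin

lemma star_subalgebra: "unital_star_subalgebra A"
  using vn by (simp add: von_neumann_algebra_def)

lemma bicommutant: "commutant (commutant A) = A"
  using vn by (simp add: von_neumann_algebra_def)

lemma apply_scaleC: "a \<in> A \<Longrightarrow> a (c *\<^sub>C x) = c *\<^sub>C a x"
  using star_subalgebra by (auto simp: unital_star_subalgebra_def bounded_operators_def)

lemma id_mem: "id_blinfun \<in> A"
  and add_mem: "a \<in> A \<Longrightarrow> b \<in> A \<Longrightarrow> a + b \<in> A"
  and mult_mem: "a \<in> A \<Longrightarrow> b \<in> A \<Longrightarrow> a \<odot> b \<in> A"
  and scaleC_mem: "a \<in> A \<Longrightarrow> c *\<^sub>C a \<in> A"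
  using star_subalgebra by (auto simp: unital_star_subalgebra_def)

lemma scaleR_mem: "a \<in> A \<Longrightarrow> r *\<^sub>R a \<in> A"
  by (metis scaleC_mem scaleC_of_real)

lemma zero_mem: "0 \<in> A"
  by (metis id_mem scaleR_mem scaleR_zero_left)

lemma minus_mem: "a \<in> A \<Longrightarrow> - a \<in> A"
  by (metis scaleC_mem scaleC_minus1)

lemma diff_mem: "a \<in> A \<Longrightarrow> b \<in> A \<Longrightarrow> a - b \<in> A"
  by (metis add_mem minus_mem uminus_add_conv_diff add.commute)

lemma sum_mem: "(\<And>i. i \<in> I \<Longrightarrow> f i \<in> A) \<Longrightarrow> sum f I \<in> A"
  by (induction I rule: infinite_finite_induct) (auto simp: zero_mem add_mem)

lemmas mem_intros = id_mem add_mem mult_mem scaleC_mem scaleR_mem zero_mem minus_mem diff_mem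

lemma adj: "a \<in> A \<Longrightarrow> is_adjoint a (adj a)" and adj_mem: "a \<in> A \<Longrightarrow> adj a \<in> A"
  using star_subalgebra adj_eq unfolding unital_star_subalgebra_def by metis+

lemma cinner_adj_left: "a \<in> A \<Longrightarrow> cinner (adj a x) y = cinner x (a y)"
  using adj by (simp add: is_adjoint_def)

lemma cinner_adj_right: "a \<in> A \<Longrightarrow> cinner x (adj a y) = cinner (a x) y"
  by (metis cinner_adj_left cinner_commute)

lemma adj_eqI:
  fixes a b :: "'h \<Rightarrow>\<^sub>L 'h"
  shows "a \<in> A \<Longrightarrow> (\<And>x y. cinner (b x) y = cinner x (a y)) \<Longrightarrow> adj a = b"
  by (rule adj_eq) (simp add: is_adjoint_def)

lemma adj_adj [simp]: "a \<in> A \<Longrightarrow> adj (adj a) = a"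
  by (rule adj_eqI) (auto simp: adj_mem cinner_adj_right)

lemma adj_add: "a \<in> A \<Longrightarrow> b \<in> A \<Longrightarrow> adj (a + b) = adj a + adj b"
  by (rule adj_eqI) (auto simp: mem_intros blinfun_simps cinner_simps cinner_adj_left)

lemma adj_diff: "a \<in> A \<Longrightarrow> b \<in> A \<Longrightarrow> adj (a - b) = adj a - adj b"
  by (rule adj_eqI) (auto simp: mem_intros blinfun_simps cinner_simps cinner_adj_left)

lemma adj_mult: "a \<in> A \<Longrightarrow> b \<in> A \<Longrightarrow> adj (a \<odot> b) = adj b \<odot> adj a"
  by (rule adj_eqI) (auto simp: mem_intros blinfun_simps cinner_simps cinner_adj_left)

lemma adj_scaleC: "a \<in> A \<Longrightarrow> adj (c *\<^sub>C a) = cnj c *\<^sub>C adj a"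
  by (rule adj_eqI) (auto simp: mem_intros blinfun_simps cinner_simps cinner_adj_left)

lemma adj_scaleR: "a \<in> A \<Longrightarrow> adj (r *\<^sub>R a) = r *\<^sub>R adj a"
  by (metis adj_scaleC complex_cnj_complex_of_real scaleC_of_real)

lemma selfadjoint_iff: "a \<in> A \<Longrightarrow> selfadjoint a \<longleftrightarrow> adj a = a"
  by (metis adj adj_eq selfadjoint_def)

lemma inner_adj_left: "a \<in> A \<Longrightarrow> inner (adj a x) y = inner x (a y)"
  by (metis cinner_adj_left Re_cinner)

text \<open>The form of \<open>adj b \<odot> b\<close> at \<open>x\<close> is the squared norm of
  \<open>b x\<close>, which gives \<open>(norm b)\<^sup>2 \<le> norm (adj b \<odot> b)\<close>.
  Submultiplicativity then yields \<open>norm b \<le> norm (adj b)\<close>, and using this for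
  \<open>a\<close> and its adjoint gives both equalities.\<close>

lemma norm_adj_mult:
  assumes "a \<in> A" shows "norm (adj a \<odot> a) = (norm a)\<^sup>2" and "norm (adj a) = norm a"
proof -
  have le: "(norm b)\<^sup>2 \<le> norm (adj b \<odot> b)" if "b \<in> A" for b
  proof -
    have "norm b \<le> sqrt (norm (adj b \<odot> b))"
    proof (rule norm_blinfun_bound)
      fix x
      have "(norm (b x))\<^sup>2 = inner x ((adj b \<odot> b) x)"
        using that inner_adj_left[OF adj_mem[OF that], of x "b x"] by (simp add: power2_norm_eq_inner inner_commute)
      also have "\<dots> \<le> norm (adj b \<odot> b) * (norm x)\<^sup>2"
        using abs_form_le[OF order_refl] by (rule order_trans[OF abs_ge_self])
      finally show "norm (b x) \<le> sqrt (norm (adj b \<odot> b)) * norm x"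
        by (metis real_sqrt_le_iff real_sqrt_mult norm_ge_zero real_sqrt_unique)
    qed simp
    then show ?thesis by (metis real_le_rsqrt norm_ge_zero real_sqrt_le_iff real_sqrt_unique real_sqrt_pow2 power_mono)
  qed
  have le2: "norm b \<le> norm (adj b)" if "b \<in> A" for b
  proof (cases "b = 0")
    case False
    have "norm b * norm b \<le> norm (adj b) * norm b"
      using le[OF that] norm_blinfun_compose[of "adj b" b] by (simp add: power2_eq_square)
    then show ?thesis using False by simp
  qed simp
  show *: "norm (adj a) = norm a"
    using le2[OF assms] le2[OF adj_mem[OF assms]] assms by simp
  show "norm (adj a \<odot> a) = (norm a)\<^sup>2"
    using le[OF assms] norm_blinfun_compose[of "adj a" a] * by (simp add: power2_eq_square)
qed

text \<open>The form is real on the diagonal; polarization with the scalars 1 and \<i> makes it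
  Hermitian. Membership in \<open>A\<close> supplies the complex linearity that this requires of an
  operator which is only real-linear by type.\<close>

lemma positive_selfadjoint:
  assumes "a \<in> A" "positive_op a" shows "selfadjoint a"
  unfolding selfadjoint_def is_adjoint_def
proof (intro allI)
  fix x y
  have Im0: "Im (cinner z (a z)) = 0" for z using assms(2) by (simp add: positive_op_iff)
  have "Im (cinner (x + c *\<^sub>C y) (a (x + c *\<^sub>C y))) = 0" for c by (rule Im0)
  from this[of 1] this[of \<i>]
  have "Im (cinner x (a y) + cinner y (a x)) = 0" "Re (cinner x (a y)) = Re (cinner y (a x))"
    using Im0[of x] Im0[of y] by (simp_all add: blinfun_simps cinner_simps apply_scaleC[OF assms(1)])
  then have "cinner x (a y) = cnj (cinner y (a x))" by (simp add: complex_eq_iff)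
  then show "cinner (a x) y = cinner x (a y)" by (metis cinner_commute)
qed

lemma selfadjoint_adj_mult: "a \<in> A \<Longrightarrow> selfadjoint (adj a \<odot> a)"
  by (simp add: selfadjoint_iff mem_intros adj_mem adj_mult)

lemma positive_adj_mult: "a \<in> A \<Longrightarrow> positive_op (adj a \<odot> a)"
  by (simp add: positive_op_def cinner_adj_right cinner_self del: of_real_power)

lemma positive_conj: "a \<in> A \<Longrightarrow> positive_op c \<Longrightarrow> positive_op (adj a \<odot> c \<odot> a)"
  by (intro positive_op_conj adj)

lemma le_norm_id: "a \<in> A \<Longrightarrow> selfadjoint a \<Longrightarrow> norm a \<le> r \<Longrightarrow> positive_op (r *\<^sub>R id_blinfun - a)"
  using abs_form_le[of a r]
  by (intro positive_op_selfadjointI selfadjoint_intros)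
     (auto simp: blinfun_simps inner_simps power2_norm_eq_inner intro: order_trans[OF abs_ge_self])

lemma real_imaginary_parts:
  assumes "a \<in> A"
  obtains b c where "b \<in> A" "c \<in> A" "selfadjoint b" "selfadjoint c" "a = b + \<i> *\<^sub>C c"
    "norm b \<le> norm a" "norm c \<le> norm a"
proof
  define b where "b = (1/2) *\<^sub>R (a + adj a)"
  define c where "c = (- \<i> / 2) *\<^sub>C (a - adj a)"
  show bc: "b \<in> A" "c \<in> A" using assms by (simp_all add: b_def c_def mem_intros adj_mem)
  show "selfadjoint b" "selfadjoint c"
    unfolding selfadjoint_iff[OF bc(1)] selfadjoint_iff[OF bc(2)]
  proof -
    show "adj b = b"
      using assms by (simp add: b_def adj_scaleR adj_add mem_intros adj_mem add.commute)
    have "adj c = (\<i> / 2) *\<^sub>C (adj a - a)"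
      using assms by (simp add: c_def adj_scaleC adj_diff mem_intros adj_mem)
    also have "\<dots> = (- \<i> / 2) *\<^sub>C (- 1) *\<^sub>C (adj a - a)"
      unfolding scaleC_scaleC by simp
    also have "\<dots> = c" unfolding scaleC_minus1 by (simp add: c_def)
    finally show "adj c = c" .
  qed
  have "\<i> *\<^sub>C c = of_real (1/2) *\<^sub>C (a - adj a)"
    by (simp add: c_def scaleC_scaleC)
  then have "\<i> *\<^sub>C c = (1/2) *\<^sub>R (a - adj a)" unfolding scaleC_of_real .
  then have "b + \<i> *\<^sub>C c = (1/2) *\<^sub>R ((a + adj a) + (a - adj a))"
    unfolding b_def by (simp only: scaleR_add_right)
  also have "\<dots> = (1/2) *\<^sub>R (2 *\<^sub>R a)" by (simp add: scaleR_2)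
  finally show "a = b + \<i> *\<^sub>C c" by simp
  have "norm (a + adj a) \<le> norm a + norm a" "norm (a - adj a) \<le> norm a + norm a"
    using norm_triangle_ineq[of a "adj a"] norm_triangle_ineq4[of a "adj a"] norm_adj_mult(2)[OF assms] by auto
  \<comment> \<open>Operators carry no inner product, so \<open>norm_scaleC\<close> does not apply
    to them. Equality follows from the upper bound for the scalar and for its inverse
    \<open>2 * \<i>\<close>.\<close>
  moreover have nc: "norm ((- \<i> / 2) *\<^sub>C d) = norm d / 2" for d :: "'h \<Rightarrow>\<^sub>L 'h"
  proof -
    have le: "norm (k *\<^sub>C d) \<le> cmod k * norm d" for k and d :: "'h \<Rightarrow>\<^sub>L 'h"
      by (rule norm_blinfun_bound)
        (auto simp: scaleC_blinfun_apply norm_scaleC mult.assoc intro!: mult_left_mono norm_blinfun)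
    have "norm d \<le> 2 * norm ((- \<i> / 2) *\<^sub>C d)"
      using le[of "2 * \<i>" "(- \<i> / 2) *\<^sub>C d"] by (simp add: scaleC_scaleC norm_mult)
    moreover have "norm ((- \<i> / 2) *\<^sub>C d) \<le> norm d / 2"
      using le[of "- \<i> / 2" d] by (simp add: norm_divide)
    ultimately show ?thesis by simp
  qed
  ultimately show "norm b \<le> norm a" "norm c \<le> norm a" unfolding b_def c_def nc by auto
qed

text \<open>Being complex-linear and commuting with the commutant both survive norm limits, and the
  bicommutant is \<open>A\<close>.\<close>

lemma norm_limit_mem:
  assumes "f \<longlonglongrightarrow> a" "\<And>n. f n \<in> A"
  shows "a \<in> A"
proof -
  have lim: "(\<lambda>n. f n x) \<longlonglongrightarrow> a x" for x
    by (intro blinfun.tendsto assms tendsto_const)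
  have "a (c *\<^sub>C x) = c *\<^sub>C a x" for c x
  proof (rule LIMSEQ_unique[OF lim])
    show "(\<lambda>n. f n (c *\<^sub>C x)) \<longlonglongrightarrow> c *\<^sub>C a x"
      using bounded_linear.tendsto[OF bounded_linear_scaleC lim] by (simp add: apply_scaleC assms(2))
  qed
  moreover have "a \<odot> r = r \<odot> a" if "r \<in> commutant A" for r
  proof (rule LIMSEQ_unique)
    show "(\<lambda>n. f n \<odot> r) \<longlonglongrightarrow> a \<odot> r" "(\<lambda>n. f n \<odot> r) \<longlonglongrightarrow> r \<odot> a"
    proof -
      show "(\<lambda>n. f n \<odot> r) \<longlonglongrightarrow> a \<odot> r" by (intro tendsto_intros assms)
      have "f n \<odot> r = r \<odot> f n" for n using that assms(2) by (simp add: commutant_def)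
      then show "(\<lambda>n. f n \<odot> r) \<longlonglongrightarrow> r \<odot> a" by (simp add: tendsto_intros assms)
    qed
  qed
  ultimately have "a \<in> commutant (commutant A)" by (auto simp: commutant_def bounded_operators_def)
  then show ?thesis by (simp add: bicommutant)
qed

end

instance chilbert_space \<subseteq> banach ..

section \<open>Square roots, range projections and minimal projections\<close>

text \<open>
  The iteration \<open>y \<mapsto> (x + y\<^sup>2) / 2\<close> has the fixed point \<open>1 - sqrt (1 - x)\<close>; it is dominated by the same
  iteration for the number \<open>x = 1\<close>.
\<close>

lemma sqrt_iteration_converges:
  fixes x :: "'h::banach \<Rightarrow>\<^sub>L 'h"
  assumes "norm x \<le> 1"
  defines "y \<equiv> rec_nat 0 (\<lambda>_ y. (1/2) *\<^sub>R (x + y \<odot> y))"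
  shows "\<exists>z. y \<longlonglongrightarrow> z"
proof -
  define t where "t = rec_nat 0 (\<lambda>_ s. (1/2) * (1 + s * s) :: real)"
  have y: "y 0 = 0" "y (Suc n) = (1/2) *\<^sub>R (x + y n \<odot> y n)" for n by (simp_all add: y_def)
  have t: "t 0 = 0" "t (Suc n) = (1/2) * (1 + t n * t n)" for n by (simp_all add: t_def)
  have t01: "0 \<le> t n \<and> t n \<le> 1" for n
    by (induction n) (auto simp: t mult_le_one)
  have tmono: "t n \<le> t (Suc n)" for n
    using zero_le_power2[of "1 - t n"] by (simp add: t power2_eq_square algebra_simps)
  have yt: "norm (y n) \<le> t n" for n
  proof (induction n)
    case (Suc n)
    have "norm (y n \<odot> y n) \<le> t n * t n"
      using norm_blinfun_compose[of "y n" "y n"] mult_mono[OF Suc Suc] t01[of n] by auto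
    then show ?case using norm_triangle_ineq[of x "y n \<odot> y n"] assms(1) by (simp add: y t)
  qed (simp add: y t)
  have step: "norm (y (Suc n) - y n) \<le> t (Suc n) - t n" for n
  proof (induction n)
    case 0
    show ?case using assms(1) by (simp add: y t)
  next
    case (Suc n)
    let ?d = "y (Suc n) - y n" and ?e = "t (Suc n) - t n"
    \<comment> \<open>Non-commutative difference of squares: \<open>u \<odot> u - v \<odot> v = u
      \<odot> (u - v) + (u - v) \<odot> v\<close>.\<close>
    have "y (Suc (Suc n)) - y (Suc n) = (1/2) *\<^sub>R (y (Suc n) \<odot> ?d + ?d \<odot> y n)"
      unfolding y(2)[of "Suc n"] y(2)[of n]
      by (simp add: blinfun_compose.diff_left blinfun_compose.diff_right flip: scaleR_diff_right)
    then have "norm (y (Suc (Suc n)) - y (Suc n)) = (1/2) * norm (y (Suc n) \<odot> ?d + ?d \<odot> y n)"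
      by simp
    also have "\<dots> \<le> (1/2) * (norm (y (Suc n)) * norm ?d + norm ?d * norm (y n))"
      by (intro mult_left_mono norm_triangle_mono norm_blinfun_compose) auto
    also have "\<dots> \<le> (1/2) * (t (Suc n) * ?e + ?e * t n)"
      using Suc yt tmono[of n] t01 by (intro mult_left_mono add_mono mult_mono) auto
    also have "\<dots> = t (Suc (Suc n)) - t (Suc n)"
      unfolding t(2)[of "Suc n"] t(2)[of n] by (simp add: algebra_simps)
    finally show ?case .
  qed
  have diff: "norm (y (n + k) - y n) \<le> t (n + k) - t n" for n k
  proof (induction k)
    case (Suc k)
    have "norm (y (n + Suc k) - y n) \<le> norm (y (Suc (n + k)) - y (n + k)) + norm (y (n + k) - y n)"
      using norm_triangle_ineq[of "y (Suc (n + k)) - y (n + k)" "y (n + k) - y n"] by simp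
    then show ?case using Suc step[of "n + k"] by simp
  qed simp
  have inc: "incseq t" using tmono by (rule incseq_SucI)
  have "convergent t"
    using inc t01 using incseq_convergent[OF inc, of 1] unfolding convergent_def by blast
  then have "Cauchy t" by (rule convergent_Cauchy)
  have "Cauchy y"
  proof (rule metric_CauchyI)
    fix e :: real assume "e > 0"
    then obtain M where M: "\<And>m n. m \<ge> M \<Longrightarrow> n \<ge> M \<Longrightarrow> dist (t m) (t n) < e"
      using \<open>Cauchy t\<close> metric_CauchyD by blast
    have *: "dist (y m) (y n) < e" if "m \<ge> n" "n \<ge> M" for m n
      using diff[of n "m - n"] M[of m n] that by (simp add: dist_norm)
    have "dist (y m) (y n) < e" if "m \<ge> M" "n \<ge> M" for m n
      using *[of m n] *[of n m] that by (cases "m \<ge> n") (auto simp: dist_commute)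
    then show "\<exists>M. \<forall>m\<ge>M. \<forall>n\<ge>M. dist (y m) (y n) < e" by blast
  qed
  then show ?thesis using convergent_eq_Cauchy by blast
qed

lemma subspace_closure:
  fixes V :: "'a::real_normed_vector set"
  assumes "subspace V"
  shows "subspace (closure V)"
proof (rule subspaceI)
  show "0 \<in> closure V" using subspace_0[OF assms] closure_subset by blast
  fix x y c assume "x \<in> closure V" "y \<in> closure V"
  then obtain f g where fg: "\<And>n. f n \<in> V" "f \<longlonglongrightarrow> x" "\<And>n. g n \<in> V" "g \<longlonglongrightarrow> y"
    unfolding closure_sequential by blast
  have "(\<lambda>n. f n + g n) \<longlonglongrightarrow> x + y" "(\<lambda>n. c *\<^sub>R f n) \<longlonglongrightarrow> c *\<^sub>R x"
    by (intro tendsto_intros fg)+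
  moreover have "f n + g n \<in> V" "c *\<^sub>R f n \<in> V" for n
    using fg assms by (auto intro: subspace_add subspace_scale)
  ultimately show "x + y \<in> closure V" "c *\<^sub>R x \<in> closure V"
    unfolding closure_sequential by (metis (full_types))+
qed

text \<open>The pointwise decomposition is unique, hence linear. Invariance of \<open>V\<close>
  under complex scalars turns real orthogonality into complex orthogonality.\<close>

lemma orthogonal_projection_exists:
  fixes V :: "'h::chilbert_space set"
  assumes V: "subspace V" and cV: "\<And>c x. x \<in> V \<Longrightarrow> c *\<^sub>C x \<in> V"
  obtains q :: "'h \<Rightarrow>\<^sub>L 'h" where "projection q" "q \<in> bounded_operators"
    "\<And>x. q x \<in> closure V" "\<And>x. x \<in> closure V \<Longrightarrow> q x = x"
    "\<And>x v. v \<in> closure V \<Longrightarrow> inner (x - q x) v = 0"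
proof -
  let ?M = "closure V"
  have M: "subspace ?M" by (rule subspace_closure[OF V])
  have cM: "c *\<^sub>C x \<in> ?M" if x: "x \<in> ?M" for c x
  proof -
    obtain f where f: "\<And>n. f n \<in> V" "f \<longlonglongrightarrow> x" using x unfolding closure_sequential by blast
    have "(\<lambda>n. c *\<^sub>C f n) \<longlonglongrightarrow> c *\<^sub>C x"
      by (rule bounded_linear.tendsto[OF bounded_linear_scaleC f(2)])
    moreover have "c *\<^sub>C f n \<in> V" for n using f(1) by (rule cV)
    ultimately show ?thesis unfolding closure_sequential by (intro exI[of _ "\<lambda>n. c *\<^sub>C f n"]) simp
  qed
  have "\<exists>y. y \<in> ?M \<and> (\<forall>v\<in>?M. inner (x - y) v = 0)" for x
    using orthogonal_decomposition[OF V, of x] by metis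
  then obtain p where p: "\<And>x. p x \<in> ?M" "\<And>x v. v \<in> ?M \<Longrightarrow> inner (x - p x) v = 0" by metis
  have uniq: "p x = y" if "y \<in> ?M" "\<And>v. v \<in> ?M \<Longrightarrow> inner (x - y) v = 0" for x y
  proof -
    have "p x - y \<in> ?M" using M p(1) that(1) by (rule subspace_diff)
    then have "inner (p x - y) (p x - y) = 0"
      using p(2)[of "p x - y" x] that(2)[of "p x - y"] by (simp add: inner_diff_left)
    then show ?thesis by simp
  qed
  have add: "p (x + y) = p x + p y" for x y
  proof (rule uniq)
    show "p x + p y \<in> ?M" by (rule subspace_add[OF M p(1) p(1)])
    show "inner (x + y - (p x + p y)) v = 0" if "v \<in> ?M" for v
      using p(2)[OF that, of x] p(2)[OF that, of y] by (simp add: inner_diff_left inner_add_left)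
  qed
  have scR: "p (c *\<^sub>R x) = c *\<^sub>R p x" for c x
  proof (rule uniq)
    show "c *\<^sub>R p x \<in> ?M" by (rule subspace_scale[OF M p(1)])
    show "inner (c *\<^sub>R x - c *\<^sub>R p x) v = 0" if "v \<in> ?M" for v
      using p(2)[OF that, of x] by (simp add: inner_diff_left)
  qed
  have scC: "p (c *\<^sub>C x) = c *\<^sub>C p x" for c x
  proof (rule uniq)
    fix v assume v: "v \<in> ?M"
    have "inner (c *\<^sub>C x - c *\<^sub>C p x) v = Re (cinner (x - p x) (cnj c *\<^sub>C v))"
      by (simp add: cinner_simps algebra_simps flip: Re_cinner)
    then show "inner (c *\<^sub>C x - c *\<^sub>C p x) v = 0"
      using p(2)[OF cM[OF v], of x "cnj c"] by (simp add: Re_cinner)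
  qed (use p cM in auto)
  have pyth: "(norm x)\<^sup>2 = (norm (p x))\<^sup>2 + (norm (x - p x))\<^sup>2" for x
    using p(2)[OF p(1), of x x]
    by (simp add: power2_norm_eq_inner inner_diff_left inner_diff_right inner_commute)
  have bl: "bounded_linear p"
  proof (rule bounded_linear_intro[where K = 1])
    show "norm (p x) \<le> norm x * 1" for x
      using pyth[of x] by (simp add: power2_le_imp_le)
  qed (auto simp: add scR)
  define q where "q = Blinfun p"
  have q: "blinfun_apply q = p" by (simp add: q_def bounded_linear_Blinfun_apply[OF bl])
  have id: "p x = x" if "x \<in> ?M" for x by (rule uniq) (use that in auto)
  have ort: "inner (x - p x) (p y) = 0" for x y by (rule p(2)[OF p(1)])
  \<comment> \<open>The imaginary part is the real inner product with
    \<open>- \<i> *\<^sub>C p y\<close>, which again lies in the closed subspace.\<close>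
  have cort: "cinner (x - p x) (p y) = 0" for x y
  proof (rule complex_eqI)
    show "Re (cinner (x - p x) (p y)) = Re 0" by (simp add: Re_cinner ort)
    have "Re (cinner (x - p x) (- \<i> *\<^sub>C p y)) = 0"
      using ort[of x "- \<i> *\<^sub>C y"] by (simp add: Re_cinner scC)
    then show "Im (cinner (x - p x) (p y)) = Im 0" by (simp add: cinner_simps)
  qed
  have cort': "cinner (p y) (x - p x) = 0" for x y
    using cort[of x y] cinner_commute by (metis complex_cnj_zero)
  have "cinner (p x) y = cinner x (p y)" for x y
    using cort[of x y] cort'[of x y] by (simp add: cinner_simps)
  then have "projection q"
    by (auto simp: projection_def selfadjoint_def is_adjoint_def q id[OF p(1)] intro!: blinfun_eqI)
  moreover have "q \<in> bounded_operators" by (simp add: bounded_operators_def q scC)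
  ultimately show thesis using p id by (intro that[of q]) (auto simp: q)
qed

context von_neumann
begin

text \<open>With \<open>x = 1 - a\<close>, the limit \<open>z\<close> of the iteration satisfies
  \<open>z = (x + z\<^sup>2) / 2\<close>, that is, \<open>(1 - z)\<^sup>2 = a\<close>. Positivity of
  \<open>1 - z\<close> follows from \<open>norm z \<le> 1\<close>, and commutation is inherited
  because every iterate is a polynomial in \<open>a\<close>.\<close>

lemma sqrt_exists_contraction:
  assumes a: "a \<in> A" "positive_op a" "norm a \<le> 1"
  obtains s where "s \<in> A" "positive_op s" "s \<odot> s = a"
    "\<And>b. a \<odot> b = b \<odot> a \<Longrightarrow> s \<odot> b = b \<odot> s"
proof -
  define x where "x = id_blinfun - a"
  have sa: "selfadjoint a" using a positive_selfadjoint by blast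
  have xA: "x \<in> A" and sx: "selfadjoint x"
    using a sa by (auto simp: x_def mem_intros intro!: selfadjoint_intros)
  have "\<bar>inner v (x v)\<bar> \<le> 1 * (norm v)\<^sup>2" for v
    using positive_opD[OF a(2), of v] positive_opD[OF le_norm_id[OF a(1) sa a(3)], of v]
    by (simp add: x_def blinfun_simps inner_simps power2_norm_eq_inner)
  then have nx: "norm x \<le> 1" using sx by (intro norm_selfadjoint_le) auto
  define y where "y = rec_nat 0 (\<lambda>_ y. (1/2) *\<^sub>R (x + y \<odot> y))"
  have y: "y 0 = 0" "y (Suc n) = (1/2) *\<^sub>R (x + y n \<odot> y n)" for n by (simp_all add: y_def)
  obtain z where z: "y \<longlonglongrightarrow> z" using sqrt_iteration_converges[OF nx] unfolding y_def by blast
  have yA: "y n \<in> A" for n by (induction n) (auto simp: y mem_intros xA)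
  have ys: "selfadjoint (y n)" for n
    by (induction n) (auto simp: y sx intro!: selfadjoint_intros selfadjoint_mult)
  have yn: "norm (y n) \<le> 1" for n
  proof (induction n)
    case (Suc n)
    have "norm (y n \<odot> y n) \<le> 1"
      using norm_blinfun_compose[of "y n" "y n"] mult_mono[OF Suc Suc] by auto
    then show ?case using norm_triangle_ineq[of x "y n \<odot> y n"] nx by (simp add: y)
  qed (simp add: y)
  have yc: "y n \<odot> b = b \<odot> y n" if "a \<odot> b = b \<odot> a" for n b
  proof (induction n)
    case (Suc n)
    have ab: "a (b v) = b (a v)" for v using that by (metis blinfun_apply_blinfun_compose)
    have yb: "y n (b v) = b (y n v)" for v using Suc by (metis blinfun_apply_blinfun_compose)
    show ?case
      by (rule blinfun_eqI) (simp add: y x_def blinfun_simps ab yb)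
  qed (simp add: y blinfun_compose.zero_left blinfun_compose.zero_right)
  have zA: "z \<in> A" by (rule norm_limit_mem[OF z yA])
  have zs: "selfadjoint z" by (rule selfadjoint_limit[OF z ys])
  have zn: "norm z \<le> 1" using LIMSEQ_le_const2[OF tendsto_norm[OF z], of 1] yn by auto
  have "(\<lambda>n. y (Suc n)) \<longlonglongrightarrow> (1/2) *\<^sub>R (x + z \<odot> z)"
    unfolding y by (intro tendsto_intros z)
  then have zfix: "z = (1/2) *\<^sub>R (x + z \<odot> z)" using z LIMSEQ_Suc LIMSEQ_unique by blast
  have zz: "z \<odot> z = 2 *\<^sub>R z - x"
    using arg_cong[OF zfix, of "\<lambda>u. 2 *\<^sub>R u - x"] by simp
  define s where "s = id_blinfun - z"
  show thesis
  proof
    show "s \<in> A" by (simp add: s_def mem_intros zA)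
    show "positive_op s" using le_norm_id[OF zA zs zn] by (simp add: s_def)
    have zz': "z (z v) = 2 *\<^sub>R z v - x v" for v
      using arg_cong[OF zz, of "\<lambda>f. f v"] by (simp add: blinfun_simps)
    show "s \<odot> s = a"
      by (rule blinfun_eqI) (simp add: s_def blinfun_simps zz' x_def scaleR_2)
    fix b assume ab: "a \<odot> b = b \<odot> a"
    have "z \<odot> b = b \<odot> z"
    proof (rule LIMSEQ_unique)
      show "(\<lambda>n. y n \<odot> b) \<longlonglongrightarrow> z \<odot> b" by (intro tendsto_intros z)
      show "(\<lambda>n. y n \<odot> b) \<longlonglongrightarrow> b \<odot> z" unfolding yc[OF ab] by (intro tendsto_intros z)
    qed
    then show "s \<odot> b = b \<odot> s"
      by (simp add: s_def blinfun_compose.diff_left blinfun_compose.diff_right blinfun_eqI)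
  qed
qed

lemma sqrt_exists:
  assumes a: "a \<in> A" "positive_op a"
  obtains s where "s \<in> A" "positive_op s" "s \<odot> s = a"
    "\<And>b. a \<odot> b = b \<odot> a \<Longrightarrow> s \<odot> b = b \<odot> s"
proof (cases "a = 0")
  case True
  show thesis
    by (rule that[of 0]) (auto simp: True zero_mem positive_op_0 blinfun_compose.zero_left blinfun_compose.zero_right)
next
  case False
  define k where "k = norm a"
  have k: "k > 0" using False by (simp add: k_def)
  define a' where "a' = (1/k) *\<^sub>R a"
  have "a' \<in> A" "positive_op a'" "norm a' \<le> 1"
    using a k by (auto simp: a'_def k_def mem_intros intro: positive_op_scaleR)
  then obtain s where s: "s \<in> A" "positive_op s" "s \<odot> s = a'"
    and sb: "\<And>b. a' \<odot> b = b \<odot> a' \<Longrightarrow> s \<odot> b = b \<odot> s"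
    using sqrt_exists_contraction by blast
  have "sqrt k *\<^sub>R s \<odot> sqrt k *\<^sub>R s = a"
    using k s(3) by (simp add: blinfun_compose.scaleR_left blinfun_compose.scaleR_right a'_def)
  moreover have "sqrt k *\<^sub>R s \<odot> b = b \<odot> sqrt k *\<^sub>R s" if "a \<odot> b = b \<odot> a" for b
    using sb[of b] that by (simp add: blinfun_compose.scaleR_left blinfun_compose.scaleR_right a'_def)
  moreover have "sqrt k *\<^sub>R s \<in> A" "positive_op (sqrt k *\<^sub>R s)"
    using s k by (simp_all add: scaleR_mem positive_op_scaleR)
  ultimately show thesis by (rule that[rotated 2])
qed

text \<open>\<open>q\<close> projects onto the closed span of all the ranges. Operators in the
  commutant preserve this span and also its orthogonal complement, the common kernel of
  \<open>S\<close>; so \<open>q\<close> commutes with them and lies in the bicommutant.\<close>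

lemma range_projection:
  assumes S: "S \<subseteq> A" "\<And>a. a \<in> S \<Longrightarrow> selfadjoint a"
  defines "V \<equiv> span (\<Union>a\<in>S. range (blinfun_apply a))"
  obtains q where "q \<in> A" "projection q" "\<And>a. a \<in> S \<Longrightarrow> q \<odot> a = a"
    "\<And>x. (\<And>a. a \<in> S \<Longrightarrow> a x = 0) \<Longrightarrow> q x = 0" "\<And>x. q x \<in> closure V"
proof -
  have V: "subspace V" by (simp add: V_def)
  have sub: "a x \<in> V" if "a \<in> S" for a x
    unfolding V_def by (rule span_base) (use that in auto)
  \<comment> \<open>One invariance argument for two kinds of \<open>r\<close>: multiplication by a
    complex scalar and elements of the commutant.\<close>
  have inv: "r x \<in> V" if r: "linear r" "\<And>a y. a \<in> S \<Longrightarrow> \<exists>z. r (a y) = a z" and x: "x \<in> V" for r x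
  proof -
    have "V \<subseteq> {x. r x \<in> V}"
      unfolding V_def
    proof (rule span_minimal)
      show "(\<Union>a\<in>S. range (blinfun_apply a)) \<subseteq> {x. r x \<in> span (\<Union>a\<in>S. range (blinfun_apply a))}"
      proof (safe)
        fix a y assume "a \<in> S"
        then obtain z where "r (a y) = a z" using r(2) by blast
        then show "r (a y) \<in> span (\<Union>a\<in>S. range (blinfun_apply a))"
          using sub[OF \<open>a \<in> S\<close>, of z] by (simp add: V_def)
      qed
      have "subspace (r -` span (\<Union>a\<in>S. range (blinfun_apply a)))"
        by (rule linear_subspace_vimage[OF r(1) subspace_span])
      then show "subspace {x. r x \<in> span (\<Union>a\<in>S. range (blinfun_apply a))}"
        by (simp add: vimage_def)
    qed
    then show ?thesis using x by blast
  qed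
  have "c *\<^sub>C x \<in> V" if "x \<in> V" for c x
  proof (rule inv[OF _ _ that])
    show "linear (\<lambda>x. c *\<^sub>C (x::'h))" by (rule bounded_linear.linear[OF bounded_linear_scaleC])
    show "\<exists>z. c *\<^sub>C a y = a z" if "a \<in> S" for a y
      using apply_scaleC[of a c y] S(1) that by (intro exI[of _ "c *\<^sub>C y"]) auto
  qed
  then obtain q :: "'h \<Rightarrow>\<^sub>L 'h" where q: "projection q" "q \<in> bounded_operators" "\<And>x. q x \<in> closure V"
    "\<And>x. x \<in> closure V \<Longrightarrow> q x = x" "\<And>x v. v \<in> closure V \<Longrightarrow> inner (x - q x) v = 0"
    by (rule orthogonal_projection_exists[OF V]) blast+
  have qa: "q \<odot> a = a" if "a \<in> S" for a
    using q(4) sub[OF that] closure_subset by (intro blinfun_eqI) auto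
  have kerI: "q x = 0" if x: "\<And>a. a \<in> S \<Longrightarrow> a x = 0" for x
  proof -
    have "V \<subseteq> {v. inner x v = 0}"
      unfolding V_def
    proof (rule span_minimal)
      show "(\<Union>a\<in>S. range (blinfun_apply a)) \<subseteq> {v. inner x v = 0}"
        using x S by (auto simp: selfadjoint_inner[symmetric])
    qed (simp add: subspace_def inner_add_right)
    moreover have "closed {v. inner x v = 0}" by (intro closed_Collect_eq continuous_intros)
    ultimately have "closure V \<subseteq> {v. inner x v = 0}" by (rule closure_minimal)
    then have "inner x (q x) = 0" using q(3) by blast
    then show ?thesis using projection_inner[OF q(1), of x] by simp
  qed
  have "q \<odot> r = r \<odot> q" if r: "r \<in> commutant A" for r
  proof (rule blinfun_eqI)
    fix x
    have comm: "r (a y) = a (r y)" if "a \<in> S" for a y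
    proof -
      have "r \<odot> a = a \<odot> r" using r S(1) that unfolding commutant_def by blast
      from arg_cong[OF this, of "\<lambda>f. f y"] show ?thesis by simp
    qed
    have "r (q x) \<in> closure V"
    proof -
      have "blinfun_apply r ` V \<subseteq> V"
        using inv[of "blinfun_apply r"] comm blinfun.bounded_linear_right[of r] bounded_linear.linear by blast
      moreover have "blinfun_apply r ` closure V \<subseteq> closure (blinfun_apply r ` V)"
        by (rule image_closure_subset) (auto intro!: continuous_intros closure_subset simp: closure_subset)
      ultimately show ?thesis using q(3) closure_mono by blast
    qed
    then have 1: "q (r (q x)) = r (q x)" by (rule q(4))
    have "a (x - q x) = 0" if "a \<in> S" for a
    proof -
      have "inner y (a (x - q x)) = 0" for y
        using q(5)[of "a y" x] sub[OF that, of y] closure_subset[of V] selfadjoint_inner[OF S(2)[OF that], of y]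
        by (auto simp: inner_commute)
      then show ?thesis by (metis inner_eq_zero_iff)
    qed
    then have "q (r (x - q x)) = 0"
      using comm by (intro kerI) (metis blinfun.zero_right)
    then show "(q \<odot> r) x = (r \<odot> q) x" using 1 by (simp add: blinfun_simps)
  qed
  then have "q \<in> A" using q(2) bicommutant by (auto simp: commutant_def)
  then show thesis using q qa kerI by (intro that) auto
qed

text \<open>The parts are half of \<open>s + a\<close> and half of \<open>s - a\<close>, where
  \<open>s\<close> is the absolute value of \<open>a\<close>; their products vanish because
  \<open>s\<close> commutes with \<open>a\<close> and has the same square.\<close>

lemma positive_negative_parts:
  assumes a: "a \<in> A" "selfadjoint a"
  obtains b c where "b \<in> A" "c \<in> A" "positive_op b" "positive_op c" "a = b - c"
    "b \<odot> c = 0" "c \<odot> b = 0"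
proof -
  obtain s where s: "s \<in> A" "positive_op s" "s \<odot> s = a \<odot> a" and "a \<odot> a \<odot> a = a \<odot> (a \<odot> a) \<Longrightarrow> s \<odot> a = a \<odot> s"
    by (rule sqrt_exists[OF mult_mem[OF a(1) a(1)] positive_op_square[OF a(2)]]) blast
  moreover have "a \<odot> a \<odot> a = a \<odot> (a \<odot> a)" by (rule blinfun_eqI) simp
  ultimately have "s \<odot> a = a \<odot> s" by blast
  then have sa: "s (a v) = a (s v)" and ss: "s (s v) = a (a v)" for v
    using s(3) by (metis blinfun_apply_blinfun_compose)+
  \<comment> \<open>Used for \<open>e = a\<close> and \<open>e = - a\<close>. Since
    \<open>(s - e) (s + e) = 0\<close>, the operators \<open>s\<close> and \<open>e\<close> agree on
    the range of \<open>d = s + e\<close>; compressing \<open>d\<close> to this range therefore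
    shows the form of \<open>2 s\<close>, which is non-negative.\<close>
  have pos: "positive_op (s + e)" if e: "e \<in> A" "selfadjoint e" "\<And>v. s (e v) = e (s v)" "\<And>v. s (s v) = e (e v)" for e
  proof -
    define d where "d = s + e"
    have dA: "d \<in> A" and d: "selfadjoint d"
      using s e positive_selfadjoint by (auto simp: d_def mem_intros intro!: selfadjoint_intros)
    obtain q where q: "q \<in> A" "projection q" "q \<odot> d = d"
      "\<And>x. q x \<in> closure (span (\<Union>a\<in>{d}. range (blinfun_apply a)))"
      by (rule range_projection[of "{d}"]) (use dA d in auto)
    have "closure (span (\<Union>a\<in>{d}. range (blinfun_apply a))) \<subseteq> {v. s v = e v}"
    proof (rule closure_minimal)
      show "span (\<Union>a\<in>{d}. range (blinfun_apply a)) \<subseteq> {v. s v = e v}"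
      proof (rule span_minimal)
        show "(\<Union>a\<in>{d}. range (blinfun_apply a)) \<subseteq> {v. s v = e v}"
          by (auto simp: d_def blinfun_simps e)
      qed (simp add: subspace_def blinfun_simps)
      show "closed {v. s v = e v}" by (intro closed_Collect_eq continuous_intros)
    qed
    then have qe: "s (q v) = e (q v)" for v using q(4) by blast
    have qd: "d \<odot> q = d"
    proof (rule op_eqI)
      fix x y
      show "cinner x ((d \<odot> q) y) = cinner x (d y)"
        using q(3) by (metis blinfun_apply_blinfun_compose d projection_simps(2)[OF q(2)] selfadjoint_cinner)
    qed
    have "0 \<le> inner v (d v)" for v
    proof -
      have "inner v (d v) = inner v (q (d (q v)))" using q(3) qd by (metis blinfun_apply_blinfun_compose)
      also have "\<dots> = inner (q v) (d (q v))"
        by (simp add: selfadjoint_inner[OF projection_simps(2)[OF q(2)]])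
      also have "\<dots> = 2 * inner (q v) (s (q v))" by (simp add: d_def blinfun_simps inner_add_right qe)
      finally show ?thesis using positive_opD[OF s(2)] by simp
    qed
    then show ?thesis using d by (fold d_def) (rule positive_op_selfadjointI)
  qed
  show thesis
  proof
    show "(1/2) *\<^sub>R (s + a) \<in> A" "(1/2) *\<^sub>R (s - a) \<in> A" using s a by (auto simp: mem_intros)
    have "selfadjoint (- a)" using selfadjoint_scaleR[OF a(2), of "- 1"] by simp
    then have "positive_op (s - a)"
      using pos[of "- a"] a by (simp add: sa ss mem_intros blinfun_simps)
    then show "positive_op ((1/2) *\<^sub>R (s + a))" "positive_op ((1/2) *\<^sub>R (s - a))"
      using a by (auto intro!: positive_op_scaleR pos simp: sa ss)
    have "(1/2) *\<^sub>R (s + a) - (1/2) *\<^sub>R (s - a) = (1/2) *\<^sub>R ((s + a) - (s - a))"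
      by (simp only: scaleR_diff_right)
    also have "\<dots> = (1/2) *\<^sub>R (2 *\<^sub>R a)" by (simp add: scaleR_2)
    finally show "a = (1/2) *\<^sub>R (s + a) - (1/2) *\<^sub>R (s - a)" by simp
    show "(1/2) *\<^sub>R (s + a) \<odot> (1/2) *\<^sub>R (s - a) = 0" "(1/2) *\<^sub>R (s - a) \<odot> (1/2) *\<^sub>R (s + a) = 0"
      by (rule blinfun_eqI; simp add: blinfun_simps sa ss flip: scaleR_add_right)+
  qed
qed

lemma mult_selfadjoint_swap:
  assumes "selfadjoint a" "selfadjoint b" "selfadjoint (a \<odot> b)"
  shows "b \<odot> a = a \<odot> b"
proof (rule op_eqI)
  fix x y
  have "cinner x ((a \<odot> b) y) = cinner ((a \<odot> b) x) y" by (simp only: selfadjoint_cinner[OF assms(3)])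
  then show "cinner x ((b \<odot> a) y) = cinner x ((a \<odot> b) y)"
    by (simp add: selfadjoint_cinner[OF assms(1)] selfadjoint_cinner[OF assms(2)])
qed

text \<open>The range projection of \<open>c\<close> is a non-zero projection below
  \<open>e\<close>, hence equals \<open>e\<close>; and it annihilates the kernel of
  \<open>c\<close>.\<close>

lemma minimal_injective:
  assumes e: "minimal_projection A e" and c: "c \<in> A" "selfadjoint c" "c \<noteq> 0" "e \<odot> c = c"
    and v: "e v = v" "c v = 0"
  shows "v = 0"
proof -
  have eP: "projection e" using e by (simp add: minimal_projection_def)
  obtain q where q: "q \<in> A" "projection q" "q \<odot> c = c" "c v = 0 \<Longrightarrow> q v = 0"
      "\<And>x. q x \<in> closure (span (\<Union>a\<in>{c}. range (blinfun_apply a)))"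
    by (rule range_projection[of "{c}"]) (use c in auto)
  have "closure (span (\<Union>a\<in>{c}. range (blinfun_apply a))) \<subseteq> {v. e v = v}"
  proof (rule closure_minimal)
    show "span (\<Union>a\<in>{c}. range (blinfun_apply a)) \<subseteq> {v. e v = v}"
    proof (rule span_minimal)
      show "(\<Union>a\<in>{c}. range (blinfun_apply a)) \<subseteq> {v. e v = v}"
        using c(4) by (auto simp flip: blinfun_apply_blinfun_compose)
    qed (simp add: subspace_def blinfun_simps)
    show "closed {v. e v = v}" by (intro closed_Collect_eq continuous_intros)
  qed
  then have "e \<odot> q = q" using q(5) by (intro blinfun_eqI) auto
  then have "le_op q e" using projection_le_iff[OF q(2) eP] by simp
  moreover have "q \<noteq> 0" using q(3) c(3) by (auto simp: blinfun_compose.zero_left)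
  ultimately have "q = e" using e q(1,2) unfolding minimal_projection_def by blast
  then show "v = 0" using q(4) v by simp
qed

text \<open>From the hypotheses \<open>b \<odot> b\<close> vanishes on the range of
  \<open>1 - e\<close>, hence so does \<open>b\<close>. The intended \<open>b\<close> is the
  positive part of \<open>d\<close>, or the negative part with \<open>- d\<close> in place of
  \<open>d\<close>.\<close>

lemma positive_part_support:
  assumes e: "e \<in> A" "projection e" and b: "b \<in> A" "positive_op b" and d: "b \<odot> b = b \<odot> d" "d \<odot> e = d"
  shows "e \<odot> b = b"
proof -
  have sb: "selfadjoint b" using b positive_selfadjoint by blast
  have "b (y - e y) = 0" for y
  proof -
    have de: "d (e y) = d y" for y using arg_cong[OF d(2), of "\<lambda>f. f y"] by simp
    have bd: "b (b y) = b (d y)" for y using arg_cong[OF d(1), of "\<lambda>f. f y"] by simp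
    have "b (b (y - e y)) = 0" by (simp add: bd blinfun_simps de)
    then have "inner (b (y - e y)) (b (y - e y)) = 0" by (simp add: selfadjoint_inner[OF sb])
    then show ?thesis by simp
  qed
  then have be: "b \<odot> e = b" by (intro blinfun_eqI) (simp add: blinfun_simps)
  show ?thesis
    using mult_selfadjoint_swap[OF sb projection_simps(2)[OF e(2)]] be sb by simp
qed

text \<open>Subtracting the multiple of \<open>e\<close> makes the form vanish at \<open>x\<close>.
  If both parts of the remainder \<open>d\<close> were non-zero, both would be injective on the
  range of \<open>e\<close>, against \<open>p \<odot> n = 0\<close>. If just one is non-zero, its
  form vanishes at \<open>x\<close>, so it annihilates \<open>x\<close>, again against
  injectivity.\<close>

lemma minimal_compress_selfadjoint:
  assumes e: "minimal_projection A e" and x: "e x = x" "norm x = 1"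
    and b: "b \<in> A" "selfadjoint b" "e \<odot> b = b" "b \<odot> e = b"
  shows "b = inner x (b x) *\<^sub>R e"
proof (rule ccontr)
  have eA: "e \<in> A" and eP: "projection e" using e by (auto simp: minimal_projection_def)
  define d where "d = b - inner x (b x) *\<^sub>R e"
  have ed: "e \<odot> d = d" "d \<odot> e = d"
    using b projection_simps(1)[OF eP]
    by (simp_all add: d_def blinfun_compose.diff_left blinfun_compose.diff_right
        blinfun_compose.scaleR_left blinfun_compose.scaleR_right)
  have d: "d \<in> A" "selfadjoint d"
    using b eA projection_simps(2)[OF eP] by (auto simp: d_def mem_intros intro!: selfadjoint_intros)
  obtain p n where pn: "p \<in> A" "n \<in> A" "positive_op p" "positive_op n" "d = p - n" "p \<odot> n = 0" "n \<odot> p = 0"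
    using positive_negative_parts[OF d] by blast
  have sp: "selfadjoint p" "selfadjoint n" using pn positive_selfadjoint by auto
  have ep: "e \<odot> p = p"
    by (rule positive_part_support[OF eA eP pn(1,3) _ ed(2)]) (simp add: pn(5,6) blinfun_compose.diff_right)
  have en: "e \<odot> n = n"
  proof (rule positive_part_support[OF eA eP pn(2,4)])
    show "n \<odot> n = n \<odot> (- d)" by (simp add: pn(5,7) blinfun_compose.diff_right)
    show "- d \<odot> e = - d" using ed(2) by (simp add: blinfun_compose.minus_left)
  qed
  have x0: "x \<noteq> 0" using x by auto
  have form: "inner x (p x) = inner x (n x)"
  proof -
    have "inner x (d x) = 0"
      using x by (simp add: d_def blinfun_simps inner_diff_right power2_norm_eq_inner[symmetric])
    then show ?thesis by (simp add: pn(5) blinfun_simps inner_diff_right)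
  qed
  assume "b \<noteq> inner x (b x) *\<^sub>R e"
  then have "d \<noteq> 0" by (simp add: d_def)
  then consider "p = 0" "n \<noteq> 0" | "n = 0" "p \<noteq> 0" | "p \<noteq> 0" "n \<noteq> 0" using pn(5) by fastforce
  then show False
  proof cases
    case 1
    then have "n x = 0" using form by (intro positive_op_kernel[OF sp(2) pn(4)]) simp
    then show False using minimal_injective[OF e pn(2) sp(2) 1(2) en x(1)] x0 by simp
  next
    case 2
    then have "p x = 0" using form by (intro positive_op_kernel[OF sp(1) pn(3)]) simp
    then show False using minimal_injective[OF e pn(1) sp(1) 2(2) ep x(1)] x0 by simp
  next
    case 3
    have "p (n x) = 0" using arg_cong[OF pn(6), of "\<lambda>f. f x"] by simp
    moreover have "e (n x) = n x" using arg_cong[OF en, of "\<lambda>f. f x"] by simp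
    ultimately have "n x = 0" using minimal_injective[OF e pn(1) sp(1) 3(1) ep] by blast
    then show False using minimal_injective[OF e pn(2) sp(2) 3(2) en x(1)] x0 by simp
  qed
qed

lemma minimal_compress:
  assumes e: "minimal_projection A e" and x: "e x = x" "norm x = 1" and a: "a \<in> A"
  shows "e \<odot> a \<odot> e = cinner x (a x) *\<^sub>C e"
proof -
  have eA: "e \<in> A" and eP: "projection e" using e by (auto simp: minimal_projection_def)
  note ee = projection_simps(3)[OF eP]
  have *: "e (b (e y)) = inner x (b x) *\<^sub>R e y" "Im (cinner x (b x)) = 0" if b: "b \<in> A" "selfadjoint b" for b y
  proof -
    have "e \<odot> b \<odot> e = inner x ((e \<odot> b \<odot> e) x) *\<^sub>R e"
    proof (rule minimal_compress_selfadjoint[OF e x])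
      show "e \<odot> b \<odot> e \<in> A" using eA b by (simp add: mem_intros)
      show "selfadjoint (e \<odot> b \<odot> e)"
        using b projection_simps(2)[OF eP] by (simp add: selfadjoint_def is_adjoint_def)
      show "e \<odot> (e \<odot> b \<odot> e) = e \<odot> b \<odot> e" "(e \<odot> b \<odot> e) \<odot> e = e \<odot> b \<odot> e"
        by (rule blinfun_eqI, simp add: ee)+
    qed
    from arg_cong[OF this, of "\<lambda>f. f y"] show "e (b (e y)) = inner x (b x) *\<^sub>R e y"
      by (simp add: x(1) blinfun_simps selfadjoint_inner[OF projection_simps(2)[OF eP], symmetric])
    show "Im (cinner x (b x)) = 0" using b by (simp add: selfadjoint_Im)
  qed
  obtain b c where bc: "b \<in> A" "c \<in> A" "selfadjoint b" "selfadjoint c" "a = b + \<i> *\<^sub>C c"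
    using real_imaginary_parts[OF a] by blast
  have "cinner x (b x) = of_real (inner x (b x))" "cinner x (c x) = of_real (inner x (c x))"
    using *(2) bc by (simp_all add: complex_eq_iff Re_cinner)
  then have xa: "cinner x (a x) = of_real (inner x (b x)) + \<i> * of_real (inner x (c x))"
    by (simp add: bc(5) blinfun_simps cinner_simps)
  show ?thesis
    by (rule blinfun_eqI)
      (simp add: xa, simp add: bc(5) blinfun_simps *(1)[OF bc(1,3)] *(1)[OF bc(2,4)] apply_scaleC[OF eA] scaleC_add_left scaleC_of_real
        flip: scaleC_scaleC)
qed

lemma minimal_unit_vector:
  assumes "minimal_projection A e"
  obtains x where "e x = x" "norm x = 1"
proof -
  have eP: "projection e" and "e \<noteq> 0" using assms by (auto simp: minimal_projection_def)
  then obtain y where y: "e y \<noteq> 0" by (metis blinfun_eqI zero_blinfun.rep_eq)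
  show thesis
    by (rule that[of "(1 / norm (e y)) *\<^sub>R e y"])
      (use y in \<open>simp_all add: blinfun_simps projection_simps(3)[OF eP]\<close>)
qed

text \<open>Let \<open>w = e \<odot> w0 \<odot> f\<close> be non-zero. Then
  \<open>w \<odot> adj w\<close> is a non-zero multiple \<nu> of \<open>e\<close>, and
  \<open>adj w \<odot> a \<odot> f\<close> is a multiple \<open>l\<close> of \<open>f\<close>; so
  \<nu> times \<open>e \<odot> a \<odot> f\<close> equals \<open>l\<close> times \<open>w\<close>.
  The constant \<open>K\<close> is uniform in \<open>a\<close>, which later turns closeness at
  \<open>u\<close> into closeness in norm.\<close>

lemma minimal_corner:
  assumes e: "minimal_projection A e" and f: "minimal_projection A f"
  shows "\<exists>u\<in>A. \<exists>K. \<forall>a\<in>A. \<exists>\<alpha>. e \<odot> a \<odot> f = \<alpha> *\<^sub>C u \<and> cmod \<alpha> \<le> K * norm a"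
proof (cases "\<forall>a\<in>A. e \<odot> a \<odot> f = 0")
  case True
  then show ?thesis
    by (intro bexI[of _ 0] exI[of _ 0] ballI exI[of _ 0]) (auto simp: zero_mem)
next
  case False
  then obtain w0 where w0: "w0 \<in> A" "e \<odot> w0 \<odot> f \<noteq> 0" by blast
  have eA: "e \<in> A" and eP: "projection e" using e by (auto simp: minimal_projection_def)
  have fA: "f \<in> A" and fP: "projection f" using f by (auto simp: minimal_projection_def)
  note ee = projection_simps(3)[OF eP] and ff = projection_simps(3)[OF fP]
  have adj_ef: "adj e = e" "adj f = f"
    using selfadjoint_iff eA fA projection_simps(2)[OF eP] projection_simps(2)[OF fP] by auto
  define w where "w = e \<odot> w0 \<odot> f"
  have w: "w \<in> A" "w \<noteq> 0" using w0 eA fA by (auto simp: w_def mem_intros)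
  have adjw: "adj w = f \<odot> (adj w0 \<odot> e)"
    using w0 eA fA by (simp add: w_def adj_mult mem_intros adj_ef)
  have ew: "e (w y) = w y" "w (f y) = w y" "f (adj w y) = adj w y" "adj w (e y) = adj w y" for y
    unfolding adjw by (simp_all add: w_def ee ff)
  obtain x where x: "e x = x" "norm x = 1" using minimal_unit_vector[OF e] by blast
  obtain y where y: "f y = y" "norm y = 1" using minimal_unit_vector[OF f] by blast
  define \<nu> where "\<nu> = cinner x ((w \<odot> adj w) x)"
  have ww: "w (adj w v) = \<nu> *\<^sub>C e v" for v
  proof -
    have "e \<odot> (w \<odot> adj w) \<odot> e = \<nu> *\<^sub>C e"
      unfolding \<nu>_def by (rule minimal_compress[OF e x]) (simp add: mem_intros adj_mem w)
    from arg_cong[OF this, of "\<lambda>f. f v"] show ?thesis by (simp add: ew scaleC_blinfun_apply)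
  qed
  have \<nu>: "\<nu> \<noteq> 0"
  proof
    assume "\<nu> = 0"
    then have "w \<odot> adj w = 0" by (intro blinfun_eqI) (simp add: ww)
    then have "norm (adj w) = 0"
      using norm_adj_mult(1)[OF adj_mem[OF w(1)]] w by simp
    then show False using norm_adj_mult(2)[OF w(1)] w by simp
  qed
  have "\<exists>\<alpha>. e \<odot> a \<odot> f = \<alpha> *\<^sub>C w \<and> cmod \<alpha> \<le> (norm w / cmod \<nu>) * norm a" if a: "a \<in> A" for a
  proof (intro exI conjI)
    define l where "l = cinner y ((adj w \<odot> a) y)"
    have "f \<odot> (adj w \<odot> a) \<odot> f = l *\<^sub>C f"
      unfolding l_def by (rule minimal_compress[OF f y]) (simp add: mem_intros adj_mem w a)
    from arg_cong[OF this, of "\<lambda>f. f v" for v]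
    have l: "adj w (a (f v)) = l *\<^sub>C f v" for v by (simp add: ew scaleC_blinfun_apply)
    show "e \<odot> a \<odot> f = (l / \<nu>) *\<^sub>C w"
    proof (rule blinfun_eqI)
      fix v
      have "\<nu> *\<^sub>C e (a (f v)) = l *\<^sub>C w v"
        unfolding ww[symmetric] l by (simp add: apply_scaleC[OF w(1)] ew)
      then have "(1 / \<nu>) *\<^sub>C \<nu> *\<^sub>C e (a (f v)) = (1 / \<nu>) *\<^sub>C l *\<^sub>C w v" by simp
      then show "(e \<odot> a \<odot> f) v = ((l / \<nu>) *\<^sub>C w) v"
        using \<nu> by (simp add: scaleC_scaleC scaleC_blinfun_apply)
    qed
    have "cmod l \<le> norm y * norm ((adj w \<odot> a) y)" unfolding l_def by (rule cmod_cinner_le)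
    also have "\<dots> \<le> norm (adj w \<odot> a)" using norm_blinfun[of "adj w \<odot> a" y] y(2) by simp
    also have "\<dots> \<le> norm w * norm a" using norm_blinfun_compose[of "adj w" a] norm_adj_mult(2)[OF w(1)] by simp
    finally show "cmod (l / \<nu>) \<le> (norm w / cmod \<nu>) * norm a"
      using \<nu> by (simp add: norm_divide divide_right_mono)
  qed
  then show ?thesis using w(1) by blast
qed

section \<open>Orthogonal families of minimal projections\<close>

definition orthogonal_minimal :: "('h \<Rightarrow>\<^sub>L 'h) set \<Rightarrow> bool"
  where "orthogonal_minimal E \<longleftrightarrow>
    (\<forall>e\<in>E. minimal_projection A e) \<and> (\<forall>e\<in>E. \<forall>f\<in>E. e \<noteq> f \<longrightarrow> e \<odot> f = 0)"

lemma maximal_orthogonal_minimal: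
  obtains E where "orthogonal_minimal E" "\<And>E'. orthogonal_minimal E' \<Longrightarrow> E \<subseteq> E' \<Longrightarrow> E' = E"
proof -
  have "\<exists>M\<in>Collect orthogonal_minimal. \<forall>X\<in>Collect orthogonal_minimal. M \<subseteq> X \<longrightarrow> X = M"
  proof (rule Zorn_Lemma, rule ballI)
    fix C assume "C \<in> chains (Collect orthogonal_minimal)"
    then have C: "\<And>E. E \<in> C \<Longrightarrow> orthogonal_minimal E" and ch: "\<And>E F. E \<in> C \<Longrightarrow> F \<in> C \<Longrightarrow> E \<subseteq> F \<or> F \<subseteq> E"
      unfolding chains_def chain_subset_def by auto
    have "e \<odot> f = 0" if ef: "e \<in> E" "E \<in> C" "f \<in> F" "F \<in> C" "e \<noteq> f" for e f E F
    proof -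
      from ch[OF ef(2,4)] obtain G where "G \<in> C" "e \<in> G" "f \<in> G" using ef(1-4) by blast
      then show ?thesis using C[of G] ef(5) by (simp add: orthogonal_minimal_def)
    qed
    moreover have "minimal_projection A e" if "e \<in> E" "E \<in> C" for e E
      using C[OF that(2)] that(1) by (simp add: orthogonal_minimal_def)
    ultimately show "\<Union>C \<in> Collect orthogonal_minimal"
      unfolding orthogonal_minimal_def by blast
  qed
  then show thesis using that by blast
qed

lemma orthogonal_minimal_sum:
  assumes F: "orthogonal_minimal F" "finite F"
  shows "\<Sum>F \<in> A" "projection (\<Sum>F)" "e \<in> F \<Longrightarrow> \<Sum>F \<odot> e = e"
proof -
  have e: "e \<in> A \<and> projection e" if "e \<in> F" for e
    using F(1) that by (simp add: orthogonal_minimal_def minimal_projection_def)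
  show "\<Sum>F \<in> A" using e by (intro sum_mem) auto
  have Fe: "\<Sum>F \<odot> e = e" if "e \<in> F" for e
  proof -
    have "\<Sum>F \<odot> e = (\<Sum>f\<in>F. f \<odot> e)" by (simp add: blinfun_compose.sum_left)
    also have "\<dots> = (\<Sum>f\<in>F. if f = e then e else 0)"
      using F(1) that e[OF that] projection_simps(1)[of e]
      by (intro sum.cong) (auto simp: orthogonal_minimal_def)
    also have "\<dots> = e" using F(2) that by (simp add: sum.delta)
    finally show ?thesis .
  qed
  then show "e \<in> F \<Longrightarrow> \<Sum>F \<odot> e = e" by blast
  have "\<Sum>F \<odot> \<Sum>F = \<Sum>F"
    using Fe by (simp add: blinfun_compose.sum_right)
  moreover have "selfadjoint (\<Sum>F)"
    using F(2) e by (induction F rule: finite_induct) (auto intro: selfadjoint_intros simp: projection_simps(2))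
  ultimately show "projection (\<Sum>F)" by (simp add: projection_def)
qed

text \<open>If the projection \<open>q\<close> onto the closed span were not the identity, atomicity
  would give a minimal projection below \<open>1 - q\<close>. It is orthogonal to all of
  \<open>E\<close>, so it could be added to \<open>E\<close>.\<close>

lemma maximal_orthogonal_dense:
  assumes "atomic A" and E: "orthogonal_minimal E" and max: "\<And>E'. orthogonal_minimal E' \<Longrightarrow> E \<subseteq> E' \<Longrightarrow> E' = E"
  shows "closure (span (\<Union>e\<in>E. range (blinfun_apply e))) = UNIV"
proof -
  have e: "e \<in> A" "projection e" "minimal_projection A e" if "e \<in> E" for e
    using E that by (simp_all add: orthogonal_minimal_def minimal_projection_def)
  have sE: "E \<subseteq> A" "\<And>e. e \<in> E \<Longrightarrow> selfadjoint e" using e projection_simps(2)[OF e(2)] by auto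
  obtain q where q: "q \<in> A" "projection q" "\<And>e. e \<in> E \<Longrightarrow> q \<odot> e = e"
      "\<And>x. q x \<in> closure (span (\<Union>e\<in>E. range (blinfun_apply e)))"
    by (rule range_projection[OF sE]) blast+
  have "q = id_blinfun"
  proof (rule ccontr)
    assume "q \<noteq> id_blinfun"
    define p where "p = id_blinfun - q"
    have p: "p \<in> A" "p \<noteq> 0" using q \<open>q \<noteq> id_blinfun\<close> by (auto simp: p_def mem_intros)
    have "p \<odot> p = p"
      by (rule blinfun_eqI) (simp add: p_def blinfun_simps projection_simps(3)[OF q(2)])
    moreover have "selfadjoint p"
      unfolding p_def by (intro selfadjoint_intros projection_simps q)
    ultimately have pP: "projection p" by (simp add: projection_def)
    then obtain f where f: "minimal_projection A f" "le_op f p"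
      using assms(1) p unfolding atomic_def by blast
    have fA: "f \<in> A" and fP: "projection f" and f0: "f \<noteq> 0" using f by (auto simp: minimal_projection_def)
    have "p \<odot> f = f" using f(2) projection_le_iff[OF fP pP] by simp
    from arg_cong[OF this, of "\<lambda>r. r y" for y] have pf: "p (f y) = f y" for y by simp
    have qf: "q (f y) = 0" for y
      using pf[of y] by (simp add: p_def blinfun_simps)
    have ef: "e \<odot> f = 0" "f \<odot> e = 0" if "e \<in> E" for e
    proof -
      have "e \<odot> q = e"
        using mult_selfadjoint_swap[of q e] q(3)[OF that] projection_simps(2)[OF q(2)]
          projection_simps(2)[OF e(2)[OF that]] by simp
      from arg_cong[OF this, of "\<lambda>r. r y" for y] have eq: "e (q y) = e y" for y by simp
      show ef: "e \<odot> f = 0" by (rule blinfun_eqI) (metis blinfun_apply_blinfun_compose eq qf blinfun.zero_left blinfun.zero_right)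
      then show "f \<odot> e = 0"
        using mult_selfadjoint_swap[of e f] projection_simps(2)[OF fP]
          projection_simps(2)[OF e(2)[OF that]] selfadjoint_0 by simp
    qed
    have "orthogonal_minimal (insert f E)"
      using E f(1) ef unfolding orthogonal_minimal_def by blast
    then have "f \<in> E" using max[of "insert f E"] by blast
    then have "f \<odot> f = 0" using ef by blast
    then show False using projection_simps(1)[OF fP] f0 by simp
  qed
  then show ?thesis using q(4) by auto
qed

lemma orthogonal_minimal_mono: "orthogonal_minimal E \<Longrightarrow> F \<subseteq> E \<Longrightarrow> orthogonal_minimal F"
  by (simp add: orthogonal_minimal_def subset_iff)

text \<open>The finite partial sums of a maximal orthogonal family form an upward directed set with
  supremum 1, and order continuity of \<phi> applies to it.\<close>

lemma normal_approx_minimal_sum: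
  assumes at: "atomic A" and \<phi>: "normal_functional A \<phi>" and \<epsilon>: "\<epsilon> > 0"
  obtains F where "orthogonal_minimal F" "finite F" "cmod (\<phi> (\<Sum>F) - \<phi> id_blinfun) < \<epsilon>"
proof -
  obtain E where E: "orthogonal_minimal E" "\<And>E'. orthogonal_minimal E' \<Longrightarrow> E \<subseteq> E' \<Longrightarrow> E' = E"
    using maximal_orthogonal_minimal by blast
  let ?V = "span (\<Union>e\<in>E. range (blinfun_apply e))"
  have dense: "closure ?V = UNIV" by (rule maximal_orthogonal_dense[OF at E])
  define D where "D = Sum ` {F. finite F \<and> F \<subseteq> E}"
  have F: "\<Sum>F \<in> A" "projection (\<Sum>F)" "\<And>e. e \<in> F \<Longrightarrow> \<Sum>F \<odot> e = e" if "finite F" "F \<subseteq> E" for F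
    using orthogonal_minimal_sum[OF orthogonal_minimal_mono[OF E(1) that(2)] that(1)] by auto
  have FG: "\<Sum>G \<odot> \<Sum>F = \<Sum>F" if "finite G" "G \<subseteq> E" "F \<subseteq> G" for F G
    using F(3)[OF that(1,2)] that(3) by (simp add: blinfun_compose.sum_right subset_iff)
  have le: "le_op (\<Sum>F) (\<Sum>G)" if "finite G" "G \<subseteq> E" "F \<subseteq> G" for F G
  proof -
    have "finite F" "F \<subseteq> E" using that finite_subset by auto
    then show ?thesis using projection_le_iff[OF F(2) F(2)[OF that(1,2)]] FG[OF that] by simp
  qed
  have "D \<subseteq> A" "\<forall>d\<in>D. selfadjoint d" using F(1) projection_simps(2)[OF F(2)] by (auto simp: D_def)
  moreover have "upward_directed D"
    unfolding upward_directed_def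
  proof (intro conjI ballI)
    show "D \<noteq> {}" by (auto simp: D_def)
    fix a b assume "a \<in> D" "b \<in> D"
    then obtain F G where FG: "finite F" "F \<subseteq> E" "a = \<Sum>F" "finite G" "G \<subseteq> E" "b = \<Sum>G"
      by (auto simp: D_def)
    then have "\<Sum>(F \<union> G) \<in> D" "le_op a (\<Sum>(F \<union> G))" "le_op b (\<Sum>(F \<union> G))"
      by (auto simp: D_def intro!: le)
    then show "\<exists>d\<in>D. le_op a d \<and> le_op b d" by blast
  qed
  moreover have "supremum_in A D id_blinfun"
    unfolding supremum_in_def
  proof (intro conjI ballI impI)
    show "id_blinfun \<in> A" "selfadjoint (id_blinfun :: 'h \<Rightarrow>\<^sub>L 'h)" by (simp_all add: id_mem selfadjoint_id)
    have idP: "projection (id_blinfun :: 'h \<Rightarrow>\<^sub>L 'h)"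
      by (auto simp: projection_def selfadjoint_id intro: blinfun_eqI)
    show "le_op d id_blinfun" if "d \<in> D" for d
    proof -
      obtain F where d: "finite F" "F \<subseteq> E" "d = \<Sum>F" using \<open>d \<in> D\<close> by (auto simp: D_def)
      have "id_blinfun \<odot> d = d" by (rule blinfun_eqI) simp
      then show ?thesis using projection_le_iff[OF F(2)[OF d(1,2)] idP] d(3) by simp
    qed
    fix b assume b: "b \<in> A" "selfadjoint b \<and> (\<forall>d\<in>D. le_op d b)"
    \<comment> \<open>Each vector of the algebraic span is fixed by some finite partial sum, so an
      upper bound \<open>b\<close> dominates the identity there, and by density everywhere.\<close>
    have ev: "\<exists>F. finite F \<and> F \<subseteq> E \<and> (\<Sum>F) v = v" if "v \<in> ?V" for v
      using that
    proof (induction rule: span_induct_alt)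
      case base
      show ?case by (intro exI[of _ "{}"]) (simp add: blinfun_simps)
    next
      case (step c v w)
      then obtain F where Fw: "finite F" "F \<subseteq> E" "(\<Sum>F) w = w" by blast
      obtain e y where e: "e \<in> E" "v = e y" using step by blast
      let ?G = "insert e F"
      have G: "finite ?G" "?G \<subseteq> E" using Fw e by auto
      have "(\<Sum>?G) ((\<Sum>F) w) = (\<Sum>F) w"
        using arg_cong[OF FG[OF G, of F], of "\<lambda>r. r w"] by auto
      then have "(\<Sum>?G) w = w" unfolding Fw(3) .
      moreover have "(\<Sum>?G) v = v"
        using arg_cong[OF F(3)[OF G, of e], of "\<lambda>r. r y"] e by auto
      ultimately have "(\<Sum>?G) (c *\<^sub>R v + w) = c *\<^sub>R v + w" by (simp only: blinfun.add_right blinfun.scaleR_right)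
      then show ?case using G by blast
    qed
    have "?V \<subseteq> {v. inner v v \<le> inner v (b v)}"
    proof
      fix v assume "v \<in> ?V"
      then obtain F where Fv: "finite F" "F \<subseteq> E" "(\<Sum>F) v = v" using ev by blast
      then have "le_op (\<Sum>F) b" using b by (auto simp: D_def)
      then have "0 \<le> inner v ((b - \<Sum>F) v)" by (simp add: le_op_def positive_opD)
      then show "v \<in> {v. inner v v \<le> inner v (b v)}"
        by (simp only: blinfun.diff_left Fv mem_Collect_eq inner_diff_right)
    qed
    moreover have "closed {v. inner v v \<le> inner v (b v)}"
      by (intro closed_Collect_le continuous_intros)
    ultimately have "closure ?V \<subseteq> {v. inner v v \<le> inner v (b v)}" by (rule closure_minimal)
    then have bv: "inner v v \<le> inner v (b v)" for v using dense by auto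
    show "le_op id_blinfun b"
      unfolding le_op_def
    proof (rule positive_op_selfadjointI)
      show "selfadjoint (b - id_blinfun)" using b by (intro selfadjoint_diff selfadjoint_id) blast
      show "0 \<le> inner x ((b - id_blinfun) x)" for x using bv[of x] by (simp add: blinfun_simps inner_diff_right)
    qed
  qed
  ultimately obtain d0 where d0: "d0 \<in> D" "\<forall>d\<in>D. le_op d0 d \<longrightarrow> cmod (\<phi> d - \<phi> id_blinfun) < \<epsilon>"
    using \<phi> \<epsilon> unfolding normal_functional_def by blast
  then obtain F0 where F0: "finite F0" "F0 \<subseteq> E" "d0 = \<Sum>F0" by (auto simp: D_def)
  have "cmod (\<phi> d0 - \<phi> id_blinfun) < \<epsilon>"
    using d0 le[OF F0(1,2) order_refl] F0(3) by blast
  then show thesis using that[of F0] orthogonal_minimal_mono[OF E(1) F0(2)] F0 by blast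
qed

end

section \<open>Functionals dominated by a normal functional\<close>

lemma finite_convergent_subsequence:
  fixes g :: "nat \<Rightarrow> 'i \<Rightarrow> complex"
  assumes "finite I" "\<And>i n. i \<in> I \<Longrightarrow> cmod (g n i) \<le> B i"
  shows "\<exists>r. strict_mono (r :: nat \<Rightarrow> nat) \<and> (\<forall>i\<in>I. convergent (\<lambda>n. g (r n) i))"
  using assms
proof (induction I rule: finite_induct)
  case empty
  show ?case by (intro exI[of _ id]) (simp add: strict_mono_def)
next
  case (insert j I)
  then obtain r :: "nat \<Rightarrow> nat" where r: "strict_mono r" "\<And>i. i \<in> I \<Longrightarrow> convergent (\<lambda>n. g (r n) i)" by auto
  have "bounded (range (\<lambda>n. g (r n) j))"
    using insert.prems[of j] by (intro boundedI[of _ "B j"]) auto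
  then obtain l s where s: "strict_mono (s :: nat \<Rightarrow> nat)" "((\<lambda>n. g (r n) j) \<circ> s) \<longlonglongrightarrow> l"
    using bounded_imp_convergent_subsequence by blast
  have "convergent (\<lambda>n. g ((r \<circ> s) n) i)" if "i \<in> insert j I" for i
  proof (cases "i = j")
    case True
    then show ?thesis using s(2) by (auto simp: o_def convergent_def)
  next
    case False
    then have "convergent (\<lambda>n. g (r n) i)" using r(2) that by blast
    then show ?thesis using convergent_subseq_convergent[OF _ s(1)] by (fastforce simp: o_def)
  qed
  moreover have "strict_mono (r \<circ> s)" using r(1) s(1) by (simp add: strict_mono_o)
  ultimately show ?case by blast
qed

text \<open>Bolzano-Weierstrass in finitely many bounded coordinates. Two distinct nearby terms are
  all that the recurrence argument needs.\<close>

lemma finite_close_indices: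
  fixes g :: "nat \<Rightarrow> 'i \<Rightarrow> complex"
  assumes "finite I" "\<And>i n. i \<in> I \<Longrightarrow> cmod (g n i) \<le> B i" "\<delta> > 0"
  obtains m n where "m < n" "\<And>i. i \<in> I \<Longrightarrow> cmod (g m i - g n i) < \<delta>"
proof -
  obtain r :: "nat \<Rightarrow> nat" where r: "strict_mono r" "\<And>i. i \<in> I \<Longrightarrow> convergent (\<lambda>n. g (r n) i)"
    using finite_convergent_subsequence[of I g B, OF assms(1,2)] by auto
  have "\<forall>i\<in>I. \<exists>M. \<forall>m\<ge>M. \<forall>n\<ge>M. dist (g (r m) i) (g (r n) i) < \<delta>"
    using r(2) convergent_Cauchy metric_CauchyD[OF _ assms(3)] by blast
  then obtain M where M: "\<And>i m n. i \<in> I \<Longrightarrow> m \<ge> M i \<Longrightarrow> n \<ge> M i \<Longrightarrow> dist (g (r m) i) (g (r n) i) < \<delta>" by metis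
  define N where "N = Max (insert 0 (M ` I))"
  have "M i \<le> N" if "i \<in> I" for i using assms(1) that by (simp add: N_def)
  then show thesis
    using that[of "r N" "r (Suc N)"] r(1) M by (simp add: strict_mono_def dist_norm le_Suc_eq)
qed

context von_neumann
begin

definition positive_functional :: "(('h \<Rightarrow>\<^sub>L 'h) \<Rightarrow> complex) \<Rightarrow> bool"
  where "positive_functional \<psi> \<longleftrightarrow> \<psi> \<in> dual_space A \<and> functional_le A (\<lambda>_. 0) \<psi>"

lemma positive_functional_add: "positive_functional \<psi> \<Longrightarrow> a \<in> A \<Longrightarrow> b \<in> A \<Longrightarrow> \<psi> (a + b) = \<psi> a + \<psi> b"
  and positive_functional_scaleC: "positive_functional \<psi> \<Longrightarrow> a \<in> A \<Longrightarrow> \<psi> (c *\<^sub>C a) = c * \<psi> a"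
  and positive_functional_Re: "positive_functional \<psi> \<Longrightarrow> a \<in> A \<Longrightarrow> positive_op a \<Longrightarrow> 0 \<le> Re (\<psi> a)"
  and positive_functional_Im: "positive_functional \<psi> \<Longrightarrow> a \<in> A \<Longrightarrow> positive_op a \<Longrightarrow> Im (\<psi> a) = 0"
  by (auto simp: positive_functional_def dual_space_def functional_le_def nonneg_Reals_iff)

lemma positive_functional_scaleR: "positive_functional \<psi> \<Longrightarrow> a \<in> A \<Longrightarrow> \<psi> (r *\<^sub>R a) = of_real r * \<psi> a"
  by (metis positive_functional_scaleC scaleC_of_real)

lemma positive_functional_diff:
  assumes "positive_functional \<psi>" "a \<in> A" "b \<in> A"
  shows "\<psi> (a - b) = \<psi> a - \<psi> b"
  using positive_functional_add[OF assms(1) diff_mem[OF assms(2,3)] assms(3)] by simp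

lemma positive_functional_sum:
  assumes "positive_functional \<psi>" "\<And>i. i \<in> I \<Longrightarrow> f i \<in> A"
  shows "\<psi> (sum f I) = (\<Sum>i\<in>I. \<psi> (f i))"
  using assms(2)
proof (induction I rule: infinite_finite_induct)
  case (insert i I)
  then show ?case by (simp add: positive_functional_add[OF assms(1)] sum_mem)
qed (use positive_functional_scaleC[OF assms(1) zero_mem, of 0] in auto)

lemma positive_functional_selfadjoint:
  assumes "positive_functional \<psi>" "a \<in> A" "selfadjoint a"
  shows "Im (\<psi> a) = 0"
proof -
  have "Im (\<psi> (norm a *\<^sub>R id_blinfun - a)) = 0" "Im (\<psi> id_blinfun) = 0"
    by (rule positive_functional_Im[OF assms(1)],
      (simp add: mem_intros assms le_norm_id positive_op_id; fail)+)+
  then show ?thesis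
    using assms by (simp add: positive_functional_diff positive_functional_scaleR mem_intros)
qed

lemma positive_functional_adj:
  assumes \<psi>: "positive_functional \<psi>" and a: "a \<in> A"
  shows "\<psi> (adj a) = cnj (\<psi> a)"
proof -
  obtain b c where bc: "b \<in> A" "c \<in> A" "selfadjoint b" "selfadjoint c" "a = b + \<i> *\<^sub>C c"
    using real_imaginary_parts[OF a] by blast
  have "adj a = b + (- \<i>) *\<^sub>C c"
    using bc selfadjoint_iff by (simp add: adj_add adj_scaleC mem_intros)
  then show ?thesis
    using bc positive_functional_selfadjoint[OF \<psi>, of b] positive_functional_selfadjoint[OF \<psi>, of c]
    by (simp add: positive_functional_add[OF \<psi>] positive_functional_scaleC[OF \<psi>] mem_intros complex_eq_iff)
qed

text \<open>The sesquilinear form \<open>\<psi> (adj u \<odot> c \<odot> v)\<close> is positive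
  semidefinite. The weight \<open>c\<close> is needed to dominate vector functionals by \<phi>; with
  \<open>c = 1\<close> it is the usual inequality.\<close>

lemma functional_cauchy_schwarz:
  assumes \<psi>: "positive_functional \<psi>" and c: "c \<in> A" "positive_op c" and u: "u \<in> A" and v: "v \<in> A"
  shows "(cmod (\<psi> (adj u \<odot> c \<odot> v)))\<^sup>2 \<le> Re (\<psi> (adj u \<odot> c \<odot> u)) * Re (\<psi> (adj v \<odot> c \<odot> v))"
proof (rule nonneg_form_imp_cauchy_schwarz)
  fix w
  have sc: "adj c = c" using c positive_selfadjoint selfadjoint_iff by blast
  have m: "adj p \<odot> c \<odot> q \<in> A" if "p \<in> A" "q \<in> A" for p q using that c by (simp add: mem_intros adj_mem)
  let ?y = "u + w *\<^sub>C v"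
  have yA: "?y \<in> A" using u v by (simp add: mem_intros)
  have "adj ?y \<odot> c \<odot> ?y = adj u \<odot> c \<odot> u + w *\<^sub>C (adj u \<odot> c \<odot> v) + cnj w *\<^sub>C (adj v \<odot> c \<odot> u)
      + (w * cnj w) *\<^sub>C (adj v \<odot> c \<odot> v)"
    using u v c
    by (intro blinfun_eqI)
      (simp add: adj_add adj_scaleC mem_intros adj_mem blinfun_simps apply_scaleC scaleC_add_right scaleC_scaleC mult.commute)
  then have "\<psi> (adj ?y \<odot> c \<odot> ?y) = \<psi> (adj u \<odot> c \<odot> u) + w * \<psi> (adj u \<odot> c \<odot> v) + cnj w * \<psi> (adj v \<odot> c \<odot> u)
      + (w * cnj w) * \<psi> (adj v \<odot> c \<odot> v)"
    using u v by (simp add: positive_functional_add[OF \<psi>] positive_functional_scaleC[OF \<psi>] mem_intros m)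
  moreover have "adj v \<odot> c \<odot> u = adj (adj u \<odot> c \<odot> v)"
    using u v c by (simp add: adj_mult mem_intros adj_mem sc) (simp add: blinfun_eqI)
  then have "\<psi> (adj v \<odot> c \<odot> u) = cnj (\<psi> (adj u \<odot> c \<odot> v))"
    using positive_functional_adj[OF \<psi> m[OF u v]] by simp
  ultimately have "Re (\<psi> (adj ?y \<odot> c \<odot> ?y)) = Re (\<psi> (adj u \<odot> c \<odot> u)) + 2 * Re (w * \<psi> (adj u \<odot> c \<odot> v))
      + (cmod w)\<^sup>2 * Re (\<psi> (adj v \<odot> c \<odot> v))"
    by (simp add: complex_norm_square[symmetric] del: of_real_power)
  moreover have "0 \<le> Re (\<psi> (adj ?y \<odot> c \<odot> ?y))"
    by (intro positive_functional_Re[OF \<psi>] m positive_conj yA c)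
  ultimately show "0 \<le> Re (\<psi> (adj u \<odot> c \<odot> u)) + 2 * Re (w * \<psi> (adj u \<odot> c \<odot> v))
      + (cmod w)\<^sup>2 * Re (\<psi> (adj v \<odot> c \<odot> v))" by simp
qed

lemma mult_id_left: "id_blinfun \<odot> a = a" and mult_id_right: "a \<odot> id_blinfun = a"
  for a :: "'h \<Rightarrow>\<^sub>L 'h"
  by (rule blinfun_eqI, simp)+

lemma functional_square_le:
  assumes \<psi>: "positive_functional \<psi>" and a: "a \<in> A"
  shows "Re (\<psi> (adj a \<odot> a)) \<le> (norm a)\<^sup>2 * Re (\<psi> id_blinfun)"
proof -
  have m: "adj a \<odot> a \<in> A" using a by (simp add: mem_intros adj_mem)
  have "positive_op ((norm a)\<^sup>2 *\<^sub>R id_blinfun - adj a \<odot> a)"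
    by (intro le_norm_id m selfadjoint_adj_mult a) (simp add: norm_adj_mult a)
  then have "0 \<le> Re (\<psi> ((norm a)\<^sup>2 *\<^sub>R id_blinfun - adj a \<odot> a))"
    using m by (intro positive_functional_Re[OF \<psi>]) (auto simp: mem_intros)
  then show ?thesis
    using m by (simp add: positive_functional_diff[OF \<psi>] positive_functional_scaleR[OF \<psi>] mem_intros del: of_real_power)
qed

lemma functional_mult_le:
  assumes \<psi>: "positive_functional \<psi>" and u: "u \<in> A" and v: "v \<in> A"
  shows "(cmod (\<psi> (adj u \<odot> v)))\<^sup>2 \<le> Re (\<psi> (adj u \<odot> u)) * Re (\<psi> (adj v \<odot> v))"
  using functional_cauchy_schwarz[OF \<psi> id_mem positive_op_id u v] by (simp add: mult_id_right)

lemma adj_id: "adj id_blinfun = (id_blinfun :: 'h \<Rightarrow>\<^sub>L 'h)"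
  by (metis id_mem selfadjoint_id selfadjoint_iff)

lemma functional_bound:
  assumes \<psi>: "positive_functional \<psi>" and a: "a \<in> A"
  shows "cmod (\<psi> a) \<le> Re (\<psi> id_blinfun) * norm a"
proof -
  have p: "0 \<le> Re (\<psi> id_blinfun)" by (rule positive_functional_Re[OF \<psi> id_mem positive_op_id])
  have "(cmod (\<psi> a))\<^sup>2 \<le> Re (\<psi> id_blinfun) * Re (\<psi> (adj a \<odot> a))"
    using functional_mult_le[OF \<psi> id_mem a] by (simp add: adj_id mult_id_left)
  also have "\<dots> \<le> Re (\<psi> id_blinfun) * ((norm a)\<^sup>2 * Re (\<psi> id_blinfun))"
    by (intro mult_left_mono functional_square_le \<psi> a p)
  finally have "(cmod (\<psi> a))\<^sup>2 \<le> (Re (\<psi> id_blinfun) * norm a)\<^sup>2" by (simp add: power2_eq_square mult_ac)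
  then show ?thesis by (rule power2_le_imp_le) (simp add: p)
qed

text \<open>With \<open>r = 1 - p\<close>, the difference \<open>a - p \<odot> a \<odot> p\<close>
  is \<open>r \<odot> a + p \<odot> a \<odot> r\<close>. Cauchy-Schwarz bounds each term through the
  square root of \<open>\<psi> r\<close>, which is why the defect of \<open>p\<close> is measured by
  the square of \<eta>.\<close>

lemma dominated_compression:
  assumes \<phi>: "positive_functional \<phi>" "\<phi> id_blinfun = 1"
    and \<psi>: "positive_functional \<psi>" "\<And>a. a \<in> A \<Longrightarrow> positive_op a \<Longrightarrow> Re (\<psi> a) \<le> C * Re (\<phi> a)"
    and p: "p \<in> A" "projection p" "cmod (\<phi> p - \<phi> id_blinfun) \<le> \<eta>\<^sup>2" and \<eta>: "0 \<le> \<eta>" and a: "a \<in> A"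
  shows "cmod (\<psi> a - \<psi> (p \<odot> a \<odot> p)) \<le> 2 * C * \<eta> * norm a"
proof -
  define r where "r = id_blinfun - p"
  have rA: "r \<in> A" using p by (simp add: r_def mem_intros)
  have rs: "selfadjoint r" unfolding r_def by (intro selfadjoint_intros projection_simps p)
  then have radj: "adj r = r" using selfadjoint_iff[OF rA] by simp
  have rr: "r \<odot> r = r"
    by (rule blinfun_eqI) (simp add: r_def blinfun_simps projection_simps(3)[OF p(2)])
  have rpos: "positive_op r" using positive_op_square[OF rs] rr by simp
  have \<psi>1: "Re (\<psi> id_blinfun) \<le> C"
    using \<psi>(2)[OF id_mem positive_op_id] \<phi>(2) by simp
  have C0: "0 \<le> C" using \<psi>1 positive_functional_Re[OF \<psi>(1) id_mem positive_op_id] by simp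
  have "Re (\<phi> r) \<le> cmod (\<phi> r)" by (rule complex_Re_le_cmod)
  also have "\<dots> = cmod (\<phi> p - \<phi> id_blinfun)"
    unfolding r_def positive_functional_diff[OF \<phi>(1) id_mem p(1)] by (rule norm_minus_commute)
  finally have \<phi>r: "Re (\<phi> r) \<le> \<eta>\<^sup>2" using p(3) by simp
  have \<psi>r: "Re (\<psi> r) \<le> C * \<eta>\<^sup>2"
    using \<psi>(2)[OF rA rpos] mult_left_mono[OF \<phi>r C0] by simp
  have \<psi>r0: "0 \<le> Re (\<psi> r)" by (rule positive_functional_Re[OF \<psi>(1) rA rpos])
  have sq: "Re (\<psi> (adj b \<odot> b)) \<le> C * (norm b)\<^sup>2" "0 \<le> Re (\<psi> (adj b \<odot> b))" if b: "b \<in> A" for b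
  proof -
    have "(norm b)\<^sup>2 * Re (\<psi> id_blinfun) \<le> (norm b)\<^sup>2 * C" by (intro mult_left_mono \<psi>1) simp
    then show "Re (\<psi> (adj b \<odot> b)) \<le> C * (norm b)\<^sup>2"
      using functional_square_le[OF \<psi>(1) b] by (simp add: mult.commute)
    show "0 \<le> Re (\<psi> (adj b \<odot> b))"
      by (intro positive_functional_Re[OF \<psi>(1)] positive_adj_mult mem_intros adj_mem b)
  qed
  have np: "norm p \<le> 1"
  proof -
    have "(norm p)\<^sup>2 = norm p"
      using norm_adj_mult(1)[OF p(1)] selfadjoint_iff[OF p(1)] projection_simps(1,2)[OF p(2)] by simp
    then show ?thesis by (auto simp: power2_eq_square)
  qed
  have bnd: "cmod z \<le> C * \<eta> * norm a" if "(cmod z)\<^sup>2 \<le> s * t" "s \<le> C * \<eta>\<^sup>2" "0 \<le> s" "t \<le> C * (norm a)\<^sup>2" "0 \<le> t" for z s t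
  proof -
    have "s * t \<le> (C * \<eta>\<^sup>2) * (C * (norm a)\<^sup>2)" using that C0 by (intro mult_mono) auto
    then have "(cmod z)\<^sup>2 \<le> (C * \<eta> * norm a)\<^sup>2" using that(1) by (simp add: power_mult_distrib power2_eq_square mult_ac)
    then show ?thesis by (rule power2_le_imp_le) (simp add: C0 \<eta>)
  qed
  have 1: "cmod (\<psi> (r \<odot> a)) \<le> C * \<eta> * norm a"
    by (rule bnd[OF functional_mult_le[OF \<psi>(1) rA a, unfolded radj rr] \<psi>r \<psi>r0 sq[OF a]])
  have pa: "p \<odot> a \<in> A" using p a by (simp add: mem_intros)
  have npa: "norm (adj (p \<odot> a)) \<le> norm a"
    unfolding norm_adj_mult(2)[OF pa] using norm_blinfun_compose[of p a] mult_right_mono[OF np, of "norm a"] by simp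
  have 2: "cmod (\<psi> (p \<odot> a \<odot> r)) \<le> C * \<eta> * norm a"
  proof (rule bnd)
    have "(cmod (\<psi> (p \<odot> a \<odot> r)))\<^sup>2 \<le> Re (\<psi> (adj (adj (p \<odot> a)) \<odot> adj (p \<odot> a))) * Re (\<psi> (adj r \<odot> r))"
      using functional_mult_le[OF \<psi>(1) adj_mem[OF pa] rA] by (simp only: adj_adj[OF pa])
    then show "(cmod (\<psi> (p \<odot> a \<odot> r)))\<^sup>2 \<le> Re (\<psi> r) * Re (\<psi> (adj (adj (p \<odot> a)) \<odot> adj (p \<odot> a)))"
      by (simp only: radj rr mult.commute)
    have "C * (norm (adj (p \<odot> a)))\<^sup>2 \<le> C * (norm a)\<^sup>2"
      using npa C0 by (intro mult_left_mono power_mono) auto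
    then show "Re (\<psi> (adj (adj (p \<odot> a)) \<odot> adj (p \<odot> a))) \<le> C * (norm a)\<^sup>2"
      using sq(1)[OF adj_mem[OF pa]] by linarith
    show "0 \<le> Re (\<psi> (adj (adj (p \<odot> a)) \<odot> adj (p \<odot> a)))" by (rule sq(2)[OF adj_mem[OF pa]])
  qed (use \<psi>r \<psi>r0 in auto)
  have "a = p \<odot> a \<odot> p + (r \<odot> a + p \<odot> a \<odot> r)"
    by (rule blinfun_eqI) (simp add: r_def blinfun_simps)
  then have "\<psi> a = \<psi> (p \<odot> a \<odot> p) + (\<psi> (r \<odot> a) + \<psi> (p \<odot> a \<odot> r))"
    using p a rA by (metis (no_types, lifting) \<psi>(1) positive_functional_add add_mem mult_mem)
  then show ?thesis
    using norm_triangle_ineq[of "\<psi> (r \<odot> a)" "\<psi> (p \<odot> a \<odot> r)"] 1 2 by simp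
qed

text \<open>This is the total boundedness of the dominated functionals, for sequences. On the corner
  of a finite sum of minimal projections a functional is determined by its values at the finitely
  many \<open>u i\<close>; outside it, all the functionals are uniformly small.\<close>

lemma dominated_sequence_close:
  assumes at: "atomic A" and \<phi>: "positive_functional \<phi>" "\<phi> id_blinfun = 1" "normal_functional A \<phi>"
    and \<psi>: "\<And>n. positive_functional (\<psi> n)"
      "\<And>n a. a \<in> A \<Longrightarrow> positive_op a \<Longrightarrow> Re (\<psi> n a) \<le> C * Re (\<phi> a)"
    and \<epsilon>: "\<epsilon> > 0"
  shows "\<exists>m n::nat. m < n \<and> (\<forall>a\<in>A. cmod (\<psi> m a - \<psi> n a) \<le> \<epsilon> * norm a)"
proof -
  have \<psi>1: "Re (\<psi> n id_blinfun) \<le> C" for n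
    using \<psi>(2)[OF id_mem positive_op_id] \<phi>(2) by simp
  have C0: "0 \<le> C"
    using order_trans[OF positive_functional_Re[OF \<psi>(1) id_mem positive_op_id] \<psi>1] .
  \<comment> \<open>The error \<epsilon> is shared out as one quarter for each of the two
    compressions and one half for the corner; \<open>C + 1\<close> and \<open>S + 1\<close> below
    keep the denominators positive.\<close>
  define \<eta> where "\<eta> = \<epsilon> / (8 * (C + 1))"
  have \<eta>: "\<eta> > 0" using \<epsilon> C0 by (simp add: \<eta>_def)
  have C\<eta>: "2 * C * \<eta> \<le> \<epsilon> / 4" using \<epsilon> C0 by (simp add: \<eta>_def field_simps)
  obtain F where F: "orthogonal_minimal F" "finite F" "cmod (\<phi> (\<Sum>F) - \<phi> id_blinfun) < \<eta>\<^sup>2"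
    using normal_approx_minimal_sum[OF at \<phi>(3), of "\<eta>\<^sup>2"] \<eta> by auto
  let ?p = "\<Sum>F"
  note p = orthogonal_minimal_sum(1,2)[OF F(1,2)]
  have "\<forall>i\<in>F \<times> F. \<exists>u. u \<in> A \<and> (\<exists>K. \<forall>a\<in>A. \<exists>\<alpha>. fst i \<odot> a \<odot> snd i = \<alpha> *\<^sub>C u \<and> cmod \<alpha> \<le> K * norm a)"
    using F(1) minimal_corner unfolding orthogonal_minimal_def by (simp add: Bex_def)
  then obtain u where "\<forall>i\<in>F \<times> F. u i \<in> A \<and> (\<exists>K. \<forall>a\<in>A. \<exists>\<alpha>. fst i \<odot> a \<odot> snd i = \<alpha> *\<^sub>C u i \<and> cmod \<alpha> \<le> K * norm a)"
    by metis
  then obtain K where uA: "\<And>i. i \<in> F \<times> F \<Longrightarrow> u i \<in> A"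
    and K: "\<And>i a. i \<in> F \<times> F \<Longrightarrow> a \<in> A \<Longrightarrow> \<exists>\<alpha>. fst i \<odot> a \<odot> snd i = \<alpha> *\<^sub>C u i \<and> cmod \<alpha> \<le> K i * norm a"
    by metis
  define S where "S = (\<Sum>i\<in>F \<times> F. \<bar>K i\<bar>)"
  have S: "0 \<le> S" by (simp add: S_def sum_nonneg)
  define \<delta> where "\<delta> = \<epsilon> / (2 * (S + 1))"
  have \<delta>: "\<delta> > 0" using \<epsilon> S by (simp add: \<delta>_def)
  have S\<delta>: "S * \<delta> \<le> \<epsilon> / 2" using \<epsilon> S by (simp add: \<delta>_def field_simps)
  have bd: "cmod (\<psi> n (u i)) \<le> C * norm (u i)" if "i \<in> F \<times> F" for n i
    using functional_bound[OF \<psi>(1) uA[OF that], of n] mult_right_mono[OF \<psi>1[of n], of "norm (u i)"] by simp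
  obtain m n :: nat where mn: "m < n" "\<And>i. i \<in> F \<times> F \<Longrightarrow> cmod (\<psi> m (u i) - \<psi> n (u i)) < \<delta>"
    by (rule finite_close_indices[of "F \<times> F" "\<lambda>n i. \<psi> n (u i)", OF _ bd \<delta>]) (use F(2) in auto)
  show ?thesis
  proof (intro exI conjI ballI, rule mn(1))
    fix a assume a: "a \<in> A"
    have FA: "e \<in> A" if "e \<in> F" for e
      using F(1) that by (simp add: orthogonal_minimal_def minimal_projection_def)
    have "?p \<odot> a \<odot> ?p = (\<Sum>i\<in>F \<times> F. fst i \<odot> a \<odot> snd i)"
      unfolding blinfun_compose.sum_left blinfun_compose.sum_right
      by (subst sum.swap) (simp add: sum.cartesian_product case_prod_beta)
    then have "\<psi> k (?p \<odot> a \<odot> ?p) = (\<Sum>i\<in>F \<times> F. \<psi> k (fst i \<odot> a \<odot> snd i))" for k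
      using a FA by (simp, intro positive_functional_sum[OF \<psi>(1)]) (auto simp: mem_intros)
    then have "cmod (\<psi> m (?p \<odot> a \<odot> ?p) - \<psi> n (?p \<odot> a \<odot> ?p)) \<le>
        (\<Sum>i\<in>F \<times> F. cmod (\<psi> m (fst i \<odot> a \<odot> snd i) - \<psi> n (fst i \<odot> a \<odot> snd i)))"
      by (simp add: norm_sum flip: sum_subtractf)
    also have "\<dots> \<le> (\<Sum>i\<in>F \<times> F. \<bar>K i\<bar> * norm a * \<delta>)"
    proof (rule sum_mono)
      fix i assume i: "i \<in> F \<times> F"
      obtain \<alpha> where \<alpha>: "fst i \<odot> a \<odot> snd i = \<alpha> *\<^sub>C u i" "cmod \<alpha> \<le> K i * norm a" using K[OF i a] by blast
      have "cmod (\<psi> m (fst i \<odot> a \<odot> snd i) - \<psi> n (fst i \<odot> a \<odot> snd i)) = cmod \<alpha> * cmod (\<psi> m (u i) - \<psi> n (u i))"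
        unfolding \<alpha>(1) positive_functional_scaleC[OF \<psi>(1) uA[OF i]] by (simp add: norm_mult flip: right_diff_distrib)
      also have "\<dots> \<le> (\<bar>K i\<bar> * norm a) * \<delta>"
        using \<alpha>(2) mn(2)[OF i] mult_right_mono[OF abs_ge_self[of "K i"], of "norm a"] by (intro mult_mono) auto
      finally show "cmod (\<psi> m (fst i \<odot> a \<odot> snd i) - \<psi> n (fst i \<odot> a \<odot> snd i)) \<le> \<bar>K i\<bar> * norm a * \<delta>" .
    qed
    also have "\<dots> = S * \<delta> * norm a" unfolding S_def sum_distrib_right by (simp add: mult_ac)
    also have "\<dots> \<le> \<epsilon> / 2 * norm a" using S\<delta> by (intro mult_right_mono) auto
    finally have 1: "cmod (\<psi> m (?p \<odot> a \<odot> ?p) - \<psi> n (?p \<odot> a \<odot> ?p)) \<le> \<epsilon> / 2 * norm a" .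
    have 2: "cmod (\<psi> k a - \<psi> k (?p \<odot> a \<odot> ?p)) \<le> \<epsilon> / 4 * norm a" for k
      using dominated_compression[OF \<phi>(1,2) \<psi>(1) \<psi>(2) p less_imp_le[OF F(3)] less_imp_le[OF \<eta>] a, of k]
        mult_right_mono[OF C\<eta>, of "norm a"] by simp
    have "\<psi> m a - \<psi> n a = (\<psi> m a - \<psi> m (?p \<odot> a \<odot> ?p)) + (\<psi> m (?p \<odot> a \<odot> ?p) - \<psi> n (?p \<odot> a \<odot> ?p))
        - (\<psi> n a - \<psi> n (?p \<odot> a \<odot> ?p))" by simp
    also have "cmod \<dots> \<le> \<epsilon> / 4 * norm a + \<epsilon> / 2 * norm a + \<epsilon> / 4 * norm a"
      by (intro order_trans[OF norm_triangle_ineq4] order_trans[OF norm_triangle_ineq] add_mono 1 2)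
    finally show "cmod (\<psi> m a - \<psi> n a) \<le> \<epsilon> * norm a" by (simp add: field_simps)
  qed
qed

text \<open>By minimality, \<open>e \<odot> adj a \<odot> a \<odot> e\<close> is
  \<open>(norm (a x))\<^sup>2\<close> times \<open>e\<close>. Hence \<open>A e\<close> and
  \<open>A x\<close> are isometric, so vectors can be exchanged for elements of
  \<open>A\<close>.\<close>

lemma minimal_norm:
  assumes e: "minimal_projection A e" and x: "e x = x" "norm x = 1" and a: "a \<in> A"
  shows "norm (a \<odot> e) = norm (a x)"
proof (rule antisym)
  have eA: "e \<in> A" and eP: "projection e" using e by (auto simp: minimal_projection_def)
  have "adj a \<odot> a \<in> A" using a by (simp add: mem_intros adj_mem)
  from arg_cong[OF minimal_compress[OF e x this], of "\<lambda>r. r y" for y]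
  have cmp: "e (adj a (a (e y))) = of_real ((norm (a x))\<^sup>2) *\<^sub>C e y" for y
    using a
    by (simp add: cinner_adj_right cinner_self scaleC_blinfun_apply del: of_real_power)
  show "norm (a \<odot> e) \<le> norm (a x)"
  proof (rule norm_blinfun_bound)
    fix y
    have "(norm (a (e y)))\<^sup>2 = inner (e y) (adj a (a (e y)))"
      using inner_adj_left[OF adj_mem[OF a], of "e y" "a (e y)"] a by (simp add: power2_norm_eq_inner)
    also have "\<dots> = inner (e y) (e (adj a (a (e y))))"
      using selfadjoint_inner[OF projection_simps(2)[OF eP], of "e y" "adj a (a (e y))"] by (simp add: projection_simps(3)[OF eP])
    also have "\<dots> = (norm (a x))\<^sup>2 * (norm (e y))\<^sup>2"
      unfolding cmp scaleC_of_real by (simp add: power2_norm_eq_inner)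
    also have "\<dots> \<le> (norm (a x))\<^sup>2 * (norm y)\<^sup>2"
    proof -
      have "(norm (e y))\<^sup>2 \<le> norm y * norm (e y)"
        using projection_inner[OF eP, of y] Cauchy_Schwarz_ineq2[of y "e y"] by simp
      then have "norm (e y) \<le> norm y" by (cases "e y = 0") (auto simp: power2_eq_square)
      then show ?thesis by (intro mult_left_mono power_mono) auto
    qed
    finally have "(norm (a (e y)))\<^sup>2 \<le> (norm (a x) * norm y)\<^sup>2" by (simp add: power_mult_distrib)
    then have "norm (a (e y)) \<le> norm (a x) * norm y" by (rule power2_le_imp_le) simp
    then show "norm ((a \<odot> e) y) \<le> norm (a x) * norm y" by simp
  qed simp
  show "norm (a x) \<le> norm (a \<odot> e)"
    using norm_blinfun[of "a \<odot> e" x] x by simp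
qed

text \<open>
  Identifying \<open>A e\<close> with \<open>A x\<close>, the vector \<open>\<xi>\<close> is \<open>\<rho> (z x)\<close>, where \<open>\<rho>\<close> is the density operator
  of \<open>\<phi>\<close> on that space.
\<close>

definition density_vector ::
    "('h \<Rightarrow>\<^sub>L 'h) \<Rightarrow> 'h \<Rightarrow> (('h \<Rightarrow>\<^sub>L 'h) \<Rightarrow> complex) \<Rightarrow> ('h \<Rightarrow>\<^sub>L 'h) \<Rightarrow> 'h \<Rightarrow> bool"
  where "density_vector e x \<phi> z \<xi> \<longleftrightarrow>
    \<xi> \<in> closure ((\<lambda>a. blinfun_apply a x) ` A) \<and> (\<forall>a\<in>A. inner \<xi> (blinfun_apply a x) = Re (\<phi> (a \<odot> e \<odot> adj z)))"

lemma subspace_A: "subspace A"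
  by (simp add: subspace_def mem_intros)

lemma linear_apply: "linear (\<lambda>a. blinfun_apply a x)" for x :: 'h
  by (intro linearI) (auto simp: blinfun_simps)

text \<open>The functional is bounded by \<open>norm (a \<odot> e) = norm (a x)\<close> up to a
  constant, and this bound also makes it depend only on \<open>a x\<close>. Riesz representation in
  graph form then supplies \<xi>.\<close>

lemma density_vector_exists:
  assumes e: "minimal_projection A e" and x: "e x = x" "norm x = 1"
    and \<phi>: "positive_functional \<phi>" and z: "z \<in> A"
  shows "\<exists>\<xi>. density_vector e x \<phi> z \<xi>"
proof -
  have eA: "e \<in> A" using e by (simp add: minimal_projection_def)
  let ?f = "\<lambda>a. Re (\<phi> (a \<odot> e \<odot> adj z))"
  define G where "G = (\<lambda>a. (blinfun_apply a x, ?f a)) ` A"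
  have m: "a \<odot> e \<odot> adj z \<in> A" if "a \<in> A" for a
    using that eA z by (simp add: mem_intros adj_mem)
  have p1: "0 \<le> Re (\<phi> id_blinfun)" by (rule positive_functional_Re[OF \<phi> id_mem positive_op_id])
  have "subspace G"
  proof (rule subspaceI)
    have "(blinfun_apply 0 x, ?f 0) = 0"
      using positive_functional_scaleR[OF \<phi> zero_mem, of 0] by (simp add: blinfun_compose.zero_left zero_prod_def)
    then show "0 \<in> G" unfolding G_def by (metis (no_types, lifting) imageI zero_mem)
    fix g h c assume "g \<in> G" "h \<in> G"
    then obtain a b where ab: "a \<in> A" "b \<in> A" "g = (a x, ?f a)" "h = (b x, ?f b)" by (auto simp: G_def)
    have "g + h = ((a + b) x, ?f (a + b))"
      using ab by (simp add: blinfun_simps blinfun_compose.add_left positive_functional_add[OF \<phi>] m)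
    then show "g + h \<in> G" using ab unfolding G_def by (metis (no_types, lifting) imageI add_mem)
    have "c *\<^sub>R g = ((c *\<^sub>R a) x, ?f (c *\<^sub>R a))"
      using ab by (simp add: blinfun_simps blinfun_compose.scaleR_left positive_functional_scaleR[OF \<phi>] m)
    then show "c *\<^sub>R g \<in> G" using ab unfolding G_def by (metis (no_types, lifting) imageI scaleR_mem)
  qed
  moreover have "\<bar>s\<bar> \<le> (Re (\<phi> id_blinfun) * norm z) * norm v" if vs: "(v, s) \<in> G" for v s
  proof -
    from vs obtain a where a: "a \<in> A" "v = a x" "s = ?f a" by (auto simp: G_def)
    have "\<bar>s\<bar> \<le> cmod (\<phi> (a \<odot> e \<odot> adj z))" unfolding a(3) by (rule abs_Re_le_cmod)
    also have "\<dots> \<le> Re (\<phi> id_blinfun) * norm (a \<odot> e \<odot> adj z)" by (rule functional_bound[OF \<phi> m[OF a(1)]])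
    also have "\<dots> \<le> Re (\<phi> id_blinfun) * (norm (a \<odot> e) * norm (adj z))"
      by (intro mult_left_mono norm_blinfun_compose p1)
    also have "\<dots> = (Re (\<phi> id_blinfun) * norm z) * norm v"
      unfolding minimal_norm[OF e x a(1)] norm_adj_mult(2)[OF z] a(2) by (simp add: mult_ac)
    finally show ?thesis .
  qed
  ultimately obtain \<xi> where \<xi>: "\<xi> \<in> closure (fst ` G)" "\<And>v s. (v, s) \<in> G \<Longrightarrow> s = inner \<xi> v"
    by (rule riesz_representation_graph) blast+
  have "fst ` G = (\<lambda>a. blinfun_apply a x) ` A" by (auto simp: G_def image_image)
  moreover have "inner \<xi> (a x) = ?f a" if "a \<in> A" for a
    using \<xi>(2)[of "a x" "?f a"] that by (auto simp: G_def)
  ultimately show ?thesis using \<xi>(1) unfolding density_vector_def by (intro exI[of _ \<xi>]) auto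
qed

text \<open>Approximate \<xi> by vectors \<open>r n x\<close>. The defining property of \<xi> and
  Cauchy-Schwarz with weight \<open>c\<close> bound the square of
  \<open>inner \<xi> (c (r n x))\<close> by \<open>\<phi> c\<close> times a value of \<phi> that
  minimality evaluates as \<open>inner (r n x) (c (r n x))\<close> times the constant. In the limit
  one factor \<open>inner \<xi> (c \<xi>)\<close> cancels.\<close>

lemma density_vector_dominated:
  assumes e: "minimal_projection A e" and x: "e x = x" "norm x = 1"
    and \<phi>: "positive_functional \<phi>" and z: "z \<in> A" and \<xi>: "density_vector e x \<phi> z \<xi>"
    and c: "c \<in> A" "positive_op c"
  shows "inner \<xi> (c \<xi>) \<le> Re (\<phi> (z \<odot> e \<odot> adj z)) * Re (\<phi> c)"
proof -
  have eA: "e \<in> A" and eP: "projection e" using e by (auto simp: minimal_projection_def)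
  have adje: "adj e = e" using selfadjoint_iff[OF eA] projection_simps(2)[OF eP] by simp
  note ee = projection_simps(3)[OF eP]
  let ?k = "Re (\<phi> (z \<odot> e \<odot> adj z))"
  have zz: "z \<odot> e \<odot> adj z \<in> A" using z eA by (simp add: mem_intros adj_mem)
  obtain f where f: "\<And>n. f n \<in> (\<lambda>a. blinfun_apply a x) ` A" "f \<longlonglongrightarrow> \<xi>"
    using \<xi> unfolding density_vector_def closure_sequential by blast
  then have "\<forall>n. \<exists>a. a \<in> A \<and> f n = a x" by blast
  then obtain r where r: "\<And>n. r n \<in> A" "\<And>n. f n = r n x" by metis
  have step: "(inner \<xi> (c (f n)))\<^sup>2 \<le> Re (\<phi> c) * (inner (f n) (c (f n)) * ?k)" for n
  proof -
    let ?w = "r n \<odot> e \<odot> adj z"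
    have wA: "?w \<in> A" using r z eA by (simp add: mem_intros adj_mem)
    have adjw: "adj ?w = z \<odot> (e \<odot> adj (r n))"
      using r z eA by (simp add: adj_mult mem_intros adj_mem adje)
    have "inner \<xi> (c (f n)) = Re (\<phi> ((c \<odot> r n) \<odot> e \<odot> adj z))"
      using \<xi> r c(1) unfolding density_vector_def by (metis blinfun_apply_blinfun_compose mult_mem)
    also have "(c \<odot> r n) \<odot> e \<odot> adj z = adj id_blinfun \<odot> c \<odot> ?w"
      by (rule blinfun_eqI) (simp add: adj_id)
    finally have "(inner \<xi> (c (f n)))\<^sup>2 \<le> (cmod (\<phi> (adj id_blinfun \<odot> c \<odot> ?w)))\<^sup>2"
      using abs_Re_le_cmod abs_le_square_iff by (metis abs_norm_cancel)
    also have "\<dots> \<le> Re (\<phi> (adj id_blinfun \<odot> c \<odot> id_blinfun)) * Re (\<phi> (adj ?w \<odot> c \<odot> ?w))"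
      by (rule functional_cauchy_schwarz[OF \<phi> c id_mem wA])
    also have "adj id_blinfun \<odot> c \<odot> id_blinfun = c" by (simp add: adj_id mult_id_left mult_id_right)
    also have "adj ?w \<odot> c \<odot> ?w = cinner (f n) (c (f n)) *\<^sub>C (z \<odot> e \<odot> adj z)"
    proof -
      have "adj (r n) \<odot> c \<odot> r n \<in> A" using r c by (simp add: mem_intros adj_mem)
      from arg_cong[OF minimal_compress[OF e x this], of "\<lambda>r. r y" for y]
      have "e (adj (r n) (c (r n (e y)))) = cinner (f n) (c (f n)) *\<^sub>C e y" for y
        using r
        by (simp add: cinner_adj_right scaleC_blinfun_apply)
      then show ?thesis
        unfolding adjw by (intro blinfun_eqI) (simp add: scaleC_blinfun_apply apply_scaleC[OF z])
    qed
    also have "Re (\<phi> (cinner (f n) (c (f n)) *\<^sub>C (z \<odot> e \<odot> adj z))) = inner (f n) (c (f n)) * ?k"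
      using c(2) by (simp add: positive_functional_scaleC[OF \<phi> zz] positive_op_iff Re_cinner)
    finally show ?thesis .
  qed
  have "(\<lambda>n. (inner \<xi> (c (f n)))\<^sup>2) \<longlonglongrightarrow> (inner \<xi> (c \<xi>))\<^sup>2"
    "(\<lambda>n. Re (\<phi> c) * (inner (f n) (c (f n)) * ?k)) \<longlonglongrightarrow> Re (\<phi> c) * (inner \<xi> (c \<xi>) * ?k)"
    by (intro tendsto_intros f)+
  then have *: "(inner \<xi> (c \<xi>))\<^sup>2 \<le> Re (\<phi> c) * (inner \<xi> (c \<xi>) * ?k)"
    using step by (intro LIMSEQ_le[of "\<lambda>n. (inner \<xi> (c (f n)))\<^sup>2" _ "\<lambda>n. Re (\<phi> c) * (inner (f n) (c (f n)) * ?k)"]) auto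
  show ?thesis
  proof (cases "inner \<xi> (c \<xi>) = 0")
    case True
    have "positive_op (adj (adj z) \<odot> e \<odot> adj z)"
      by (rule positive_conj[OF adj_mem[OF z] projection_simps(4)[OF eP]])
    then have "0 \<le> ?k" using positive_functional_Re[OF \<phi> zz] z by simp
    then show ?thesis using True positive_functional_Re[OF \<phi> c] by simp
  next
    case False
    then have "0 < inner \<xi> (c \<xi>)" using positive_opD[OF c(2), of \<xi>] by simp
    then show ?thesis using * by (simp add: power2_eq_square mult_ac)
  qed
qed

text \<open>Let \<open>x - y\<close> be the component of \<open>x\<close> orthogonal to all density
  vectors. By completeness of \<open>A e\<close> it is \<open>a x\<close> with
  \<open>a \<odot> e = a\<close>. Testing it against the density vector of \<open>z = a\<close>
  gives \<open>\<phi> (a \<odot> adj a) = 0\<close>, so faithfulness gives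
  \<open>a = 0\<close>.\<close>

lemma density_vectors_dense:
  assumes e: "minimal_projection A e" and x: "e x = x" "norm x = 1"
    and \<phi>: "positive_functional \<phi>" "faithful A \<phi>"
  shows "x \<in> closure {\<xi>. \<exists>z\<in>A. density_vector e x \<phi> z \<xi>}"
proof -
  have eA: "e \<in> A" and eP: "projection e" using e by (auto simp: minimal_projection_def)
  define V where "V = (\<lambda>a. blinfun_apply a x) ` A"
  have V: "subspace V" unfolding V_def by (rule linear_subspace_image[OF linear_apply subspace_A])
  have clV: "subspace (closure V)" by (rule subspace_closure[OF V])
  define R where "R = {\<xi>. \<exists>z\<in>A. density_vector e x \<phi> z \<xi>}"
  have RI: "\<xi> \<in> R" if "\<xi> \<in> closure V" "z \<in> A" "\<And>a. a \<in> A \<Longrightarrow> inner \<xi> (a x) = Re (\<phi> (a \<odot> e \<odot> adj z))" for \<xi> z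
    using that by (auto simp: R_def density_vector_def V_def)
  have RD: "\<exists>z\<in>A. \<xi> \<in> closure V \<and> (\<forall>a\<in>A. inner \<xi> (blinfun_apply a x) = Re (\<phi> (a \<odot> e \<odot> adj z)))" if "\<xi> \<in> R" for \<xi>
    using that by (auto simp: R_def density_vector_def V_def)
  have m: "a \<odot> e \<odot> adj z \<in> A" if "a \<in> A" "z \<in> A" for a z
    using that eA by (simp add: mem_intros adj_mem)
  have R: "subspace R"
  proof (rule subspaceI)
    have "adj 0 = (0 :: 'h \<Rightarrow>\<^sub>L 'h)" using adj_diff[OF id_mem id_mem] by simp
    then show "0 \<in> R"
      using positive_functional_scaleR[OF \<phi>(1) zero_mem, of 0] subspace_0[OF clV]
      by (intro RI[OF _ zero_mem]) (auto simp: blinfun_compose.zero_right)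
    fix \<xi> \<zeta> k assume "\<xi> \<in> R" "\<zeta> \<in> R"
    obtain z where z: "z \<in> A" "\<xi> \<in> closure V" "\<And>a. a \<in> A \<Longrightarrow> inner \<xi> (a x) = Re (\<phi> (a \<odot> e \<odot> adj z))"
      using RD[OF \<open>\<xi> \<in> R\<close>] by blast
    obtain w where w: "w \<in> A" "\<zeta> \<in> closure V" "\<And>a. a \<in> A \<Longrightarrow> inner \<zeta> (a x) = Re (\<phi> (a \<odot> e \<odot> adj w))"
      using RD[OF \<open>\<zeta> \<in> R\<close>] by blast
    show "\<xi> + \<zeta> \<in> R"
      by (rule RI[OF subspace_add[OF clV z(2) w(2)] add_mem[OF z(1) w(1)]])
        (simp add: inner_add_left z w adj_add blinfun_compose.add_right positive_functional_add[OF \<phi>(1)] m)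
    show "k *\<^sub>R \<xi> \<in> R"
      by (rule RI[OF subspace_scale[OF clV z(2)] scaleR_mem[OF z(1), of k]])
        (simp add: z adj_scaleR blinfun_compose.scaleR_right positive_functional_scaleR[OF \<phi>(1)] m)
  qed
  obtain y where y: "y \<in> closure R" "\<And>v. v \<in> closure R \<Longrightarrow> inner (x - y) v = 0"
    using orthogonal_decomposition[OF R] by metis
  have "R \<subseteq> closure V" using RD by blast
  then have "y \<in> closure V" using y(1) by (metis closure_closure closure_mono subsetD)
  moreover have "x \<in> closure V"
    unfolding V_def by (rule subsetD[OF closure_subset]) (use id_mem in force)
  ultimately have "x - y \<in> closure V" using clV by (simp add: subspace_diff)
  then obtain f where f: "\<And>n. f n \<in> V" "f \<longlonglongrightarrow> x - y" unfolding closure_sequential by blast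
  then have "\<forall>n. \<exists>a. a \<in> A \<and> f n = a x" unfolding V_def by blast
  then obtain r where r: "\<And>n. r n \<in> A" "\<And>n. f n = r n x" by metis
  \<comment> \<open>The isometry between \<open>A x\<close> and \<open>A e\<close> lifts convergence
    of vectors to norm convergence of operators, whose limit stays in \<open>A\<close>.\<close>
  have "Cauchy (\<lambda>n. r n \<odot> e)"
  proof -
    have "dist (r m \<odot> e) (r n \<odot> e) = dist (f m) (f n)" for m n
      using minimal_norm[OF e x diff_mem[OF r(1)[of m] r(1)[of n]]]
      by (simp add: dist_norm r(2) blinfun_simps blinfun_compose.diff_left)
    moreover have "Cauchy f" using f(2) LIMSEQ_imp_Cauchy by blast
    ultimately show ?thesis unfolding Cauchy_def by simp
  qed
  then obtain a where a: "(\<lambda>n. r n \<odot> e) \<longlonglongrightarrow> a" using convergent_eq_Cauchy by blast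
  have aA: "a \<in> A" by (rule norm_limit_mem[OF a]) (simp add: mult_mem r eA)
  have "(\<lambda>n. (r n \<odot> e) \<odot> e) \<longlonglongrightarrow> a \<odot> e" by (intro tendsto_intros a)
  moreover have "(r n \<odot> e) \<odot> e = r n \<odot> e" for n by (rule blinfun_eqI) (simp add: projection_simps(3)[OF eP])
  ultimately have ae: "a \<odot> e = a" using a by (simp add: LIMSEQ_unique)
  have "(\<lambda>n. (r n \<odot> e) x) \<longlonglongrightarrow> a x" by (intro blinfun.tendsto a tendsto_const)
  then have "f \<longlonglongrightarrow> a x" by (simp add: x r(2)[abs_def])
  then have ax: "a x = x - y" using f(2) LIMSEQ_unique by blast
  obtain \<xi> where \<xi>: "density_vector e x \<phi> a \<xi>" using density_vector_exists[OF e x \<phi>(1) aA] by blast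
  then have "\<xi> \<in> closure R" using aA closure_subset unfolding R_def by fastforce
  then have "inner \<xi> (a x) = 0" using y(2) ax by (simp add: inner_commute)
  then have "Re (\<phi> (a \<odot> adj a)) = 0" using \<xi> aA ae unfolding density_vector_def by auto
  moreover have pos: "positive_op (a \<odot> adj a)" and aa: "a \<odot> adj a \<in> A"
    using positive_adj_mult[OF adj_mem[OF aA]] aA by (simp_all add: mem_intros adj_mem)
  ultimately have "\<phi> (a \<odot> adj a) = 0"
    using positive_functional_Im[OF \<phi>(1) aa pos] by (simp add: complex_eq_iff)
  then have "a \<odot> adj a = 0" using \<phi>(2) pos aa unfolding faithful_def by blast
  then have "norm (adj a) = 0" using norm_adj_mult(1)[OF adj_mem[OF aA]] aA by simp
  then have "a = 0" using norm_adj_mult(2)[OF aA] by simp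
  then have "x = y" using ax by simp
  then show ?thesis using y(1) by (simp add: R_def)
qed

text \<open>If the negative part \<open>n\<close> is non-zero, choose a minimal \<open>e\<close>
  below its range projection. The positive part vanishes on the range of \<open>e\<close>, so the
  hypothesis forces the form of \<open>n\<close> to vanish at a unit vector there; then
  \<open>n\<close> and its range projection annihilate that vector, a contradiction.\<close>

lemma positive_if_minimal:
  assumes at: "atomic A" and b: "b \<in> A" "selfadjoint b"
    and min: "\<And>e x. minimal_projection A e \<Longrightarrow> e x = x \<Longrightarrow> norm x = 1 \<Longrightarrow> 0 \<le> inner x (b x)"
  shows "positive_op b"
proof -
  obtain p n where pn: "p \<in> A" "n \<in> A" "positive_op p" "positive_op n" "b = p - n" "p \<odot> n = 0" "n \<odot> p = 0"
    using positive_negative_parts[OF b] by blast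
  have sn: "selfadjoint n" using pn positive_selfadjoint by blast
  have "n = 0"
  proof (rule ccontr)
    assume n0: "n \<noteq> 0"
    obtain q where q: "q \<in> A" "projection q" "q \<odot> n = n" "\<And>x. n x = 0 \<Longrightarrow> q x = 0"
        "\<And>x. q x \<in> closure (span (\<Union>a\<in>{n}. range (blinfun_apply a)))"
      by (rule range_projection[of "{n}"]) (use pn sn in auto)
    have "q \<noteq> 0" using q(3) n0 by (auto simp: blinfun_compose.zero_left)
    then obtain e where e: "minimal_projection A e" "le_op e q" using at q unfolding atomic_def by blast
    have "q \<odot> e = e" using e projection_le_iff[OF _ q(2)] by (simp add: minimal_projection_def)
    then have qe: "q (e y) = e y" for y by (metis blinfun_apply_blinfun_compose)
    obtain x where x: "e x = x" "norm x = 1" using minimal_unit_vector[OF e(1)] by blast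
    have qx: "q x = x" using qe[of x] x by simp
    have "closure (span (\<Union>a\<in>{n}. range (blinfun_apply a))) \<subseteq> {v. p v = 0}"
    proof (rule closure_minimal)
      show "span (\<Union>a\<in>{n}. range (blinfun_apply a)) \<subseteq> {v. p v = 0}"
      proof (rule span_minimal)
        show "(\<Union>a\<in>{n}. range (blinfun_apply a)) \<subseteq> {v. p v = 0}"
          using pn(6) by (auto simp flip: blinfun_apply_blinfun_compose)
      qed (simp add: subspace_def blinfun_simps)
      show "closed {v. p v = 0}" by (intro closed_Collect_eq continuous_intros)
    qed
    then have "p x = 0" using q(5)[of x] qx by auto
    then have "inner x (n x) \<le> 0" using min[OF e(1) x] by (simp add: pn(5) blinfun_simps)
    then have "inner x (n x) = 0" using positive_opD[OF pn(4), of x] by simp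
    then have "q x = 0" using positive_op_kernel[OF sn pn(4)] q(4) by blast
    then show False using qx x by simp
  qed
  then show ?thesis using pn by simp
qed

lemma vector_functional:
  shows "positive_functional (\<lambda>a. cinner \<xi> (a \<xi>))"
  unfolding positive_functional_def dual_space_def functional_le_def
proof (intro conjI CollectI ballI allI impI)
  have "cmod (cinner \<xi> (a \<xi>)) \<le> (norm \<xi>)\<^sup>2 * norm a" for a :: "'h \<Rightarrow>\<^sub>L 'h"
  proof -
    have "cmod (cinner \<xi> (a \<xi>)) \<le> norm \<xi> * norm (a \<xi>)" by (rule cmod_cinner_le)
    also have "\<dots> \<le> norm \<xi> * (norm a * norm \<xi>)" by (intro mult_left_mono norm_blinfun) simp
    finally show ?thesis by (simp add: power2_eq_square mult_ac)
  qed
  then show "\<exists>K. \<forall>a\<in>A. cmod (cinner \<xi> (blinfun_apply a \<xi>)) \<le> K * norm a" by blast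
qed (auto simp: blinfun_simps cinner_simps positive_op_def)

end

section \<open>Positive unital maps\<close>

locale positive_unital_map = von_neumann A for A :: "('h::chilbert_space \<Rightarrow>\<^sub>L 'h) set" +
  fixes T :: "('h \<Rightarrow>\<^sub>L 'h) \<Rightarrow> ('h \<Rightarrow>\<^sub>L 'h)"
  assumes T_linear: "linear_operator_on A T" and T_positive: "positive_operator_on A T"
    and T_id: "T id_blinfun = id_blinfun"
begin

lemma T_mem: "a \<in> A \<Longrightarrow> T a \<in> A"
  and T_add: "a \<in> A \<Longrightarrow> b \<in> A \<Longrightarrow> T (a + b) = T a + T b"
  and T_scaleC: "a \<in> A \<Longrightarrow> T (c *\<^sub>C a) = c *\<^sub>C T a"
  using T_linear by (auto simp: linear_operator_on_def)

lemma T_pos: "a \<in> A \<Longrightarrow> positive_op a \<Longrightarrow> positive_op (T a)"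
  using T_positive by (auto simp: positive_operator_on_def positive_cone_def)

lemma T_scaleR: "a \<in> A \<Longrightarrow> T (r *\<^sub>R a) = r *\<^sub>R T a"
  by (metis T_scaleC scaleC_of_real)

lemma T_diff: "a \<in> A \<Longrightarrow> b \<in> A \<Longrightarrow> T (a - b) = T a - T b"
  using T_add[of "a - b" b] by (simp add: diff_mem)

lemma T_selfadjoint: assumes "a \<in> A" "selfadjoint a" shows "selfadjoint (T a)"
proof -
  obtain b c where bc: "b \<in> A" "c \<in> A" "positive_op b" "positive_op c" "a = b - c"
    using positive_negative_parts[OF assms] by blast
  then have "selfadjoint (T b)" "selfadjoint (T c)"
    using positive_selfadjoint T_mem T_pos by blast+
  then show ?thesis by (simp add: bc T_diff selfadjoint_diff)
qed

lemma T_adj: assumes "a \<in> A" shows "T (adj a) = adj (T a)"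
proof -
  obtain b c where bc: "b \<in> A" "c \<in> A" "selfadjoint b" "selfadjoint c" "a = b + \<i> *\<^sub>C c"
    using real_imaginary_parts[OF assms] by blast
  have adj: "adj b = b" "adj c = c" "adj (T b) = T b" "adj (T c) = T c"
    using bc T_selfadjoint T_mem selfadjoint_iff by auto
  show ?thesis
    using bc T_mem by (simp add: adj_add adj_scaleC T_add T_scaleC mem_intros adj)
qed

text \<open>\<open>T\<close> preserves positivity of \<open>norm a\<close> times the identity, plus
  or minus \<open>a\<close>, and fixes the identity.\<close>

lemma T_selfadjoint_norm_le:
  assumes a: "a \<in> A" "selfadjoint a"
  shows "norm (T a) \<le> norm a"
proof (rule norm_selfadjoint_le[OF T_selfadjoint[OF a]])
  fix x
  have le: "inner x (T b x) \<le> norm a * (norm x)\<^sup>2" if b: "b \<in> A" "selfadjoint b" "norm b = norm a" for b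
  proof -
    have "positive_op (T (norm a *\<^sub>R id_blinfun - b))"
      using le_norm_id[OF b(1,2), of "norm a"] b by (intro T_pos) (auto simp: mem_intros)
    then have "0 \<le> inner x ((norm a *\<^sub>R id_blinfun - T b) x)"
      using b by (simp add: T_diff T_scaleR T_id mem_intros positive_opD)
    then show ?thesis by (simp add: blinfun_simps inner_diff_right power2_norm_eq_inner)
  qed
  have "inner x (T ((- 1) *\<^sub>R a) x) \<le> norm a * (norm x)\<^sup>2"
    by (rule le) (use a scaleR_mem[of a "- 1"] selfadjoint_scaleR[of a "- 1"] in auto)
  then show "\<bar>inner x (T a x)\<bar> \<le> norm a * (norm x)\<^sup>2"
    using le[OF a refl] unfolding T_scaleR[OF a(1)] by (simp add: blinfun_simps)
qed simp

lemma T_norm_le2: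
  assumes a: "a \<in> A"
  shows "norm (T a) \<le> 2 * norm a"
proof -
  obtain b c where bc: "b \<in> A" "c \<in> A" "selfadjoint b" "selfadjoint c" "a = b + \<i> *\<^sub>C c"
    "norm b \<le> norm a" "norm c \<le> norm a"
    using real_imaginary_parts[OF a] by blast
  have "norm (\<i> *\<^sub>C T c) \<le> norm (T c)"
    by (rule norm_blinfun_bound) (simp_all add: scaleC_blinfun_apply norm_scaleC norm_blinfun)
  then have "norm (T a) \<le> norm (T b) + norm (T c)"
    using bc norm_triangle_ineq[of "T b" "\<i> *\<^sub>C T c"] by (simp add: T_add T_scaleC mem_intros)
  then show ?thesis using T_selfadjoint_norm_le[OF bc(1,3)] T_selfadjoint_norm_le[OF bc(2,4)] bc by simp
qed

lemma positive_functional_comp: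
  assumes \<psi>: "positive_functional \<psi>"
  shows "positive_functional (\<lambda>a. \<psi> (T a))"
  unfolding positive_functional_def dual_space_def functional_le_def
proof (intro conjI CollectI ballI allI impI)
  have "cmod (\<psi> (T a)) \<le> (Re (\<psi> id_blinfun) * 2) * norm a" if "a \<in> A" for a
  proof -
    have "cmod (\<psi> (T a)) \<le> Re (\<psi> id_blinfun) * norm (T a)" by (rule functional_bound[OF \<psi> T_mem[OF that]])
    also have "\<dots> \<le> Re (\<psi> id_blinfun) * (2 * norm a)"
      by (intro mult_left_mono T_norm_le2 that positive_functional_Re[OF \<psi>] id_mem positive_op_id)
    finally show ?thesis by simp
  qed
  then show "\<exists>K. \<forall>a\<in>A. cmod (\<psi> (T a)) \<le> K * norm a" by blast
  show "\<psi> (T a) - 0 \<in> \<real>\<^sub>\<ge>\<^sub>0" if "a \<in> A" "positive_op a" for a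
    using that positive_functional_Re[OF \<psi>] positive_functional_Im[OF \<psi>] T_mem T_pos by (simp add: nonneg_Reals_iff)
qed (auto simp: T_add T_scaleC T_mem positive_functional_add[OF \<psi>] positive_functional_scaleC[OF \<psi>])

lemma funpow_mem: "a \<in> A \<Longrightarrow> (T ^^ n) a \<in> A"
  by (induction n) (auto simp: T_mem)

lemma funpow_pos: "a \<in> A \<Longrightarrow> positive_op a \<Longrightarrow> positive_op ((T ^^ n) a)"
  by (induction n) (auto simp: T_pos funpow_mem)

lemma selfadjoint_if_image:
  assumes inj: "inj_on T A" and b: "b \<in> A" "selfadjoint (T b)"
  shows "selfadjoint b"
proof -
  have "T (adj b) = T b" using b T_adj T_mem selfadjoint_iff by simp
  then have "adj b = b" using inj b adj_mem by (auto dest: inj_onD)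
  then show ?thesis using b selfadjoint_iff by simp
qed

lemma inverse_positive_if_doubly_power_bounded:
  assumes at: "atomic A" and \<phi>: "\<phi> \<in> predual A" "state A \<phi>" "faithful A \<phi>"
    and le: "functional_le A (dual_operator T \<phi>) \<phi>"
    and dpb: "doubly_power_bounded_on A T"
  shows "positive_operator_on A (inv_into A T)"
proof -
  define S where "S = inv_into A T"
  have bij: "bij_betw T A A" using dpb by (simp add: doubly_power_bounded_on_def)
  obtain K0 where K0: "\<And>n a. a \<in> A \<Longrightarrow> norm (int_power A T n a) \<le> K0 * norm a"
    using dpb unfolding doubly_power_bounded_on_def by blast
  define K where "K = \<bar>K0\<bar> + 1"
  have SA: "S a \<in> A" and TS: "T (S a) = a" if "a \<in> A" for a
    using bij that by (auto simp: S_def bij_betw_def inv_into_into f_inv_into_f)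
  have SnA: "(S ^^ n) a \<in> A" if "a \<in> A" for n a using that by (induction n) (auto simp: SA)
  have TnSn: "(T ^^ n) ((S ^^ n) a) = a" if "a \<in> A" for n a
  proof (induction n)
    case (Suc n)
    then show ?case using TS[OF SnA[OF that]] by (simp only: funpow_Suc_right[of n T] funpow.simps(2)[of n S] o_apply)
  qed simp
  have SK: "norm ((S ^^ m) a) \<le> K * norm a" if "a \<in> A" for m a
  proof -
    have "int_power A T (- int m) a = (S ^^ m) a" by (cases "m = 0") (simp_all add: int_power_def S_def)
    then have "norm ((S ^^ m) a) \<le> K0 * norm a" using K0[OF that, of "- int m"] by simp
    also have "\<dots> \<le> K * norm a" by (intro mult_right_mono) (auto simp: K_def)
    finally show ?thesis .
  qed
  have pf: "positive_functional \<phi>" and nf: "normal_functional A \<phi>" and \<phi>1: "\<phi> id_blinfun = 1"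
    using \<phi> by (auto simp: positive_functional_def state_def predual_def)
  have Re_T: "Re (\<phi> (T a)) \<le> Re (\<phi> a)" if "a \<in> A" "positive_op a" for a
    using le that unfolding functional_le_def dual_operator_def by (auto simp: nonneg_Reals_iff)
  have "positive_op (S a)" if a: "a \<in> A" "positive_op a" for a
  proof -
    define b where "b = S a"
    have b: "b \<in> A" "T b = a" using SA TS a by (auto simp: b_def)
    have sb: "selfadjoint b"
      by (rule selfadjoint_if_image[OF bij_betw_imp_inj_on[OF bij] b(1)])
        (simp add: b(2) positive_selfadjoint[OF a])
    \<comment> \<open>Approximate recurrence: if the form of \<open>b\<close> were
      \<open>- d < 0\<close> at \<xi>, two functionals \<open>\<psi> m\<close> and
      \<open>\<psi> n\<close> closer than \<open>d\<close> at \<open>(S ^^ m) b\<close> would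
      compare this negative value with a non-negative one.\<close>
    have dom: "0 \<le> inner \<xi> (b \<xi>)" if \<xi>: "\<And>c. c \<in> A \<Longrightarrow> positive_op c \<Longrightarrow> inner \<xi> (c \<xi>) \<le> C * Re (\<phi> c)" for \<xi> C
    proof (rule ccontr)
      define d where "d = - inner \<xi> (b \<xi>)"
      assume "\<not> 0 \<le> inner \<xi> (b \<xi>)"
      then have d: "d > 0" by (simp add: d_def)
      define \<psi> where "\<psi> n c = cinner \<xi> ((T ^^ n) c \<xi>)" for n and c :: "'h \<Rightarrow>\<^sub>L 'h"
      have "positive_functional (\<psi> n) \<and> (\<forall>c\<in>A. positive_op c \<longrightarrow> Re (\<psi> n c) \<le> C * Re (\<phi> c))" for n
      proof (induction n)
        case 0
        show ?case using vector_functional[of \<xi>] \<xi> by (simp add: \<psi>_def[abs_def] Re_cinner)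
      next
        case (Suc n)
        have \<psi>S: "\<psi> (Suc n) = (\<lambda>c. \<psi> n (T c))" by (simp add: \<psi>_def fun_eq_iff funpow_swap1)
        have C0: "0 \<le> C"
          using order_trans[OF positive_opD[OF positive_op_id] \<xi>[OF id_mem positive_op_id]] \<phi>1 by simp
        have "Re (\<psi> n (T c)) \<le> C * Re (\<phi> c)" if "c \<in> A" "positive_op c" for c
        proof -
          have "Re (\<psi> n (T c)) \<le> C * Re (\<phi> (T c))" using Suc that T_mem T_pos by blast
          also have "\<dots> \<le> C * Re (\<phi> c)" by (intro mult_left_mono Re_T that C0)
          finally show ?thesis .
        qed
        then show ?case using Suc positive_functional_comp by (simp add: \<psi>S)
      qed
      then have \<psi>: "\<And>n. positive_functional (\<psi> n)" "\<And>n c. c \<in> A \<Longrightarrow> positive_op c \<Longrightarrow> Re (\<psi> n c) \<le> C * Re (\<phi> c)"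
        by auto
      \<comment> \<open>A positive bound for the norms of all \<open>(S ^^ m) b\<close>; then
        \<epsilon> times \<open>M\<close> is \<open>d / 2\<close>, strictly below
        \<open>d\<close>.\<close>
      define M where "M = K * norm b + 1"
      define \<epsilon> where "\<epsilon> = d / (2 * M)"
      have Kb: "M > 0" by (simp add: M_def K_def add_nonneg_pos)
      have \<epsilon>: "\<epsilon> > 0" using d Kb by (simp add: \<epsilon>_def)
      obtain m n :: nat where mn: "m < n" and close: "\<And>a. a \<in> A \<Longrightarrow> cmod (\<psi> m a - \<psi> n a) \<le> \<epsilon> * norm a"
        using dominated_sequence_close[of \<phi> \<psi> C, OF at pf \<phi>1 nf \<psi> \<epsilon>] by auto
      \<comment> \<open>One power of \<open>T\<close> beyond \<open>m\<close> is spent on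
        \<open>T b = a\<close>: \<open>T ^^ n\<close> after \<open>S ^^ m\<close> maps
        \<open>b\<close> to \<open>(T ^^ k) a\<close>, which is positive.\<close>
      define k where "k = n - Suc m"
      have n: "n = Suc k + m" using mn by (simp add: k_def)
      have "(T ^^ n) ((S ^^ m) b) = (T ^^ k) a"
        unfolding n funpow_add o_apply TnSn[OF b(1)] by (simp add: funpow_swap1 b)
      then have "\<psi> n ((S ^^ m) b) = cinner \<xi> ((T ^^ k) a \<xi>)" by (simp add: \<psi>_def)
      moreover have "\<psi> m ((S ^^ m) b) = cinner \<xi> (b \<xi>)" by (simp add: \<psi>_def TnSn[OF b(1)])
      ultimately have "cmod (cinner \<xi> (b \<xi>) - cinner \<xi> ((T ^^ k) a \<xi>)) \<le> \<epsilon> * norm ((S ^^ m) b)"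
        using close[OF SnA[OF b(1), of m]] by simp
      also have "\<dots> \<le> \<epsilon> * M" using SK[OF b(1), of m] \<epsilon> by (intro mult_left_mono) (auto simp: M_def)
      also have "\<dots> < d" using d Kb by (simp add: \<epsilon>_def)
      finally have "cmod (cinner \<xi> (b \<xi>) - cinner \<xi> ((T ^^ k) a \<xi>)) < d" .
      then have "\<bar>inner \<xi> (b \<xi>) - inner \<xi> ((T ^^ k) a \<xi>)\<bar> < d"
        using abs_Re_le_cmod[of "cinner \<xi> (b \<xi>) - cinner \<xi> ((T ^^ k) a \<xi>)"] by (simp add: Re_cinner)
      moreover have "0 \<le> inner \<xi> ((T ^^ k) a \<xi>)" by (rule positive_opD[OF funpow_pos[OF a]])
      ultimately show False by (simp add: d_def)
    qed
    have "positive_op b"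
    proof (rule positive_if_minimal[OF at b(1) sb])
      fix e x assume e: "minimal_projection A e" and x: "e x = x" "norm x = 1"
      have "{\<xi>. \<exists>z\<in>A. density_vector e x \<phi> z \<xi>} \<subseteq> {\<xi>. 0 \<le> inner \<xi> (b \<xi>)}"
      proof safe
        fix \<xi> z assume z: "z \<in> A" "density_vector e x \<phi> z \<xi>"
        show "0 \<le> inner \<xi> (b \<xi>)" by (rule dom[OF density_vector_dominated[OF e x pf z]])
      qed
      moreover have "closed {\<xi>. 0 \<le> inner \<xi> (b \<xi>)}" by (intro closed_Collect_le continuous_intros)
      ultimately show "0 \<le> inner x (b x)"
        using density_vectors_dense[OF e x pf \<phi>(3)] closure_minimal by blast
    qed
    then show ?thesis by (simp add: b_def)
  qed
  then show ?thesis unfolding positive_operator_on_def positive_cone_def S_def[symmetric] using SA by blast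
qed

end

section \<open>Kadison's inequality and Jordan homomorphisms\<close>

text \<open>
  If \<open>k\<close> and \<open>m\<close> stand for the weight \<open>a\<^sup>k (1 - a)\<^sup>m\<close>, the sum obtained after \<open>n\<close> splittings is the
  second moment of the Bernstein polynomials of degree \<open>n\<close>, which exceeds \<open>a\<^sup>2\<close> by \<open>a (1 - a) / n\<close>.
\<close>

lemma bernstein_moment_nonneg:
  fixes X Y Z :: "nat \<Rightarrow> nat \<Rightarrow> real"
  assumes X: "\<And>k m. X k m = X (Suc k) m + X k (Suc m)"
    and Y: "\<And>k m. Y k m = Y (Suc k) m + Y k (Suc m)"
    and Z: "\<And>k m. Z k m = Z (Suc k) m + Z k (Suc m)"
    and pos: "\<And>k m t. 0 \<le> t\<^sup>2 * X k m + 2 * t * Y k m + Z k m"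
  shows "0 \<le> X 2 0 + 2 * Y 1 0 + Z 0 0"
proof -
  \<comment> \<open>Binomial expectation in closed form: starting from weight \<open>(k, m)\<close>,
    each of \<open>j\<close> splittings adds \<open>h\<close> to the node \<open>s\<close> or leaves
    it. If \<open>X\<close> comes from weights in \<open>a\<close>, the \<open>X\<close> part is the
    second moment, with mean \<open>s + j h a\<close> and variance
    \<open>j h\<^sup>2 a (1 - a)\<close>.\<close>
  define F where "F h j s k m = s\<^sup>2 * X k m + 2 * s * (real j * h) * X (Suc k) m
      + (real j * h)\<^sup>2 * X (Suc (Suc k)) m + real j * h\<^sup>2 * (X (Suc k) m - X (Suc (Suc k)) m)
      + 2 * (s * Y k m + real j * h * Y (Suc k) m) + Z k m" for h j s k m
  \<comment> \<open>Pascal's rule: the first splitting sends the node to \<open>s + h\<close> with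
    factor \<open>a\<close>, or keeps it with factor \<open>1 - a\<close>.\<close>
  have split: "F h (Suc j) s k m = F h j (s + h) (Suc k) m + F h j s k (Suc m)" for h j s k m
  proof -
    have *: "X k (Suc m) = X k m - X (Suc k) m" "Y k (Suc m) = Y k m - Y (Suc k) m"
      "Z k (Suc m) = Z k m - Z (Suc k) m" for k m
      using X[of k m] Y[of k m] Z[of k m] by simp_all
    show ?thesis
      unfolding F_def * by (simp only: of_nat_Suc power2_eq_square) algebra
  qed
  have F: "0 \<le> F h j s k m" for h j s k m
  proof (induction j arbitrary: s k m)
    case 0
    show ?case using pos[of s k m] by (simp add: F_def)
  qed (simp add: split)
  \<comment> \<open>With \<open>j = Suc n\<close> and \<open>h = 1 / Suc n\<close> the mean becomes
    exactly \<open>a\<close>, and the variance carries the factor \<open>1 / Suc n\<close>.\<close>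
  have "0 \<le> (1 / real (Suc n)) * (X 1 0 - X 2 0) + (X 2 0 + 2 * Y 1 0 + Z 0 0)" for n
  proof -
    have "real (Suc n) * (1 / real (Suc n)) = 1" "real (Suc n) * (1 / real (Suc n))\<^sup>2 = 1 / real (Suc n)"
      by (simp_all add: power2_eq_square)
    then show ?thesis
      using F[of "1 / real (Suc n)" "Suc n" 0 0 0] unfolding F_def by (simp add: numeral_2_eq_2)
  qed
  moreover have "(\<lambda>n. (1 / real (Suc n)) * (X 1 0 - X 2 0) + (X 2 0 + 2 * Y 1 0 + Z 0 0))
      \<longlonglongrightarrow> 0 * (X 1 0 - X 2 0) + (X 2 0 + 2 * Y 1 0 + Z 0 0)"
    using LIMSEQ_inverse_real_of_nat by (intro tendsto_intros) (simp add: inverse_eq_divide)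
  ultimately show ?thesis using LIMSEQ_le_const by fastforce
qed

context von_neumann
begin

text \<open>The square root \<open>s\<close> of \<open>a\<close> commutes with \<open>b\<close> as
  well, so \<open>a \<odot> b = s \<odot> b \<odot> s\<close>.\<close>

lemma positive_commuting_mult:
  assumes "a \<in> A" "positive_op a" "b \<in> A" "positive_op b" "a \<odot> b = b \<odot> a"
  shows "positive_op (a \<odot> b)"
proof -
  obtain s where s: "s \<in> A" "positive_op s" "s \<odot> s = a" and sb: "s \<odot> b = b \<odot> s"
    using sqrt_exists[OF assms(1,2)] assms(5) by blast
  have "adj s = s" using s positive_selfadjoint selfadjoint_iff by blast
  then have "positive_op (s \<odot> b \<odot> s)" using positive_conj[OF s(1) assms(4)] by simp
  also have "s \<odot> b \<odot> s = a \<odot> b"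
    using arg_cong[OF s(3), of "\<lambda>r. r y" for y] arg_cong[OF sb[symmetric], of "\<lambda>r. r y" for y]
    by (intro blinfun_eqI) simp
  finally show ?thesis .
qed

fun weight :: "('h \<Rightarrow>\<^sub>L 'h) \<Rightarrow> nat \<Rightarrow> nat \<Rightarrow> ('h \<Rightarrow>\<^sub>L 'h)" where
  "weight a 0 0 = id_blinfun"
| "weight a 0 (Suc m) = (id_blinfun - a) \<odot> weight a 0 m"
| "weight a (Suc k) m = a \<odot> weight a k m"

lemma weight_commute: "a \<odot> weight a k m = weight a k m \<odot> a"
proof -
  have "a (weight a k m v) = weight a k m (a v)" for v
    by (induction a k m rule: weight.induct) (simp_all add: blinfun_simps)
  then show ?thesis by (intro blinfun_eqI) simp
qed

lemma weight_Suc_right: "weight a k (Suc m) = (id_blinfun - a) \<odot> weight a k m"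
proof -
  have "weight a k (Suc m) v = (id_blinfun - a) (weight a k m v)" for v
    by (induction k) (simp_all add: blinfun_simps)
  then show ?thesis by (intro blinfun_eqI) simp
qed

lemma weight_split: "weight a k m = weight a (Suc k) m + weight a k (Suc m)"
  by (rule blinfun_eqI) (simp add: weight_Suc_right blinfun_simps)

lemma weight_positive:
  assumes "a \<in> A" "positive_op a" "positive_op (id_blinfun - a)"
  shows "weight a k m \<in> A" "positive_op (weight a k m)"
proof -
  have "weight a k m \<in> A \<and> positive_op (weight a k m)"
    using assms
  proof (induction a k m rule: weight.induct)
    case (2 a m)
    have "(id_blinfun - a) \<odot> weight a 0 m = weight a 0 m \<odot> (id_blinfun - a)"
      using weight_commute[of a 0 m] by (simp add: blinfun_compose.diff_left blinfun_compose.diff_right mult_id_left mult_id_right)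
    then show ?case using 2 by (auto simp: mem_intros intro: positive_commuting_mult)
  next
    case (3 a k m)
    then show ?case using weight_commute[of a k m] by (auto simp: mem_intros intro: positive_commuting_mult)
  qed (simp add: id_mem positive_op_id)
  then show "weight a k m \<in> A" "positive_op (weight a k m)" by auto
qed

lemma positive_antisym:
  assumes "a \<in> A" "positive_op a" "positive_op (- a)"
  shows "a = 0"
proof -
  have "inner x (a x) = 0" for x
    using positive_opD[OF assms(2), of x] positive_opD[OF assms(3), of x] by (simp add: blinfun_simps)
  then have "a x = 0" for x
    using positive_op_kernel[OF positive_selfadjoint[OF assms(1,2)] assms(2)] by blast
  then show ?thesis by (intro blinfun_eqI) simp
qed

end

context positive_unital_map
begin

text \<open>The images \<open>T (weight a k m)\<close> are positive, so evaluating them at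
  \<open>t *\<^sub>R x + y\<close> gives the quadratic polynomials required by the Bernstein moment
  lemma.\<close>

lemma kadison_inequality_unit_interval:
  assumes a: "a \<in> A" "positive_op a" "positive_op (id_blinfun - a)"
  shows "positive_op (T (a \<odot> a) - T a \<odot> T a)"
proof (rule positive_op_selfadjointI)
  have sa: "selfadjoint a" using a positive_selfadjoint by blast
  have sT: "selfadjoint (T a)" by (rule T_selfadjoint[OF a(1) sa])
  show "selfadjoint (T (a \<odot> a) - T a \<odot> T a)"
    by (intro selfadjoint_diff T_selfadjoint selfadjoint_mult sa sT mem_intros a refl)
  fix x
  \<comment> \<open>This choice completes the square: the mixed term is -2 times, and the last term
    once, the squared norm of \<open>T a x\<close>.\<close>
  define y where "y = - T a x"
  note w = weight_positive[OF a]
  have Ts: "T (weight a k m) = T (weight a (Suc k) m) + T (weight a k (Suc m))" for k m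
    by (subst weight_split) (rule T_add[OF w(1) w(1)])
  have "0 \<le> inner x (T (weight a 2 0) x) + 2 * inner x (T (weight a 1 0) y) + inner y (T (weight a 0 0) y)"
  proof (rule bernstein_moment_nonneg[of "\<lambda>k m. inner x (T (weight a k m) x)" "\<lambda>k m. inner x (T (weight a k m) y)"
        "\<lambda>k m. inner y (T (weight a k m) y)"])
    fix k m
    show "inner x (T (weight a k m) x) = inner x (T (weight a (Suc k) m) x) + inner x (T (weight a k (Suc m)) x)"
      "inner x (T (weight a k m) y) = inner x (T (weight a (Suc k) m) y) + inner x (T (weight a k (Suc m)) y)"
      "inner y (T (weight a k m) y) = inner y (T (weight a (Suc k) m) y) + inner y (T (weight a k (Suc m)) y)"
      by (subst Ts, simp only: blinfun.add_left inner_add_right)+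
    fix t :: real
    let ?W = "T (weight a k m)"
    have pW: "positive_op ?W" and sW: "selfadjoint ?W"
      using T_pos w positive_selfadjoint T_mem by blast+
    have "inner y (?W x) = inner x (?W y)" using selfadjoint_inner[OF sW, of x y] by (simp add: inner_commute)
    then show "0 \<le> t\<^sup>2 * inner x (?W x) + 2 * t * inner x (?W y) + inner y (?W y)"
      using positive_opD[OF pW, of "t *\<^sub>R x + y"]
      by (simp add: blinfun_simps inner_add_left inner_add_right power2_eq_square algebra_simps)
  qed
  moreover have "weight a 2 0 = a \<odot> a" "weight a 1 0 = a" "weight a 0 0 = id_blinfun"
    by (simp_all add: numeral_2_eq_2 mult_id_right)
  moreover have "inner x (T a (T a x)) = inner (T a x) (T a x)" by (simp add: selfadjoint_inner[OF sT])
  ultimately show "0 \<le> inner x ((T (a \<odot> a) - T a \<odot> T a) x)"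
    by (simp add: y_def T_id blinfun_simps inner_diff_right)
qed

text \<open>The affine map \<open>a \<mapsto> (a + c) / (2 c)\<close> moves the spectrum into the
  unit interval. As \<open>T\<close> is unital, linear and constant terms cancel in the defect,
  which is only scaled by \<open>(1 / (2 * c))\<^sup>2\<close>.\<close>

lemma kadison_inequality:
  assumes a: "a \<in> A" "selfadjoint a"
  shows "positive_op (T (a \<odot> a) - T a \<odot> T a)"
proof -
  define c where "c = norm a + 1"
  have c: "c > 0" by (simp add: c_def add_nonneg_pos)
  define b where "b = (1 / (2 * c)) *\<^sub>R (a + c *\<^sub>R id_blinfun)"
  have bA: "b \<in> A" using a by (simp add: b_def mem_intros)
  have "selfadjoint (- a)" using selfadjoint_scaleR[OF a(2), of "- 1"] by simp
  then have p1: "positive_op (c *\<^sub>R id_blinfun - - a)" "positive_op (c *\<^sub>R id_blinfun - a)"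
    using le_norm_id[OF minus_mem[OF a(1)], of c] le_norm_id[OF a, of c] by (simp_all add: c_def)
  have "b = (1 / (2 * c)) *\<^sub>R (c *\<^sub>R id_blinfun - - a)" by (simp add: b_def add.commute)
  then have b1: "positive_op b" using positive_op_scaleR[OF p1(1), of "1 / (2 * c)"] c by simp
  have "id_blinfun - b = (1 / (2 * c)) *\<^sub>R (c *\<^sub>R id_blinfun - a)"
  proof -
    have "id_blinfun = (1 / (2 * c)) *\<^sub>R ((2 * c) *\<^sub>R (id_blinfun :: 'h \<Rightarrow>\<^sub>L 'h))" using c by simp
    then have "id_blinfun - b = (1 / (2 * c)) *\<^sub>R ((2 * c) *\<^sub>R id_blinfun - (a + c *\<^sub>R id_blinfun))"
      unfolding b_def by (simp only: scaleR_diff_right)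
    also have "(2 * c) *\<^sub>R id_blinfun - (a + c *\<^sub>R id_blinfun) = c *\<^sub>R id_blinfun - a"
      by (simp add: scaleR_2 flip: scaleR_scaleR)
    finally show ?thesis .
  qed
  then have b2: "positive_op (id_blinfun - b)" using positive_op_scaleR[OF p1(2), of "1 / (2 * c)"] c by simp
  have K: "positive_op (T (b \<odot> b) - T b \<odot> T b)" by (rule kadison_inequality_unit_interval[OF bA b1 b2])
  define k where "k = 1 / (2 * c)"
  have sq: "k *\<^sub>R (p + c *\<^sub>R id_blinfun) \<odot> k *\<^sub>R (p + c *\<^sub>R id_blinfun)
      = (k * k) *\<^sub>R (p \<odot> p + (2 * c) *\<^sub>R p + (c * c) *\<^sub>R id_blinfun)" for p :: "'h \<Rightarrow>\<^sub>L 'h"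
  proof -
    have "(2 * c) *\<^sub>R w = c *\<^sub>R w + c *\<^sub>R w" for w :: 'h by (simp flip: scaleR_left.add)
    then have "(p + c *\<^sub>R id_blinfun) \<odot> (p + c *\<^sub>R id_blinfun) = p \<odot> p + (2 * c) *\<^sub>R p + (c * c) *\<^sub>R id_blinfun"
      by (intro blinfun_eqI) (simp add: blinfun_simps scaleR_add_right)
    then show ?thesis by (simp only: blinfun_compose.scaleR_left blinfun_compose.scaleR_right scaleR_scaleR)
  qed
  have "b \<odot> b = (k * k) *\<^sub>R (a \<odot> a + (2 * c) *\<^sub>R a + (c * c) *\<^sub>R id_blinfun)"
    using sq[of a] by (simp only: b_def k_def)
  then have Tbb: "T (b \<odot> b) = (k * k) *\<^sub>R (T (a \<odot> a) + (2 * c) *\<^sub>R T a + (c * c) *\<^sub>R id_blinfun)"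
    using a by (simp add: T_scaleR T_add mem_intros T_id)
  have Tb: "T b = k *\<^sub>R (T a + c *\<^sub>R id_blinfun)"
    using a by (simp add: b_def k_def T_scaleR T_add mem_intros T_id)
  have "T b \<odot> T b = (k * k) *\<^sub>R (T a \<odot> T a + (2 * c) *\<^sub>R T a + (c * c) *\<^sub>R id_blinfun)"
    unfolding Tb by (rule sq)
  then have "T (b \<odot> b) - T b \<odot> T b = (k * k) *\<^sub>R (T (a \<odot> a) - T a \<odot> T a)"
    unfolding Tbb by (simp flip: scaleR_diff_right)
  then have "(1 / (k * k)) *\<^sub>R (T (b \<odot> b) - T b \<odot> T b) = T (a \<odot> a) - T a \<odot> T a"
    using c by (simp add: k_def)
  then show ?thesis using positive_op_scaleR[OF K, of "1 / (k * k)"] by simp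
qed

end

section \<open>Order isomorphisms: Jordan structure and isometry\<close>

locale order_isomorphism = positive_unital_map A T for A :: "('h::chilbert_space \<Rightarrow>\<^sub>L 'h) set" and T +
  assumes bij: "bij_betw T A A" and inv_positive: "positive_operator_on A (inv_into A T)"
begin

lemma inv_mem: "a \<in> A \<Longrightarrow> inv_into A T a \<in> A" and T_inv: "a \<in> A \<Longrightarrow> T (inv_into A T a) = a"
  and inv_T: "a \<in> A \<Longrightarrow> inv_into A T (T a) = a"
  using bij by (auto simp: bij_betw_def inv_into_into f_inv_into_f)

lemma positive_unital_map_inv: "positive_unital_map A (inv_into A T)"
proof (unfold_locales)
  show "linear_operator_on A (inv_into A T)"
    unfolding linear_operator_on_def
  proof (intro conjI ballI allI)
    show "inv_into A T a \<in> A" if "a \<in> A" for a by (rule inv_mem[OF that])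
    show "inv_into A T (a + b) = inv_into A T a + inv_into A T b" if "a \<in> A" "b \<in> A" for a b
      using inv_T[of "inv_into A T a + inv_into A T b"] that by (simp add: T_add T_inv inv_mem mem_intros)
    show "inv_into A T (c *\<^sub>C a) = c *\<^sub>C inv_into A T a" if "a \<in> A" for a c
      using inv_T[of "c *\<^sub>C inv_into A T a"] that by (simp add: T_scaleC T_inv inv_mem mem_intros)
  qed
  show "positive_operator_on A (inv_into A T)" by (rule inv_positive)
  show "inv_into A T id_blinfun = id_blinfun" using inv_T[OF id_mem] by (simp add: T_id)
qed

lemma order_isomorphism_inv: "order_isomorphism A (inv_into A T)"
proof -
  interpret S: positive_unital_map A "inv_into A T" by (rule positive_unital_map_inv)
  show ?thesis
  proof
    show bS: "bij_betw (inv_into A T) A A" by (rule bij_betw_inv_into[OF bij])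
    have "inv_into A (inv_into A T) a = T a" if "a \<in> A" for a
      using inv_into_f_f[OF bij_betw_imp_inj_on[OF bS] T_mem[OF that]] inv_T[OF that] by simp
    then show "positive_operator_on A (inv_into A (inv_into A T))"
      using T_mem T_pos by (auto simp: positive_operator_on_def positive_cone_def)
  qed
qed

text \<open>The Kadison defect \<open>d\<close> of \<open>T\<close> is positive, hence so is its
  preimage. Kadison's inequality for the inverse at \<open>T a\<close> says that this preimage is
  also negative, so both vanish.\<close>

lemma T_square_selfadjoint:
  assumes a: "a \<in> A" "selfadjoint a"
  shows "T (a \<odot> a) = T a \<odot> T a"
proof -
  interpret S: positive_unital_map A "inv_into A T" by (rule positive_unital_map_inv)
  define d where "d = T (a \<odot> a) - T a \<odot> T a"
  have dA: "d \<in> A" using a by (simp add: d_def mem_intros T_mem)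
  have pd: "positive_op d" unfolding d_def by (rule kadison_inequality[OF a])
  have "inv_into A T d = a \<odot> a - inv_into A T (T a \<odot> T a)"
    using a by (simp add: d_def S.T_diff mem_intros T_mem inv_T)
  moreover have "positive_op (inv_into A T (T a \<odot> T a) - a \<odot> a)"
    using S.kadison_inequality[OF T_mem[OF a(1)] T_selfadjoint[OF a]] a by (simp add: inv_T)
  ultimately have "positive_op (- inv_into A T d)" by simp
  then have "inv_into A T d = 0" using positive_antisym[OF S.T_mem[OF dA] S.T_pos[OF dA pd]] by blast
  then have "d = 0" using T_inv[OF dA] T_scaleR[OF zero_mem, of 0] by simp
  then show ?thesis by (simp add: d_def)
qed

lemma T_jordan_selfadjoint:
  assumes a: "a \<in> A" "selfadjoint a" and b: "b \<in> A" "selfadjoint b"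
  shows "T (a \<odot> b + b \<odot> a) = T a \<odot> T b + T b \<odot> T a"
proof -
  have "a \<odot> b + b \<odot> a = (a + b) \<odot> (a + b) - a \<odot> a - b \<odot> b"
    by (simp add: blinfun_compose.add_left blinfun_compose.add_right)
  then have "T (a \<odot> b + b \<odot> a) = T ((a + b) \<odot> (a + b)) - T (a \<odot> a) - T (b \<odot> b)"
    using a b by (simp add: T_diff mem_intros)
  also have "\<dots> = (T a + T b) \<odot> (T a + T b) - T a \<odot> T a - T b \<odot> T b"
    using a b by (simp add: T_square_selfadjoint T_add mem_intros selfadjoint_add)
  finally show ?thesis by (simp add: blinfun_compose.add_left blinfun_compose.add_right)
qed

lemma T_square:
  assumes a: "a \<in> A"
  shows "T (a \<odot> a) = T a \<odot> T a"
proof -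
  obtain b c where bc: "b \<in> A" "c \<in> A" "selfadjoint b" "selfadjoint c" "a = b + \<i> *\<^sub>C c"
    using real_imaginary_parts[OF a] by blast
  have sq: "(p + \<i> *\<^sub>C q) \<odot> (p + \<i> *\<^sub>C q) = p \<odot> p - q \<odot> q + \<i> *\<^sub>C (p \<odot> q + q \<odot> p)" if "p \<in> A" "q \<in> A" for p q
  proof (rule blinfun_eqI)
    fix v
    have "\<i> *\<^sub>C \<i> *\<^sub>C w = - w" for w :: 'h by (simp add: scaleC_scaleC scaleC_minus1)
    then show "((p + \<i> *\<^sub>C q) \<odot> (p + \<i> *\<^sub>C q)) v = (p \<odot> p - q \<odot> q + \<i> *\<^sub>C (p \<odot> q + q \<odot> p)) v"
      using that by (simp add: blinfun_simps scaleC_add_right apply_scaleC)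
  qed
  have "T a = T b + \<i> *\<^sub>C T c" using bc by (simp add: T_add T_scaleC mem_intros)
  then show ?thesis
    using bc by (simp add: sq T_add T_diff T_scaleC mem_intros T_mem T_square_selfadjoint
        T_jordan_selfadjoint[symmetric])
qed

lemma T_jordan:
  assumes a: "a \<in> A" and b: "b \<in> A"
  shows "T (a \<odot> b + b \<odot> a) = T a \<odot> T b + T b \<odot> T a"
proof -
  have "a \<odot> b + b \<odot> a = (a + b) \<odot> (a + b) - a \<odot> a - b \<odot> b"
    by (simp add: blinfun_compose.add_left blinfun_compose.add_right)
  then have "T (a \<odot> b + b \<odot> a) = T ((a + b) \<odot> (a + b)) - T (a \<odot> a) - T (b \<odot> b)"
    using a b by (simp add: T_diff mem_intros)
  also have "\<dots> = (T a + T b) \<odot> (T a + T b) - T a \<odot> T a - T b \<odot> T b"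
    using a b by (simp add: T_square T_add mem_intros)
  finally show ?thesis by (simp add: blinfun_compose.add_left blinfun_compose.add_right)
qed

text \<open>In terms of the anticommutator, \<open>2 a b a = {a, {a, b}} - {a\<^sup>2, b}\<close>,
  so the triple product is preserved although products need not be.\<close>

lemma T_triple:
  assumes a: "a \<in> A" and b: "b \<in> A"
  shows "T (a \<odot> b \<odot> a) = T a \<odot> T b \<odot> T a"
proof -
  have triple: "p \<odot> q \<odot> p = (1/2) *\<^sub>R ((p \<odot> (p \<odot> q + q \<odot> p) + (p \<odot> q + q \<odot> p) \<odot> p)
      - (p \<odot> p \<odot> q + q \<odot> (p \<odot> p)))" for p q :: "'h \<Rightarrow>\<^sub>L 'h"
  proof -
    have "(p \<odot> (p \<odot> q + q \<odot> p) + (p \<odot> q + q \<odot> p) \<odot> p) - (p \<odot> p \<odot> q + q \<odot> (p \<odot> p)) = 2 *\<^sub>R (p \<odot> q \<odot> p)"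
      by (rule blinfun_eqI) (simp add: blinfun_simps scaleR_2)
    then show ?thesis by simp
  qed
  show ?thesis
    unfolding triple[of a b] triple[of "T a" "T b"]
    using a b by (simp add: T_scaleR T_diff T_jordan T_square mem_intros)
qed

text \<open>
  Since \<open>\<parallel>a a\<^sup>* a\<parallel> = \<parallel>a\<parallel>\<^sup>3\<close>, the crude bound \<open>2\<close> on the norm of \<open>T\<close> improves to its cube root, and
  so on.
\<close>

lemma T_norm_power_le:
  assumes "a \<in> A"
  shows "norm (T a) ^ (3 ^ n) \<le> 2 * norm a ^ (3 ^ n)"
  using assms
proof (induction n arbitrary: a)
  case 0
  then show ?case using T_norm_le2 by simp
next
  case (Suc n)
  define b where "b = a \<odot> adj a \<odot> a"
  have bA: "b \<in> A" using Suc.prems by (simp add: b_def mem_intros adj_mem)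
  define c where "c = T a"
  have cA: "c \<in> A" using Suc.prems T_mem by (simp add: c_def)
  have Tb: "T b = c \<odot> adj c \<odot> c"
    using Suc.prems by (simp add: b_def c_def T_triple adj_mem T_adj)
  \<comment> \<open>Only this half of the cube identity is delicate: with
    \<open>h = adj c \<odot> c\<close>, the fourth power of \<open>norm c\<close> is the norm of
    \<open>h \<odot> h = adj c \<odot> T b\<close>, and one factor \<open>norm c\<close>
    cancels.\<close>
  have "norm c ^ 3 \<le> norm (T b)"
  proof (cases "c = 0")
    case False
    let ?h = "adj c \<odot> c"
    have hA: "?h \<in> A" and adjh: "adj ?h = ?h"
      using cA by (simp_all add: mem_intros adj_mem adj_mult)
    have "norm c ^ 4 = (norm ?h)\<^sup>2" using norm_adj_mult(1)[OF cA] by (simp flip: power_mult)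
    also have "\<dots> = norm (?h \<odot> ?h)" using norm_adj_mult(1)[OF hA] adjh by simp
    also have "?h \<odot> ?h = adj c \<odot> T b" unfolding Tb by (rule blinfun_eqI) simp
    also have "norm (adj c \<odot> T b) \<le> norm c * norm (T b)"
      using norm_blinfun_compose[of "adj c" "T b"] norm_adj_mult(2)[OF cA] by simp
    finally have "norm c * norm c ^ 3 \<le> norm c * norm (T b)" by (simp add: power_def numeral_eq_Suc)
    then show ?thesis using False by simp
  qed simp
  then have "(norm c ^ 3) ^ (3 ^ n) \<le> norm (T b) ^ (3 ^ n)" by (rule power_mono) simp
  also have "\<dots> \<le> 2 * norm b ^ (3 ^ n)" by (rule Suc.IH[OF bA])
  finally have cb: "(norm c ^ 3) ^ (3 ^ n) \<le> 2 * norm b ^ (3 ^ n)" .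
  have "norm b \<le> norm a ^ 3"
  proof -
    have "norm b \<le> norm (a \<odot> adj a) * norm a" unfolding b_def by (rule norm_blinfun_compose)
    also have "\<dots> \<le> (norm a * norm a) * norm a"
      using norm_blinfun_compose[of a "adj a"] norm_adj_mult(2)[OF Suc.prems] by (intro mult_right_mono) auto
    finally show ?thesis by (simp add: power3_eq_cube)
  qed
  then have "norm b ^ (3 ^ n) \<le> (norm a ^ 3) ^ (3 ^ n)" by (rule power_mono) simp
  then have "(norm c ^ 3) ^ (3 ^ n) \<le> 2 * (norm a ^ 3) ^ (3 ^ n)" using cb by linarith
  then show ?case by (simp add: c_def power_mult)
qed

lemma T_norm_le:
  assumes a: "a \<in> A"
  shows "norm (T a) \<le> norm a"
proof (rule ccontr)
  assume "\<not> norm (T a) \<le> norm a"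
  then have less: "norm a < norm (T a)" by simp
  have a0: "norm a > 0"
  proof (rule ccontr)
    assume "\<not> norm a > 0"
    then have "norm (T a) \<le> 0" using T_norm_le2[OF a] by simp
    then show False using less by simp
  qed
  define r where "r = norm (T a) / norm a"
  have r: "r > 1" using less a0 by (simp add: r_def)
  then obtain n where n: "2 < r ^ n" using real_arch_pow by blast
  have "n \<le> 3 ^ n" using less_exp[of n] power_mono[of 2 3 n] by simp
  then have "r ^ n \<le> r ^ (3 ^ n)" using r by (intro power_increasing) auto
  \<comment> \<open>The bound 2 does not depend on \<open>n\<close>, whereas powers of a ratio above
    1 are unbounded.\<close>
  also have "\<dots> \<le> 2" using T_norm_power_le[OF a, of n] a0 by (simp add: r_def power_divide field_simps)
  finally show False using n by simp
qed

lemma isometry: "isometry_on A T"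
  unfolding isometry_on_def
proof
  fix a assume a: "a \<in> A"
  interpret S: order_isomorphism A "inv_into A T" by (rule order_isomorphism_inv)
  show "norm (T a) = norm a"
    using T_norm_le[OF a] S.T_norm_le[OF T_mem[OF a]] inv_T[OF a] by simp
qed

end

context positive_unital_map
begin

text \<open>The constant \<open>c = norm a\<close> is large enough: \<open>0 \<le> a \<le> c\<close>
  gives \<open>norm (c - a) \<le> c\<close>, and the isometry carries this back to
  \<open>norm (c - b) \<le> c\<close>, whence \<open>b = c - (c - b)\<close> is positive.\<close>

lemma inverse_positive_if_isometry:
  assumes bij: "bij_betw T A A" and iso: "isometry_on A T"
  shows "positive_operator_on A (inv_into A T)"
proof -
  have "positive_op (inv_into A T a)" "inv_into A T a \<in> A" if a: "a \<in> A" "positive_op a" for a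
  proof -
    define b where "b = inv_into A T a"
    have b: "b \<in> A" "T b = a"
      using bij a by (auto simp: b_def bij_betw_def inv_into_into f_inv_into_f)
    have sa: "selfadjoint a" by (rule positive_selfadjoint[OF a])
    have sb: "selfadjoint b"
      by (rule selfadjoint_if_image[OF bij_betw_imp_inj_on[OF bij] b(1)]) (simp add: b(2) sa)
    define c where "c = norm a"
    define d where "d = c *\<^sub>R id_blinfun - b"
    have dA: "d \<in> A" using b by (simp add: d_def mem_intros)
    have Td: "T d = c *\<^sub>R id_blinfun - a" using b by (simp add: d_def T_diff T_scaleR T_id mem_intros)
    have "norm (T d) \<le> c"
    proof (rule norm_selfadjoint_le)
      show "selfadjoint (T d)" unfolding Td by (intro selfadjoint_intros sa)
      fix x
      have "0 \<le> inner x ((c *\<^sub>R id_blinfun - a) x)"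
        using le_norm_id[OF a(1) sa, of c] by (simp add: c_def positive_opD)
      then show "\<bar>inner x (T d x)\<bar> \<le> c * (norm x)\<^sup>2"
        using positive_opD[OF a(2), of x] unfolding Td by (simp add: blinfun_simps inner_diff_right power2_norm_eq_inner)
    qed (simp add: c_def)
    then have "norm d \<le> c" using iso dA by (simp add: isometry_on_def)
    moreover have "selfadjoint d" unfolding d_def by (intro selfadjoint_intros sb)
    ultimately have "positive_op (c *\<^sub>R id_blinfun - d)" using dA by (intro le_norm_id)
    then show "positive_op (inv_into A T a)" "inv_into A T a \<in> A" using b(1) by (simp_all add: d_def b_def)
  qed
  then show ?thesis unfolding positive_operator_on_def positive_cone_def by auto
qed

lemma doubly_power_bounded_if_isometry:
  assumes bij: "bij_betw T A A" and iso: "isometry_on A T"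
  shows "doubly_power_bounded_on A T"
proof -
  have S: "inv_into A T a \<in> A \<and> norm (inv_into A T a) = norm a" if "a \<in> A" for a
    using bij iso that unfolding isometry_on_def by (metis bij_betw_def f_inv_into_f inv_into_into)
  have T: "T a \<in> A \<and> norm (T a) = norm a" if "a \<in> A" for a
    using iso T_mem that by (simp add: isometry_on_def)
  have funpow: "(f ^^ n) a \<in> A \<and> norm ((f ^^ n) a) = norm a"
    if "a \<in> A" "\<And>b. b \<in> A \<Longrightarrow> f b \<in> A \<and> norm (f b) = norm b" for f :: "('h \<Rightarrow>\<^sub>L 'h) \<Rightarrow> ('h \<Rightarrow>\<^sub>L 'h)" and n a
    using that by (induction n) auto
  have "norm (int_power A T n a) \<le> 1 * norm a" if "a \<in> A" for n a
    using funpow[OF that, of T] funpow[OF that, of "inv_into A T"] S T by (simp add: int_power_def)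
  then show ?thesis using bij unfolding doubly_power_bounded_on_def by blast
qed

end

theorem theorem8p2:
  fixes A :: "('h::chilbert_space \<Rightarrow>\<^sub>L 'h) set"
    and \<phi> :: "('h \<Rightarrow>\<^sub>L 'h) \<Rightarrow> complex"
    and T :: "('h \<Rightarrow>\<^sub>L 'h) \<Rightarrow> ('h \<Rightarrow>\<^sub>L 'h)"
  assumes "von_neumann_algebra A"
    and "atomic A"
    and "\<phi> \<in> predual A"
    and "state A \<phi>"
    and "faithful A \<phi>"
    and "linear_operator_on A T"
    and "positive_operator_on A T"
    and "T id_blinfun = id_blinfun"
    and "functional_le A (dual_operator T \<phi>) \<phi>"
  shows "(bij_betw T A A \<and> positive_operator_on A (inv_into A T) \<longleftrightarrow>
          bij_betw T A A \<and> isometry_on A T) \<and>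
         (bij_betw T A A \<and> isometry_on A T \<longleftrightarrow> doubly_power_bounded_on A T)"
proof -
  interpret positive_unital_map A T by unfold_locales (fact assms)+
  have ab: "isometry_on A T" if "bij_betw T A A" "positive_operator_on A (inv_into A T)"
  proof -
    interpret order_isomorphism A T by unfold_locales (fact that)+
    show ?thesis by (rule isometry)
  qed
  have ca: "bij_betw T A A \<and> positive_operator_on A (inv_into A T)" if "doubly_power_bounded_on A T"
    using inverse_positive_if_doubly_power_bounded[OF assms(2-5,9) that] that
    by (simp add: doubly_power_bounded_on_def)
  show ?thesis
    using ab ca inverse_positive_if_isometry doubly_power_bounded_if_isometry by blast
qed

end
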